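(* Let $S$ be a compact connected surface with non-empty boundary and negative Euler characteristic, let $T$ be an ideal triangulation of $S$ with set of edges $E$, and let $T(S)$ be the Teichmüller space of $S$. For $\lambda\in\mathbf{R}$ let $\Psi_\lambda:T(S)\to\mathbf{R}^E$ be the map sending a hyperbolic metric to its $\psi_\lambda$ edge invariant. Then for every $\lambda\in\mathbf{R}$, $\Psi_\lambda(T(S))$ is the set of points $z\in\mathbf{R}^E$ satisfying: 1. $z(e)<2\int_0^\infty\cosh^\lambda(t)\,dt$ for each edge $e$; 2. $\sum_{i=1}^n z(e_i)>-2\int_0^\infty\cosh^\lambda(t)\,dt$ for each fundamental edge path $(H_0,e_1,H_1,\dots,e_n,H_n)$; 3. $\sum_{i=1}^n z(e_i)>0$ for each fundamental edge cycle $(H_0,e_1,H_1,\dots,e_n,H_n=H_0)$. Thus $\Psi_\lambda(T(S))$ is an open convex polytope. Moreover, $$\Psi_{\lambda_1}(T(S))\subset\Psi_{\lambda_2}(T(S))\subset\Psi_0(T(S))=\Psi_{\lambda_3}(T(S))$$ for $\lambda_1<\lambda_2<0<\lambda_3$. The intersection $\bigcap_{\lambda\le 0}\Psi_\lambda(T(S))$ is empty.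
   Context: **Teichmüller space.** $T(S)$ is the space of isotopy classes of hyperbolic metrics with totally geodesic boundary on $S$, where two such metrics are isotopic if there is an isometry between them that is isotopic to the identity. **Ideal triangulation.** A colored hexagon is a hexagon with three pairwise non-adjacent edges labelled red and the opposite edges labelled black. Take a finite disjoint union of colored hexagons and identify all red edges in pairs by homeomorphisms; the quotient is a compact surface with non-empty boundary together with an ideal triangulation. The 2-cells (hexagons) of the ideal triangulation are the quotients of the hexagons, its edges are the quotients of the red edges, and its A-arcs are the quotients of the black edges. $E$ is the set of all edges. Every compact surface with non-empty boundary and negative Euler characteristic admits an ideal triangulation. **Length coordinates.** For any $l_1,l_2,l_3>0$ there is a unique (up to isometry preserving coloring) colored hyperbolic right-angled hexagon whose three red edges have lengths $l_1,l_2,l_3$. A hyperbolic metric $d$ on $S$ determines $l_d:E\to\mathbf{R}_{>0}$, where $l_d(e)$ is the length of the shortest geodesic arc homotopic to $e$ relative to the boundary of $S$. Conversely, $l:E\to\mathbf{R}_{>0}$ determines a hyperbolic metric with totally geodesic boundary by making each 2-cell with red edges $e_i,e_j,e_k$ the colored hyperbolic right-angled hexagon with red edge lengths $l(e_i),l(e_j),l(e_k)$. In this way $T(S)$ is identified with $\mathbf{R}_{>0}^E$. **Edge invariant.** For a hyperbolic metric in $T(S)$, the $\psi_\lambda$ edge invariant is the function $\psi_\lambda:E\to\mathbf{R}$ defined by $$\psi_\lambda(e)=\int_0^{\frac{a+b-c}{2}}\cosh^\lambda(t)\,dt+\int_0^{\frac{a'+b'-c'}{2}}\cosh^\lambda(t)\,dt,$$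 where $e$ is an edge shared by two hyperbolic right-angled hexagons; in the first hexagon $c$ is the length of the A-arc facing (opposite to) $e$ and $a,b$ are the lengths of the two A-arcs adjacent to $e$; $a',b',c'$ are the corresponding lengths in the second hexagon. **Edge paths and cycles.** An edge path $(H_0,e_1,H_1,\dots,e_n,H_n)$ is a collection of hexagons and edges in the ideal triangulation such that, for $i=1,\dots,n$, $H_{i-1}$ and $H_i$ are two distinct hexagons sharing the edge $e_i$. An edge path is an edge cycle if $H_0=H_n$. A fundamental edge path (respectively fundamental edge cycle) is an edge path (respectively edge cycle) such that each edge of the ideal triangulation appears at most twice in it. **Convention.** The integral $\int_0^\infty\cosh^\lambda(t)\,dt$ equals $+\infty$ when $\lambda\ge 0$, in which case conditions 1 and 2 impose no restriction.
   Formalization: Edge paths and cycles may not backtrack (a hexagon is not left through the side by which it was entered, also at H_n = H_0 in a cycle), and a step may cross an edge glued from two red edges of one hexagon, so H_{i-1} = H_i is allowed; with the literal definition the claim is false. *)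

theory Defs
  imports "HOL-Analysis.Analysis"
begin

section \<open>Ideal triangulations\<close>

text \<open>
  The model colored hexagon is the regular Euclidean hexagon with vertices the sixth roots of unity.
  Its red edges are numbered 0, 1, 2 in cyclic order, red edge \<open>i\<close> joining the vertices \<open>2 i\<close> and
  \<open>2 i + 1\<close>; the other three edges are black.
\<close>

definition hex_vertex :: "nat \<Rightarrow> complex" where
  "hex_vertex k = cis (real k * pi / 3)"

definition model_hexagon :: "complex set" where
  "model_hexagon = convex hull (hex_vertex ` {..<6})"

definition red_edge :: "nat \<Rightarrow> complex set" where
  "red_edge i = closed_segment (hex_vertex (2 * i)) (hex_vertex (2 * i + 1))"

definition sides :: "('h \<times> nat) set" where
  "sides = UNIV \<times> {..<3}"

text \<open>
  The finite types \<open>'h\<close> and \<open>'e\<close> index the hexagons and the edges; \<open>ed (h, i)\<close> is the edge which is the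
  image of red edge \<open>i\<close> of hexagon \<open>h\<close>, and \<open>q\<close> is the quotient map from the disjoint union of the
  hexagons to the surface. The two red edges identified with each other may belong to the same hexagon,
  and no orientability is assumed. A space \<open>S\<close> with such a structure is automatically a compact
  surface with non-empty boundary, and its Euler characteristic is \<open>- CARD('h) / 2 < 0\<close>.
\<close>

definition ideal_triangulation ::
  "'a topology \<Rightarrow> ('h::finite \<times> complex \<Rightarrow> 'a) \<Rightarrow> ('h \<times> nat \<Rightarrow> 'e::finite) \<Rightarrow> bool" where
  "ideal_triangulation S q ed \<longleftrightarrow>
     (\<forall>e. card {s \<in> sides. ed s = e} = 2) \<and>
     quotient_map (prod_topology (discrete_topology UNIV) (top_of_set model_hexagon)) S q \<and>
     (\<exists>g. (\<forall>s\<in>sides. \<forall>s'\<in>sides. s \<noteq> s' \<and> ed s = ed s' \<longrightarrow>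
             homeomorphism (red_edge (snd s)) (red_edge (snd s')) (g s) (g s')) \<and>
          (\<forall>h h'. \<forall>x\<in>model_hexagon. \<forall>x'\<in>model_hexagon.
             q (h, x) = q (h', x') \<longleftrightarrow>
               (h, x) = (h', x') \<or>
               (\<exists>i<3. \<exists>j<3. (h, i) \<noteq> (h', j) \<and> ed (h, i) = ed (h', j) \<and>
                  x \<in> red_edge i \<and> x' = g (h, i) x)))"


section \<open>Right-angled hyperbolic hexagons\<close>

text \<open>The hyperbolic plane is the upper sheet of the hyperboloid in Minkowski space.\<close>

definition mink :: "real^3 \<Rightarrow> real^3 \<Rightarrow> real" where
  "mink x y = x$1 * y$1 + x$2 * y$2 - x$3 * y$3"

definition hyp_plane :: "(real^3) set" where
  "hyp_plane = {x. mink x x = -1 \<and> x$3 > 0}"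

definition hyp_dist :: "real^3 \<Rightarrow> real^3 \<Rightarrow> real" where
  "hyp_dist x y = arcosh (- mink x y)"

text \<open>The component of \<open>y\<close> tangent to the hyperboloid at \<open>x\<close>: for \<open>y \<noteq> x\<close> it is a positive multiple of
  the initial velocity of the geodesic from \<open>x\<close> to \<open>y\<close>.\<close>

definition hyp_dir :: "real^3 \<Rightarrow> real^3 \<Rightarrow> real^3" where
  "hyp_dir x y = y + mink x y *\<^sub>R x"

text \<open>
  A right-angled hexagon is given by its vertices \<open>v 0, ..., v 5\<close> in cyclic order. Having interior
  angles less than \<open>pi\<close>, it is strictly convex: all vertices off a side lie on the same side of the
  geodesic containing it, the sign of the determinant telling the two sides of that geodesic apart.
  The sign \<open>s\<close> is the orientation of the hexagon.
\<close>

definition right_angled_hexagon :: "(nat \<Rightarrow> real^3) \<Rightarrow> bool" where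
  "right_angled_hexagon v \<longleftrightarrow>
     (\<forall>k<6. v k \<in> hyp_plane) \<and>
     (\<exists>s\<in>{1, -1}. \<forall>k<6. \<forall>j<6. j \<noteq> k \<and> j \<noteq> (k + 1) mod 6 \<longrightarrow>
        s * det (vector [v k, v ((k + 1) mod 6), v j] :: real^3^3) > 0) \<and>
     (\<forall>k<6. mink (hyp_dir (v ((k + 1) mod 6)) (v k))
                 (hyp_dir (v ((k + 1) mod 6)) (v ((k + 2) mod 6))) = 0)"

definition red_length :: "(nat \<Rightarrow> real^3) \<Rightarrow> nat \<Rightarrow> real" where
  "red_length v i = hyp_dist (v (2 * i)) (v (2 * i + 1))"

text \<open>The black edge opposite to red edge \<open>i\<close>. Hence the two black edges adjacent to red edge \<open>i\<close> are
  those opposite to the red edges \<open>i + 1\<close> and \<open>i + 2\<close> modulo 3.\<close>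

definition black_length :: "(nat \<Rightarrow> real^3) \<Rightarrow> nat \<Rightarrow> real" where
  "black_length v i = hyp_dist (v ((2 * i + 3) mod 6)) (v ((2 * i + 4) mod 6))"


section \<open>Teichmueller space and the edge invariants\<close>

text \<open>Teichmueller space in the length coordinates of an ideal triangulation with edges \<open>'e\<close>.\<close>

definition teichmueller :: "(real^'e) set" where
  "teichmueller = {l. \<forall>e. l $ e > 0}"

text \<open>The colored right-angled hexagon, unique up to isometry, that the metric with length
  coordinates \<open>l\<close> induces on the 2-cell \<open>h\<close>.\<close>

definition cell_hexagon :: "('h \<times> nat \<Rightarrow> 'e) \<Rightarrow> real^'e \<Rightarrow> 'h \<Rightarrow> nat \<Rightarrow> real^3" where
  "cell_hexagon ed l h =
     (SOME v. right_angled_hexagon v \<and> (\<forall>i<3. red_length v i = l $ ed (h, i)))"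

definition arc_opposite :: "('h \<times> nat \<Rightarrow> 'e) \<Rightarrow> real^'e \<Rightarrow> 'h \<times> nat \<Rightarrow> real" where
  "arc_opposite ed l s = black_length (cell_hexagon ed l (fst s)) (snd s)"

text \<open>The quantity \<open>(a + b - c) / 2\<close> of the edge \<open>ed (h, i)\<close> as seen from the side \<open>(h, i)\<close>.\<close>

definition half_diff :: "('h \<times> nat \<Rightarrow> 'e) \<Rightarrow> real^'e \<Rightarrow> 'h \<times> nat \<Rightarrow> real" where
  "half_diff ed l = (\<lambda>(h, i).
     (arc_opposite ed l (h, (i + 1) mod 3) + arc_opposite ed l (h, (i + 2) mod 3)
        - arc_opposite ed l (h, i)) / 2)"

text \<open>In an ideal triangulation each edge has exactly two sides, so the sum below has two terms.
  The interval integral is the oriented one, hence negative for a negative upper limit.\<close>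

definition Psi :: "('h::finite \<times> nat \<Rightarrow> 'e::finite) \<Rightarrow> real \<Rightarrow> real^'e \<Rightarrow> real^'e" where
  "Psi ed lam l =
     (\<chi> e. \<Sum>s\<in>{s \<in> sides. ed s = e}. LBINT t=0..ereal (half_diff ed l s). cosh t powr lam)"

definition cosh_integral :: "real \<Rightarrow> ereal" where
  "cosh_integral lam = enn2ereal (\<integral>\<^sup>+t\<in>{0..}. ennreal (cosh t powr lam) \<partial>lborel)"


section \<open>Edge paths and edge cycles\<close>

text \<open>
  Step \<open>k\<close> of an edge path \<open>(H 0, e 1, H 1, ..., e n, H n)\<close> crosses the edge \<open>e k\<close>: it leaves
  \<open>H (k - 1)\<close> through its side number \<open>a k\<close> and enters \<open>H k\<close> through its side number \<open>b k\<close>, these being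
  the two different sides of \<open>e k\<close>. So the hexagons \<open>H (k - 1)\<close> and \<open>H k\<close> are the ones on the two sides of
  \<open>e k\<close>, which are the same 2-cell when two red edges of one hexagon are identified (their lifts to the
  universal cover are always distinct). As usual for edge paths there is no backtracking: a hexagon
  is not left through the side through which it was entered. For an edge cycle this is
  also required at \<open>H n = H 0\<close>.
\<close>

definition edge_path_via ::
  "('h \<times> nat \<Rightarrow> 'e) \<Rightarrow> nat \<Rightarrow> (nat \<Rightarrow> 'h) \<Rightarrow> (nat \<Rightarrow> 'e) \<Rightarrow> (nat \<Rightarrow> nat) \<Rightarrow> (nat \<Rightarrow> nat) \<Rightarrow> bool" where
  "edge_path_via ed n H e a b \<longleftrightarrow>
     n \<ge> 1 \<and>
     (\<forall>k\<in>{1..n}. a k < 3 \<and> b k < 3 \<and> (H (k - 1), a k) \<noteq> (H k, b k) \<and>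
        ed (H (k - 1), a k) = e k \<and> ed (H k, b k) = e k) \<and>
     (\<forall>k\<in>{1..<n}. b k \<noteq> a (k + 1))"

definition edge_path :: "('h \<times> nat \<Rightarrow> 'e) \<Rightarrow> nat \<Rightarrow> (nat \<Rightarrow> 'h) \<Rightarrow> (nat \<Rightarrow> 'e) \<Rightarrow> bool" where
  "edge_path ed n H e \<longleftrightarrow> (\<exists>a b. edge_path_via ed n H e a b)"

definition edge_cycle :: "('h \<times> nat \<Rightarrow> 'e) \<Rightarrow> nat \<Rightarrow> (nat \<Rightarrow> 'h) \<Rightarrow> (nat \<Rightarrow> 'e) \<Rightarrow> bool" where
  "edge_cycle ed n H e \<longleftrightarrow>
     (\<exists>a b. edge_path_via ed n H e a b \<and> H n = H 0 \<and> b n \<noteq> a 1)"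

definition at_most_twice :: "nat \<Rightarrow> (nat \<Rightarrow> 'e) \<Rightarrow> bool" where
  "at_most_twice n e \<longleftrightarrow> (\<forall>x. card {k \<in> {1..n}. e k = x} \<le> 2)"

definition fundamental_edge_path ::
  "('h \<times> nat \<Rightarrow> 'e) \<Rightarrow> nat \<Rightarrow> (nat \<Rightarrow> 'h) \<Rightarrow> (nat \<Rightarrow> 'e) \<Rightarrow> bool" where
  "fundamental_edge_path ed n H e \<longleftrightarrow> edge_path ed n H e \<and> at_most_twice n e"

definition fundamental_edge_cycle ::
  "('h \<times> nat \<Rightarrow> 'e) \<Rightarrow> nat \<Rightarrow> (nat \<Rightarrow> 'h) \<Rightarrow> (nat \<Rightarrow> 'e) \<Rightarrow> bool" where
  "fundamental_edge_cycle ed n H e \<longleftrightarrow> edge_cycle ed n H e \<and> at_most_twice n e"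


section \<open>Open convex polytopes\<close>

text \<open>The open counterpart of \<^const>\<open>polyhedron\<close>; it need not be bounded.\<close>

definition open_convex_polytope :: "'a::euclidean_space set \<Rightarrow> bool" where
  "open_convex_polytope P \<longleftrightarrow>
     (\<exists>F. finite F \<and> P = \<Inter>F \<and> (\<forall>h\<in>F. \<exists>a b. a \<noteq> 0 \<and> h = {x. a \<bullet> x < b}))"

end

theory Submission
  imports Defs
begin

text \<open>
  Let \<open>r\<close> be the quantity \<open>(a + b - c) / 2\<close> at a side of a hexagon. Two such quantities of one hexagon add up
  to the length of a black edge, which is positive; since \<open>x \<mapsto> \<integral>\<^sub>0\<^sup>x cosh\<^sup>\<lambda>\<close> is odd and increasing, summing
  along a path or a cycle shows that the image lies in the polytope. The tangent law says that
  \<open>tanh (l / 2) * cosh r\<close> is the same for the three sides of a hexagon. Hence the derivative of the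
  invariant, weighted by \<open>tanh (l / 2) powr (\<lambda> + 1)\<close> at each edge, is a sum over the hexagons of positive
  multiples of negative definite forms which do not depend on \<open>\<lambda>\<close>. So the derivative is injective and the
  image is open. The image is also closed in the polytope: when the lengths degenerate while the invariant
  converges, either the shortest edge tends to 0, which violates the first condition, or walking
  from each infinitely long edge to the longer one of the two other edges of the next hexagon yields a
  path or a cycle along which the limit violates the second or the third condition. Since the
  polytope is connected, it is the image.
\<close>

section \<open>Minkowski geometry\<close>

text \<open>A clopen argument takes the place of inverting the map: injectivity of the derivative
  gives openness, and a compactness statement gives closedness. The compactness is the delicate
  half. The invariant controls the primitives of the half gaps, whereas degeneration is seen in the
  half gaps themselves: along a walk the two gaps of a hexagon add up to a collapsing black edge,
  and their primitives have to cancel in the limit as well. For nonpositive exponents the integrand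
  is at most 1 and this is immediate. For positive exponents it is unbounded, so the half gaps are
  bounded beforehand, by induction on the number of longer edges. The bound 2 in the notion of a
  fundamental path comes from the walk: the part that is used enters each side at most once, and an
  edge has two sides. The hexagon of a cell is a choice; its existence gives the choice a meaning,
  and the cosine law shows that the black lengths depend on the red lengths only.\<close>

lemma mink_commute: "mink x y = mink y x"
  by (simp add: mink_def mult.commute)

lemma mink_add_left: "mink (x + y) z = mink x z + mink y z"
  by (simp add: mink_def algebra_simps)
lemma mink_diff_left: "mink (x - y) z = mink x z - mink y z"
  by (simp add: mink_def algebra_simps)
lemma mink_scaleR_left: "mink (c *\<^sub>R x) z = c * mink x z"
  by (simp add: mink_def algebra_simps)
lemma mink_add_right: "mink z (x + y) = mink z x + mink z y"
  by (simp add: mink_def algebra_simps)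
lemma mink_diff_right: "mink z (x - y) = mink z x - mink z y"
  by (simp add: mink_def algebra_simps)
lemma mink_scaleR_right: "mink z (c *\<^sub>R x) = c * mink z x"
  by (simp add: mink_def algebra_simps)

lemmas mink_linear = mink_add_left mink_diff_left mink_scaleR_left
  mink_add_right mink_diff_right mink_scaleR_right

definition det3 :: "real^3 \<Rightarrow> real^3 \<Rightarrow> real^3 \<Rightarrow> real" where
  "det3 x y z = det (vector [x, y, z] :: real^3^3)"

lemma det3_eq: "det3 x y z = x$1 * y$2 * z$3 + x$2 * y$3 * z$1 + x$3 * y$1 * z$2
   - x$1 * y$3 * z$2 - x$2 * y$1 * z$3 - x$3 * y$2 * z$1"
  by (simp add: det3_def det_3 vector_3)

lemma det3_rotate: "det3 x y z = det3 y z x"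
  by (simp add: det3_eq)

text \<open>The Gram matrix is \<open>X J Y^T\<close> with \<open>J = diag(1, 1, -1)\<close>; the
  sign is the determinant of \<open>J\<close>.\<close>

lemma det3_gram:
  "det3 x y z * det3 u v w = 
    - (mink x u * (mink y v * mink z w - mink y w * mink z v)
     - mink x v * (mink y u * mink z w - mink y w * mink z u)
     + mink x w * (mink y u * mink z v - mink y v * mink z u))"
  unfolding det3_eq mink_def by algebra

text \<open>Reversed Cauchy-Schwarz inequality on the upper sheet; after squaring, the difference is
  a sum of three squares as in Lagrange's identity.\<close>

lemma mink_le_neg1:
  assumes "x \<in> hyp_plane" "y \<in> hyp_plane"
  shows "mink x y \<le> -1"
proof -
  define a b c where "a = x$1" "b = x$2" "c = x$3"
  define a' b' c' where "a' = y$1" "b' = y$2" "c' = y$3"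
  have c: "c\<^sup>2 = 1 + a\<^sup>2 + b\<^sup>2" "c > 0" and c': "c'\<^sup>2 = 1 + a'\<^sup>2 + b'\<^sup>2" "c' > 0"
    using assms by (auto simp: hyp_plane_def mink_def a_b_c_def a'_b'_c'_def power2_eq_square)
  have "(1 + a*a' + b*b')\<^sup>2 \<le> (c * c')\<^sup>2"
  proof -
    have "(c * c')\<^sup>2 - (1 + a*a' + b*b')\<^sup>2 = (a - a')\<^sup>2 + (b - b')\<^sup>2 + (a*b' - a'*b)\<^sup>2"
      unfolding power_mult_distrib c c' by (simp add: power2_eq_square algebra_simps)
    then show ?thesis by (smt (verit) zero_le_power2)
  qed
  then have "1 + a*a' + b*b' \<le> c * c'"
    using c(2) c'(2) by (meson less_imp_le mult_pos_pos power2_le_imp_le)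
  then show ?thesis by (simp add: mink_def a_b_c_def a'_b'_c'_def)
qed

lemma mink_hyp_dir:
  assumes "x \<in> hyp_plane"
  shows "mink (hyp_dir x y) (hyp_dir x z) = mink y z + mink x y * mink x z"
  using assms by (simp add: hyp_dir_def mink_linear hyp_plane_def mink_commute algebra_simps)

text \<open>The right angle at \<open>b\<close> is the hyperbolic theorem of Pythagoras,
  \<open>mink a c = - (mink a b * mink b c)\<close>. It makes the Gram determinant factor, so a
  nonzero determinant forces both sides at \<open>b\<close> to have positive length.\<close>

lemma right_angled_det3:
  assumes "a \<in> hyp_plane" "b \<in> hyp_plane" "c \<in> hyp_plane"
    and "mink (hyp_dir b a) (hyp_dir b c) = 0"
    and "det3 a b c \<noteq> 0"
  shows "- mink a b > 1" "- mink b c > 1"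
    and "(det3 a b c)\<^sup>2 = ((mink a b)\<^sup>2 - 1) * ((mink b c)\<^sup>2 - 1)"
proof -
  have n: "mink a a = -1" "mink b b = -1" "mink c c = -1"
    using assms by (auto simp: hyp_plane_def)
  have ac: "mink a c = - (mink a b * mink b c)"
    using assms mink_hyp_dir[of b a c] by (simp add: mink_commute)
  have "(det3 a b c)\<^sup>2 = - (mink a a * (mink b b * mink c c - mink b c * mink c b)
     - mink a b * (mink b a * mink c c - mink b c * mink c a)
     + mink a c * (mink b a * mink c b - mink b b * mink c a))"
    by (simp add: power2_eq_square det3_gram)
  also have "\<dots> = ((mink a b)\<^sup>2 - 1) * ((mink b c)\<^sup>2 - 1)"
    unfolding mink_commute[of b a] mink_commute[of c a] mink_commute[of c b] n ac
    by (simp add: power2_eq_square algebra_simps)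
  finally show e: "(det3 a b c)\<^sup>2 = ((mink a b)\<^sup>2 - 1) * ((mink b c)\<^sup>2 - 1)" .
  then have "((mink a b)\<^sup>2 - 1) * ((mink b c)\<^sup>2 - 1) \<noteq> 0"
    using assms(5) by (metis zero_eq_power2)
  then have "mink a b \<noteq> -1" "mink b c \<noteq> -1" by auto
  then show "- mink a b > 1" "- mink b c > 1"
    using mink_le_neg1 assms by force+
qed


section \<open>The cosine law\<close>

text \<open>\<open>p\<close> and \<open>q\<close> span a nondegenerate plane, so the vectors
  \<open>a\<close> and \<open>b\<close> orthogonal to it are proportional. The proportion is stated
  without division.\<close>

lemma perp_det3_eq:
  assumes "mink a p = 0" "mink a q = 0" "mink b p = 0" "mink b q = 0"
    and "mink p p * mink q q \<noteq> (mink p q)\<^sup>2"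
  shows "mink a y * det3 p q b = mink b y * det3 p q a"
proof -
  have sym: "mink q p = mink p q" by (rule mink_commute)
  have *: "det3 p q c * det3 p q x = mink c x * ((mink p q)\<^sup>2 - mink p p * mink q q)"
    if "mink c p = 0" "mink c q = 0" for c x
    unfolding det3_gram sym that by (simp add: power2_eq_square algebra_simps)
  have "(mink a y * det3 p q b) * ((mink p q)\<^sup>2 - mink p p * mink q q)
      = det3 p q a * det3 p q y * det3 p q b"
    using *[of a y] assms by simp
  also have "\<dots> = (mink b y * det3 p q a) * ((mink p q)\<^sup>2 - mink p p * mink q q)"
    using *[of b y] assms by (simp add: mult.commute)
  finally show ?thesis using assms(5) by simp
qed

text \<open>The product of the two determinants is known from their squares and their common sign,
  while the Gram identity expresses it through \<open>mink v0 v3\<close>; comparing both yields the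
  formula. The minus sign records that \<open>v0\<close> and \<open>v3\<close> lie on the same side
  of the line through \<open>v1\<close> and \<open>v2\<close>.\<close>

lemma right_angled_chain:
  assumes hyp: "v0 \<in> hyp_plane" "v1 \<in> hyp_plane" "v2 \<in> hyp_plane" "v3 \<in> hyp_plane"
    and right: "mink (hyp_dir v1 v0) (hyp_dir v1 v2) = 0" "mink (hyp_dir v2 v1) (hyp_dir v2 v3) = 0"
    and s: "s \<in> {1, -1 :: real}"
    and D: "s * det3 v0 v1 v2 > 0" "s * det3 v1 v2 v3 > 0"
  defines "c01 \<equiv> - mink v0 v1" and "c12 \<equiv> - mink v1 v2" and "c23 \<equiv> - mink v2 v3"
  shows "- mink v0 v3 = c01 * c12 * c23 - sqrt (c01\<^sup>2 - 1) * sqrt (c23\<^sup>2 - 1)"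
    and "s * det3 v0 v1 v2 = sqrt (c01\<^sup>2 - 1) * sqrt (c12\<^sup>2 - 1)"
    and "- mink v0 v2 = c01 * c12"
    and "- mink v1 v3 = c12 * c23"
    and "c01 > 1"
proof -
  have nz: "det3 v0 v1 v2 \<noteq> 0" "det3 v1 v2 v3 \<noteq> 0" using D by auto
  have gt: "c01 > 1" "c12 > 1" "c23 > 1"
    using right_angled_det3(1,2)[OF hyp(1-3) right(1) nz(1)]
      right_angled_det3(1,2)[OF hyp(2-4) right(2) nz(2)]
    by (auto simp: c01_def c12_def c23_def)
  show "c01 > 1" by (rule gt)
  have s2: "s\<^sup>2 = 1" using s by auto
  have sq: "(s * det3 v0 v1 v2)\<^sup>2 = (c01\<^sup>2 - 1) * (c12\<^sup>2 - 1)"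
    "(s * det3 v1 v2 v3)\<^sup>2 = (c12\<^sup>2 - 1) * (c23\<^sup>2 - 1)"
    using right_angled_det3(3)[OF hyp(1-3) right(1) nz(1)]
      right_angled_det3(3)[OF hyp(2-4) right(2) nz(2)]
    by (auto simp: c01_def c12_def c23_def power_mult_distrib s2)
  show d0: "s * det3 v0 v1 v2 = sqrt (c01\<^sup>2 - 1) * sqrt (c12\<^sup>2 - 1)"
    using sq(1) D(1) by (metis less_imp_le real_sqrt_mult real_sqrt_unique)
  have d1: "s * det3 v1 v2 v3 = sqrt (c12\<^sup>2 - 1) * sqrt (c23\<^sup>2 - 1)"
    using sq(2) D(2) by (metis less_imp_le real_sqrt_mult real_sqrt_unique)
  show e02: "- mink v0 v2 = c01 * c12" and e13: "- mink v1 v3 = c12 * c23"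
    using right hyp by (simp_all add: mink_hyp_dir mink_commute c01_def c12_def c23_def)
  have n: "mink v1 v1 = -1" "mink v2 v2 = -1" using hyp by (auto simp: hyp_plane_def)
  have m: "mink v0 v1 = - c01" "mink v1 v2 = - c12" "mink v2 v1 = - c12" "mink v2 v3 = - c23"
    "mink v0 v2 = - (c01 * c12)" "mink v1 v3 = - (c12 * c23)"
    using e02 e13 by (simp_all add: c01_def c12_def c23_def mink_commute[of v2 v1])
  have "(c12\<^sup>2 - 1) * (sqrt (c01\<^sup>2 - 1) * sqrt (c23\<^sup>2 - 1))
      = (s * det3 v0 v1 v2) * (s * det3 v1 v2 v3)"
  proof -
    have "sqrt (c12\<^sup>2 - 1) * sqrt (c12\<^sup>2 - 1) = c12\<^sup>2 - 1" using gt by simp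
    then show ?thesis unfolding d0 d1 by algebra
  qed
  also have "\<dots> = s\<^sup>2 * (det3 v1 v2 v0 * det3 v1 v2 v3)"
    unfolding det3_rotate[of v0 v1 v2] by (simp add: power2_eq_square)
  also have "\<dots> = (c12\<^sup>2 - 1) * (c01 * c12 * c23 + mink v0 v3)"
    unfolding s2 det3_gram n m by (simp add: power2_eq_square algebra_simps)
  moreover have "c12\<^sup>2 \<noteq> 1" using gt(2) by (simp add: power2_eq_1_iff)
  ultimately show "- mink v0 v3 = c01 * c12 * c23 - sqrt (c01\<^sup>2 - 1) * sqrt (c23\<^sup>2 - 1)"
    by simp
qed

text \<open>The lines \<open>v5 v0\<close> and \<open>v3 v4\<close> carry the sides adjacent to both
  the chain \<open>v0 v1 v2 v3\<close> and the opposite side \<open>v4 v5\<close>. The Minkowski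
  product of their normals is computed once along the chain and once along \<open>v4 v5\<close>;
  equating the results gives the law.\<close>

lemma hexagon_cosine_law_cosh:
  fixes v0 v1 v2 v3 v4 v5 :: "real^3"
  assumes hyp: "v0 \<in> hyp_plane" "v1 \<in> hyp_plane" "v2 \<in> hyp_plane"
      "v3 \<in> hyp_plane" "v4 \<in> hyp_plane" "v5 \<in> hyp_plane"
    and right: "mink (hyp_dir v1 v0) (hyp_dir v1 v2) = 0" "mink (hyp_dir v2 v1) (hyp_dir v2 v3) = 0"
      "mink (hyp_dir v3 v2) (hyp_dir v3 v4) = 0" "mink (hyp_dir v4 v3) (hyp_dir v4 v5) = 0"
      "mink (hyp_dir v5 v4) (hyp_dir v5 v0) = 0" "mink (hyp_dir v0 v5) (hyp_dir v0 v1) = 0"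
    and s: "s \<in> {1, -1 :: real}"
    and D: "s * det3 v0 v1 v2 > 0" "s * det3 v1 v2 v3 > 0" "s * det3 v2 v3 v4 > 0"
      "s * det3 v3 v4 v5 > 0" "s * det3 v4 v5 v0 > 0" "s * det3 v5 v0 v1 > 0"
  defines "c01 \<equiv> - mink v0 v1" and "c12 \<equiv> - mink v1 v2" and "c23 \<equiv> - mink v2 v3"
    and "c45 \<equiv> - mink v4 v5"
  shows "c45 = sqrt (c01\<^sup>2 - 1) * sqrt (c23\<^sup>2 - 1) * c12 - c01 * c23"
    and "c01 > 1" "c23 > 1" "c12 > 1" "c45 > 1"
proof -
  define c34 c50 where "c34 = - mink v3 v4" and "c50 = - mink v5 v0"
  define s01 s12 s23 s34 s45 s50 where "s01 = sqrt (c01\<^sup>2 - 1)" and "s12 = sqrt (c12\<^sup>2 - 1)"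
    and "s23 = sqrt (c23\<^sup>2 - 1)" and "s34 = sqrt (c34\<^sup>2 - 1)" and "s45 = sqrt (c45\<^sup>2 - 1)"
    and "s50 = sqrt (c50\<^sup>2 - 1)"
  note cdefs = c01_def c12_def c23_def c34_def c45_def c50_def
  note ch0 = right_angled_chain[OF hyp(1,2,3,4) right(1,2) s D(1,2), folded cdefs]
  note ch1 = right_angled_chain[OF hyp(2,3,4,5) right(2,3) s D(2,3), folded cdefs]
  note ch2 = right_angled_chain[OF hyp(3,4,5,6) right(3,4) s D(3,4), folded cdefs]
  note ch3 = right_angled_chain[OF hyp(4,5,6,1) right(4,5) s D(4,5), folded cdefs]
  note ch4 = right_angled_chain[OF hyp(5,6,1,2) right(5,6) s D(5,6), folded cdefs]
  note ch5 = right_angled_chain[OF hyp(6,1,2,3) right(6,1) s D(6,1), folded cdefs]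
  show gt: "c01 > 1" "c23 > 1" "c12 > 1" "c45 > 1" by (rule ch0 ch2 ch1 ch4)+
  have gt': "c34 > 1" "c50 > 1" by (rule ch3 ch5)+
  have sq: "s01\<^sup>2 = c01\<^sup>2 - 1" "s23\<^sup>2 = c23\<^sup>2 - 1" "s45\<^sup>2 = c45\<^sup>2 - 1"
    using gt by (simp_all add: s01_def s23_def s45_def)
  have pos: "s01 > 0" "s23 > 0" "s34 > 0" "s45 > 0" "s50 > 0"
    using gt gt' by (simp_all add: s01_def s23_def s34_def s45_def s50_def)
  have n: "mink v0 v0 = -1" "mink v3 v3 = -1" "mink v4 v4 = -1" "mink v5 v5 = -1"
    using hyp by (auto simp: hyp_plane_def)
  have m: "mink v0 v1 = - c01" "mink v1 v2 = - c12" "mink v2 v3 = - c23" "mink v3 v4 = - c34"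
    "mink v4 v5 = - c45" "mink v5 v0 = - c50"
    "mink v0 v2 = - (c01 * c12)" "mink v1 v3 = - (c12 * c23)" "mink v2 v4 = - (c23 * c34)"
    "mink v3 v5 = - (c34 * c45)" "mink v4 v0 = - (c45 * c50)" "mink v5 v1 = - (c50 * c01)"
    "mink v0 v3 = - (c01 * c12 * c23 - s01 * s23)"
    using ch0(1,3,4) ch1(3,4) ch2(4) ch3(4) ch4(4)
    by (simp_all add: cdefs s01_def s23_def)
  have sym: "mink v1 v0 = mink v0 v1" "mink v2 v1 = mink v1 v2" "mink v3 v2 = mink v2 v3"
    "mink v4 v3 = mink v3 v4" "mink v5 v4 = mink v4 v5" "mink v0 v5 = mink v5 v0"
    "mink v2 v0 = mink v0 v2" "mink v3 v1 = mink v1 v3" "mink v4 v2 = mink v2 v4"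
    "mink v5 v3 = mink v3 v5" "mink v0 v4 = mink v4 v0" "mink v1 v5 = mink v5 v1"
    "mink v3 v0 = mink v0 v3"
    by (rule mink_commute)+
  \<comment> \<open>These are \<open>hyp_dir v0 v1\<close>, \<open>hyp_dir v3 v2\<close>,
    \<open>hyp_dir v4 v5\<close> and \<open>hyp_dir v5 v4\<close>. By the right angles
    \<open>n0\<close> and \<open>m5\<close> are normals of the line \<open>v5 v0\<close>, and
    \<open>n3\<close> and \<open>m4\<close> are normals of the line \<open>v3 v4\<close>.\<close>
  define n0 n3 m4 m5 where "n0 = v1 - c01 *\<^sub>R v0" and "n3 = v2 - c23 *\<^sub>R v3"
    and "m4 = v5 - c45 *\<^sub>R v4" and "m5 = v4 - c45 *\<^sub>R v5"
  note nm = n0_def n3_def m4_def m5_def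
  have perp: "mink n0 v0 = 0" "mink n0 v5 = 0" "mink m5 v0 = 0" "mink m5 v5 = 0"
     "mink n3 v3 = 0" "mink n3 v4 = 0" "mink m4 v3 = 0" "mink m4 v4 = 0"
    by (simp_all add: nm mink_linear sym m n)
  have nd: "mink v5 v5 * mink v0 v0 \<noteq> (mink v5 v0)\<^sup>2" "mink v3 v3 * mink v4 v4 \<noteq> (mink v3 v4)\<^sup>2"
    using gt' by (auto simp: n m power2_eq_square) (smt (verit) mult_le_cancel_left1)+
  have d: "s * det3 v5 v0 m5 = s45 * s50" "s * det3 v5 v0 n0 = s50 * s01"
    "s * det3 v3 v4 m4 = s34 * s45" "s * det3 v3 v4 n3 = s23 * s34"
  proof -
    have "det3 v5 v0 m5 = det3 v4 v5 v0" "det3 v5 v0 n0 = det3 v5 v0 v1"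
      "det3 v3 v4 m4 = det3 v3 v4 v5" "det3 v3 v4 n3 = det3 v2 v3 v4"
      by (simp_all add: nm det3_eq algebra_simps)
    then show "s * det3 v5 v0 m5 = s45 * s50" "s * det3 v5 v0 n0 = s50 * s01"
      "s * det3 v3 v4 m4 = s34 * s45" "s * det3 v3 v4 n3 = s23 * s34"
      using ch4(2) ch5(2) ch3(2) ch2(2) by (simp_all add: s45_def s50_def s01_def s34_def s23_def)
  qed
  have "mink n0 n3 * (s * det3 v5 v0 m5) = mink m5 n3 * (s * det3 v5 v0 n0)"
    using perp_det3_eq[OF perp(2,1,4,3) nd(1), of n3] by simp
  then have 1: "mink n0 n3 * s45 = mink m5 n3 * s01"
    unfolding d using pos by simp
  have "mink n3 m5 * (s * det3 v3 v4 m4) = mink m4 m5 * (s * det3 v3 v4 n3)"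
    using perp_det3_eq[OF perp(5,6,7,8) nd(2), of m5] by simp
  then have 2: "mink m5 n3 * s45 = mink m4 m5 * s23"
    unfolding d using pos by (simp add: mink_commute)
  have 3: "mink m4 m5 = - (c45 * s45\<^sup>2)"
    unfolding sq by (simp add: nm mink_linear sym m n power2_eq_square algebra_simps)
  have 4: "mink n0 n3 = - (s01 * s23) * (s01 * s23 * c12 - c01 * c23)"
  proof -
    have "mink n0 n3 = - c12 * (1 - c23\<^sup>2 - c01\<^sup>2 + c01\<^sup>2 * c23\<^sup>2) + c01 * c23 * (s01 * s23)"
      by (simp add: nm mink_linear sym m n power2_eq_square algebra_simps)
    also have "1 - c23\<^sup>2 - c01\<^sup>2 + c01\<^sup>2 * c23\<^sup>2 = s01\<^sup>2 * s23\<^sup>2"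
      unfolding sq by (simp add: algebra_simps)
    finally show ?thesis by (simp add: power2_eq_square algebra_simps)
  qed
  have "mink n0 n3 * s45\<^sup>2 = - (c45 * s45\<^sup>2) * s23 * s01"
    using 1 2 unfolding 3[symmetric] by (simp add: power2_eq_square algebra_simps)
  then have "(mink n0 n3 + c45 * s23 * s01) * s45\<^sup>2 = 0" by (simp add: algebra_simps)
  then have "mink n0 n3 = - c45 * s23 * s01" using pos by simp
  then have "c45 * (s01 * s23) = (s01 * s23 * c12 - c01 * c23) * (s01 * s23)"
    unfolding 4 by (simp add: algebra_simps)
  then show "c45 = sqrt (c01\<^sup>2 - 1) * sqrt (c23\<^sup>2 - 1) * c12 - c01 * c23"
    using pos by (simp add: s01_def s23_def)
qed


section \<open>Existence of right-angled hexagons\<close>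

lemma all_less_6: "(\<forall>k<6. P k) \<longleftrightarrow> P 0 \<and> P 1 \<and> P 2 \<and> P 3 \<and> P 4 \<and> P (5::nat)"
  by (simp add: eval_nat_numeral All_less_Suc conj_ac)

lemma all_less_3: "(\<forall>k<3. P k) \<longleftrightarrow> P 0 \<and> P 1 \<and> P (2::nat)"
  by (simp add: eval_nat_numeral All_less_Suc conj_ac)

lemma mod_6_simps:
  "(0 + 1) mod 6 = (1::nat)" "(0 + 2) mod 6 = (2::nat)" "(1 + 1) mod 6 = (2::nat)"
    "(1 + 2) mod 6 = (3::nat)" "(2 + 1) mod 6 = (3::nat)" "(2 + 2) mod 6 = (4::nat)"
    "(3 + 1) mod 6 = (4::nat)" "(3 + 2) mod 6 = (5::nat)" "(4 + 1) mod 6 = (5::nat)"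
    "(4 + 2) mod 6 = (0::nat)" "(5 + 1) mod 6 = (0::nat)" "(5 + 2) mod 6 = (1::nat)"
  by simp_all

text \<open>The unit normals \<open>B0, B1, B2\<close> of the lines containing the black edges have Minkowski products
  \<open>- c0, - c1, - c2\<close>. The vertex on the black line \<open>i\<close> and on the common perpendicular of the
  black lines \<open>i, j\<close> is a multiple of \<open>Bj + ck Bi\<close>, so the signs of all
  determinants can be read off from the coefficients.\<close>

lemma right_angled_hexagon_of_cosh:
  fixes c0 c1 c2 :: real
  assumes c: "c0 > 1" "c1 > 1" "c2 > 1"
  obtains v where "right_angled_hexagon v" "- mink (v 0) (v 1) = c0" "- mink (v 2) (v 3) = c1"
    "- mink (v 4) (v 5) = c2"
proof -
  define s0 s1 s2 where "s0 = sqrt (c0\<^sup>2 - 1)" and "s1 = sqrt (c1\<^sup>2 - 1)" and "s2 = sqrt (c2\<^sup>2 - 1)"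
  have sq: "s0\<^sup>2 = c0\<^sup>2 - 1" "s1\<^sup>2 = c1\<^sup>2 - 1" "s2\<^sup>2 = c2\<^sup>2 - 1"
    using c by (simp_all add: s0_def s1_def s2_def)
  have spos: "s0 > 0" "s1 > 0" "s2 > 0" using c by (simp_all add: s0_def s1_def s2_def)
  \<comment> \<open>With \<open>B2\<close> the first basis vector and \<open>B1\<close> in the span
    of the first and third, the third coordinate \<open>w\<close> of \<open>B0\<close> is forced by
    \<open>mink B0 B1 = - c2\<close>. The second coordinate \<open>y\<close> is then forced by
    \<open>mink B0 B0 = 1\<close>, so the radicand has to be positive.\<close>
  define w where "w = (c2 + c0 * c1) / s0"
  have cpos: "c0 * c1 > 0" "c0 * c1 * c2 > 0" using c by simp_all
  then have "c2 + c0 * c1 > 0" using c by linarith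
  then have w: "w > 0" "s0 * w = c2 + c0 * c1" using spos by (simp_all add: w_def)
  define y where "y = sqrt (1 + w\<^sup>2 - c1\<^sup>2)"
  have "s0\<^sup>2 * (1 + w\<^sup>2 - c1\<^sup>2) = s0\<^sup>2 + (s0 * w)\<^sup>2 - s0\<^sup>2 * c1\<^sup>2"
    by (simp add: power_mult_distrib algebra_simps)
  also have "\<dots> = s0\<^sup>2 + c2\<^sup>2 + 2 * (c0 * c1 * c2) + c1\<^sup>2"
    unfolding w(2) sq(1) by (simp add: power2_eq_square algebra_simps)
  finally have "s0\<^sup>2 * (1 + w\<^sup>2 - c1\<^sup>2) > 0"
    using cpos spos by (smt (verit) zero_le_power2 zero_less_power)
  then have y2: "1 + w\<^sup>2 - c1\<^sup>2 > 0" using spos by (simp add: zero_less_mult_iff)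
  then have y: "y > 0" "y\<^sup>2 = 1 + w\<^sup>2 - c1\<^sup>2" by (simp_all add: y_def)
  define B0 B1 B2 :: "real^3" where "B0 = vector [- c1, y, w]" and "B1 = vector [- c0, 0, s0]"
    and "B2 = vector [1, 0, 0]"
  have gram: "mink B0 B0 = 1" "mink B1 B1 = 1" "mink B2 B2 = 1"
    "mink B1 B2 = - c0" "mink B2 B1 = - c0" "mink B0 B2 = - c1" "mink B2 B0 = - c1"
    "mink B0 B1 = - c2" "mink B1 B0 = - c2"
    using y(2) w(2) sq(1) by (simp_all add: mink_def B0_def B1_def B2_def vector_3 power2_eq_square mult.commute[of w s0] mult.commute[of c1 c0])
  define d where "d = det3 B0 B1 B2"
  have d: "d > 0" using y spos by (simp add: d_def det3_eq B0_def B1_def B2_def vector_3)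
  define u where "u a b c = a *\<^sub>R B0 + b *\<^sub>R B1 + c *\<^sub>R B2" for a b c :: real
  have mu: "mink (u a b c) (u a' b' c') = a * a' + b * b' + c * c'
      - c0 * (b * c' + c * b') - c1 * (a * c' + c * a') - c2 * (a * b' + b * a')"
    for a b c a' b' c'
    by (simp add: u_def mink_linear gram algebra_simps)
  have du: "det3 (u a b c) (u a' b' c') (u a'' b'' c'') = d * (a * b' * c'' + b * c' * a'' + c * a' * b''
     - a * c' * b'' - b * a' * c'' - c * b' * a'')" for a b c a' b' c' a'' b'' c''
    unfolding d_def det3_eq u_def vector_add_component vector_scaleR_component real_scaleR_def
    by algebra
  \<comment> \<open>For instance \<open>c0 B1 + B2\<close> is orthogonal to \<open>B1\<close> and
    has Minkowski square \<open>1 - c0^2\<close>; hence the division by \<open>s0\<close>.\<close>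
  define v where "v k = [u 0 (c0/s0) (1/s0), u 0 (1/s0) (c0/s0), u (1/s1) 0 (c1/s1),
     u (c1/s1) 0 (1/s1), u (c2/s2) (1/s2) 0, u (1/s2) (c2/s2) 0] ! k" for k
  have v: "v 0 = u 0 (c0/s0) (1/s0)" "v 1 = u 0 (1/s0) (c0/s0)" "v (Suc 0) = u 0 (1/s0) (c0/s0)"
     "v (Suc (Suc 0)) = u (1/s1) 0 (c1/s1)" "v 2 = u (1/s1) 0 (c1/s1)"
     "v 3 = u (c1/s1) 0 (1/s1)" "v 4 = u (c2/s2) (1/s2) 0" "v 5 = u (1/s2) (c2/s2) 0"
    by (simp_all add: v_def numeral_eq_Suc)
  have quot: "c0/s0 * (c0/s0) = 1 + 1/s0*(1/s0)" "c1/s1 * (c1/s1) = 1 + 1/s1*(1/s1)"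
    "c2/s2 * (c2/s2) = 1 + 1/s2*(1/s2)"
    using spos sq by (simp_all add: field_simps power2_eq_square)
  define p0 p1 p2 where "p0 = 1/s0" and "p1 = 1/s1" and "p2 = 1/s2"
  define q0 q1 q2 where "q0 = c0/s0" and "q1 = c1/s1" and "q2 = c2/s2"
  have pq: "q0 = c0 * p0" "q1 = c1 * p1" "q2 = c2 * p2" "q0 * q0 = 1 + p0 * p0"
     "q1 * q1 = 1 + p1 * p1" "q2 * q2 = 1 + p2 * p2" 
    using quot by (simp_all add: p0_def p1_def p2_def q0_def q1_def q2_def)
  have p: "p0 > 0" "p1 > 0" "p2 > 0" "q0 > p0" "q1 > p1" "q2 > p2"
    using spos c by (simp_all add: p0_def p1_def p2_def q0_def q1_def q2_def divide_strict_right_mono)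
  note v' = v[folded p0_def p1_def p2_def q0_def q1_def q2_def]
  have q: "q0 > 0" "q1 > 0" "q2 > 0" using p by auto
  have third: "(u a b c) $ 3 > 0" if "a \<ge> 0" "b \<ge> 0" "c \<ge> 0" "a > 0 \<or> b > 0" for a b c
  proof -
    have "(u a b c) $ 3 = a * w + b * s0" by (simp add: u_def B0_def B1_def B2_def vector_3)
    moreover have "a * w \<ge> 0" "b * s0 \<ge> 0" "a * w > 0 \<or> b * s0 > 0" using that w spos by auto
    ultimately show ?thesis by linarith
  qed
  have norm: "mink (v 0) (v 0) = -1" "mink (v 1) (v 1) = -1" "mink (v 2) (v 2) = -1"
    "mink (v 3) (v 3) = -1" "mink (v 4) (v 4) = -1" "mink (v 5) (v 5) = -1"
    subgoal unfolding v' mu using pq(1,4) by algebra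
    subgoal unfolding v' mu using pq(1,4) by algebra
    subgoal unfolding v' mu using pq(2,5) by algebra
    subgoal unfolding v' mu using pq(2,5) by algebra
    subgoal unfolding v' mu using pq(3,6) by algebra
    subgoal unfolding v' mu using pq(3,6) by algebra
    done
  have hyp: "\<forall>k<6. v k \<in> hyp_plane"
    unfolding all_less_6 hyp_plane_def mem_Collect_eq norm using p q
    by (simp add: v' third)
  have hyp': "v 0 \<in> hyp_plane" "v 1 \<in> hyp_plane" "v 2 \<in> hyp_plane" "v 3 \<in> hyp_plane"
    "v 4 \<in> hyp_plane" "v 5 \<in> hyp_plane"
    using hyp by auto
  have prod: "mink (v 0) (v 1) = - c0" "mink (v 1) (v 0) = - c0" "mink (v 2) (v 3) = - c1"
    "mink (v 3) (v 2) = - c1" "mink (v 4) (v 5) = - c2" "mink (v 5) (v 4) = - c2"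
    unfolding v' mu by (simp_all add: pq(4-6)) (simp_all add: pq(1-3) algebra_simps)
  have right: "mink (hyp_dir (v 1) (v 0)) (hyp_dir (v 1) (v 2)) = 0"
    "mink (hyp_dir (v 2) (v 1)) (hyp_dir (v 2) (v 3)) = 0"
    "mink (hyp_dir (v 3) (v 2)) (hyp_dir (v 3) (v 4)) = 0"
    "mink (hyp_dir (v 4) (v 3)) (hyp_dir (v 4) (v 5)) = 0"
    "mink (hyp_dir (v 5) (v 4)) (hyp_dir (v 5) (v 0)) = 0"
    "mink (hyp_dir (v 0) (v 5)) (hyp_dir (v 0) (v 1)) = 0"
    unfolding hyp'[THEN mink_hyp_dir]
    unfolding prod unfolding v' mu pq(1-3) by (simp_all add: algebra_simps)
  have len: "- mink (v 0) (v 1) = c0" "- mink (v 2) (v 3) = c1" "- mink (v 4) (v 5) = c2"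
    using prod by simp_all
  have convex: "\<forall>k<6. \<forall>j<6. j \<noteq> k \<and> j \<noteq> (k + 1) mod 6 \<longrightarrow>
        1 * det (vector [v k, v ((k + 1) mod 6), v j] :: real^3^3) > 0"
    unfolding all_less_6 det3_def[symmetric] using d p q
    by (simp add: v' du zero_less_mult_iff pq(4-6) add_pos_pos q)
  show thesis
  proof (rule that[of v])
    show "right_angled_hexagon v"
      unfolding right_angled_hexagon_def
    proof (intro conjI hyp)
      show "\<exists>s\<in>{1, -1::real}. \<forall>k<6. \<forall>j<6. j \<noteq> k \<and> j \<noteq> (k + 1) mod 6 \<longrightarrow>
        s * det (vector [v k, v ((k + 1) mod 6), v j] :: real^3^3) > 0"
        by (rule bexI[where x = 1], rule convex) simp
      show "\<forall>k<6. mink (hyp_dir (v ((k + 1) mod 6)) (v k))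
                 (hyp_dir (v ((k + 1) mod 6)) (v ((k + 2) mod 6))) = 0"
        unfolding all_less_6 mod_6_simps by (intro conjI right)
    qed
  qed (rule len)+
qed


section \<open>Black lengths as functions of the red lengths\<close>

text \<open>The cosine law solved for the black edge opposite to the red edge of length
  \<open>x\<close>; it is adjacent to the red edges of lengths \<open>y\<close> and
  \<open>z\<close>.\<close>

definition facing_arc :: "real \<Rightarrow> real \<Rightarrow> real \<Rightarrow> real" where
  "facing_arc x y z = arcosh ((cosh x + cosh y * cosh z) / (sinh y * sinh z))"

lemma hexagon_cosine_law:
  fixes v0 v1 v2 v3 v4 v5 :: "real^3"
  assumes hyp: "v0 \<in> hyp_plane" "v1 \<in> hyp_plane" "v2 \<in> hyp_plane"
      "v3 \<in> hyp_plane" "v4 \<in> hyp_plane" "v5 \<in> hyp_plane"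
    and right: "mink (hyp_dir v1 v0) (hyp_dir v1 v2) = 0" "mink (hyp_dir v2 v1) (hyp_dir v2 v3) = 0"
      "mink (hyp_dir v3 v2) (hyp_dir v3 v4) = 0" "mink (hyp_dir v4 v3) (hyp_dir v4 v5) = 0"
      "mink (hyp_dir v5 v4) (hyp_dir v5 v0) = 0" "mink (hyp_dir v0 v5) (hyp_dir v0 v1) = 0"
    and s: "s \<in> {1, -1 :: real}"
    and D: "s * det3 v0 v1 v2 > 0" "s * det3 v1 v2 v3 > 0" "s * det3 v2 v3 v4 > 0"
      "s * det3 v3 v4 v5 > 0" "s * det3 v4 v5 v0 > 0" "s * det3 v5 v0 v1 > 0"
  shows "hyp_dist v1 v2 = facing_arc (hyp_dist v4 v5) (hyp_dist v0 v1) (hyp_dist v2 v3)"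
proof -
  note * = hexagon_cosine_law_cosh[OF hyp right s D]
  have "- mink v1 v2 = (- mink v4 v5 + - mink v0 v1 * - mink v2 v3) /
      (sqrt ((- mink v0 v1)\<^sup>2 - 1) * sqrt ((- mink v2 v3)\<^sup>2 - 1))"
  proof -
    have "sqrt ((- mink v0 v1)\<^sup>2 - 1) > 0" "sqrt ((- mink v2 v3)\<^sup>2 - 1) > 0"
      using *(2,3) by (simp_all only: real_sqrt_gt_0_iff diff_gt_0_iff_gt one_less_power zero_less_numeral)
    then have "sqrt ((- mink v0 v1)\<^sup>2 - 1) * sqrt ((- mink v2 v3)\<^sup>2 - 1) \<noteq> 0" by simp
    then show ?thesis using *(1) by (subst eq_divide_eq) (simp add: algebra_simps)
  qed
  then show ?thesis
    using *(2-5) by (simp add: facing_arc_def hyp_dist_def cosh_arcosh_real sinh_arcosh_real)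
qed

text \<open>Rotating the labels by an even number of vertices preserves the colours, so the law for
  the side \<open>v1 v2\<close> covers all three black edges.\<close>

lemma black_length_eq:
  assumes "right_angled_hexagon v" "i < 3"
  shows "black_length v i = facing_arc (red_length v i) (red_length v ((i + 1) mod 3)) (red_length v ((i + 2) mod 3))"
proof -
  from assms obtain s where hyp: "\<forall>k<6. v k \<in> hyp_plane" and s: "s \<in> {1, -1 :: real}"
    and c: "\<And>k j. \<lbrakk>k < 6; j < 6; j \<noteq> k; j \<noteq> (k + 1) mod 6\<rbrakk> \<Longrightarrow> s * det3 (v k) (v ((k + 1) mod 6)) (v j) > 0"
    and right: "\<And>k. k < 6 \<Longrightarrow> mink (hyp_dir (v ((k + 1) mod 6)) (v k))
                 (hyp_dir (v ((k + 1) mod 6)) (v ((k + 2) mod 6))) = 0"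
    unfolding right_angled_hexagon_def det3_def by metis
  have hyp': "v 0 \<in> hyp_plane" "v 1 \<in> hyp_plane" "v 2 \<in> hyp_plane" "v 3 \<in> hyp_plane"
    "v 4 \<in> hyp_plane" "v 5 \<in> hyp_plane"
    using hyp by auto
  have D: "s * det3 (v 0) (v 1) (v 2) > 0" "s * det3 (v 1) (v 2) (v 3) > 0"
    "s * det3 (v 2) (v 3) (v 4) > 0" "s * det3 (v 3) (v 4) (v 5) > 0"
    "s * det3 (v 4) (v 5) (v 0) > 0" "s * det3 (v 5) (v 0) (v 1) > 0"
    using c[of 0 2] c[of 1 3] c[of 2 4] c[of 3 5] c[of 4 0] c[of 5 1] unfolding mod_6_simps by simp_all
  have R: "mink (hyp_dir (v 1) (v 0)) (hyp_dir (v 1) (v 2)) = 0"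
    "mink (hyp_dir (v 2) (v 1)) (hyp_dir (v 2) (v 3)) = 0"
    "mink (hyp_dir (v 3) (v 2)) (hyp_dir (v 3) (v 4)) = 0"
    "mink (hyp_dir (v 4) (v 3)) (hyp_dir (v 4) (v 5)) = 0"
    "mink (hyp_dir (v 5) (v 4)) (hyp_dir (v 5) (v 0)) = 0"
    "mink (hyp_dir (v 0) (v 5)) (hyp_dir (v 0) (v 1)) = 0"
    using right[of 0] right[of 1] right[of 2] right[of 3] right[of 4] right[of 5]
    unfolding mod_6_simps by simp_all
  have mod_idx: "(2 * 1 + 3) mod 6 = (5::nat)" "(2 * 1 + 4) mod 6 = (0::nat)" "(1 + 1) mod 3 = (2::nat)"
    "(1 + 2) mod 3 = (0::nat)" "(2 * 2 + 3) mod 6 = (1::nat)" "(2 * 2 + 4) mod 6 = (2::nat)"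
    "(2 + 1) mod 3 = (0::nat)" "(2 + 2) mod 3 = (1::nat)" "(2 * 0 + 3) mod 6 = (3::nat)"
    "(2 * 0 + 4) mod 6 = (4::nat)" "(0 + 1) mod 3 = (1::nat)" "(0 + 2) mod 3 = (2::nat)"
    by simp_all
  consider "i = 0" | "i = 1" | "i = 2" using assms(2) by linarith
  then show ?thesis
  proof cases
    case 1
    then show ?thesis
      using hexagon_cosine_law[OF hyp'(3,4,5,6,1,2) R(3,4,5,6,1,2) s D(3,4,5,6,1,2)]
      unfolding black_length_def red_length_def 1 mod_idx by simp
  next
    case 2
    then show ?thesis
      using hexagon_cosine_law[OF hyp'(5,6,1,2,3,4) R(5,6,1,2,3,4) s D(5,6,1,2,3,4)]
      unfolding black_length_def red_length_def 2 mod_idx by simp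
  next
    case 3
    then show ?thesis
      using hexagon_cosine_law[OF hyp' R s D]
      unfolding black_length_def red_length_def 3 mod_idx by simp
  qed
qed

lemma right_angled_hexagon_exists:
  assumes "\<And>i. i < 3 \<Longrightarrow> l i > (0::real)"
  shows "\<exists>v. right_angled_hexagon v \<and> (\<forall>i<3. red_length v i = l i)"
proof -
  have c: "cosh (l 0) > 1" "cosh (l 1) > 1" "cosh (l 2) > 1"
    using assms[of 0] assms[of 1] assms[of 2] cosh_real_strict_mono[of 0] by auto
  obtain v where "right_angled_hexagon v" "- mink (v 0) (v 1) = cosh (l 0)"
    "- mink (v 2) (v 3) = cosh (l 1)" "- mink (v 4) (v 5) = cosh (l 2)"
    using right_angled_hexagon_of_cosh[OF c] .
  moreover have "arcosh (cosh (l i)) = l i" if "i < 3" for i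
    using assms[OF that] by (simp add: arcosh_cosh_real)
  ultimately show ?thesis
    by (intro exI[of _ v]) (simp add: all_less_3 red_length_def hyp_dist_def)
qed

text \<open>Existence makes the chosen hexagon satisfy its specification; the cosine law then gives
  the same value for every possible choice.\<close>

lemma arc_opposite_eq:
  assumes "l \<in> teichmueller" "i < 3"
  shows "arc_opposite ed l (h, i) =
    facing_arc (l $ ed (h, i)) (l $ ed (h, (i + 1) mod 3)) (l $ ed (h, (i + 2) mod 3))"
proof -
  have "\<exists>v. right_angled_hexagon v \<and> (\<forall>i<3. red_length v i = l $ ed (h, i))"
    using assms(1) by (intro right_angled_hexagon_exists) (simp add: teichmueller_def)
  then have "right_angled_hexagon (cell_hexagon ed l h) \<and>
    (\<forall>i<3. red_length (cell_hexagon ed l h) i = l $ ed (h, i))"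
    unfolding cell_hexagon_def by (rule someI_ex)
  then show ?thesis
    using assms(2) by (simp add: arc_opposite_def black_length_eq)
qed


section \<open>Hexagon trigonometry\<close>

lemma facing_arc_commute: "facing_arc x y z = facing_arc x z y"
  by (simp add: facing_arc_def mult.commute)

text \<open>The radicand is minus the Gram determinant of the unit normals of the three black lines.
  It is symmetric, and the root is the common numerator of the hyperbolic sines of the three black
  lengths.\<close>

definition hex_disc :: "real \<Rightarrow> real \<Rightarrow> real \<Rightarrow> real" where
  "hex_disc x y z = sqrt ((cosh x)\<^sup>2 + (cosh y)\<^sup>2 + (cosh z)\<^sup>2 + 2 * cosh x * cosh y * cosh z - 1)"

lemma hex_disc_rotate: "hex_disc y z x = hex_disc x y z"
  by (simp add: hex_disc_def algebra_simps)

lemma cosh_gt_1: "x > 0 \<Longrightarrow> cosh x > (1::real)"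
  using cosh_real_strict_mono[of 0 x] by simp

lemma hex_disc_pos:
  assumes "x > 0" "y > 0" "z > 0"
  shows "hex_disc x y z > 0"
    "(hex_disc x y z)\<^sup>2 = (cosh x)\<^sup>2 + (cosh y)\<^sup>2 + (cosh z)\<^sup>2 + 2 * cosh x * cosh y * cosh z - 1"
proof -
  have "(cosh x)\<^sup>2 > 1" using cosh_gt_1[OF assms(1)] by (simp add: one_less_power)
  then have "(cosh x)\<^sup>2 + (cosh y)\<^sup>2 + (cosh z)\<^sup>2 + 2 * cosh x * cosh y * cosh z - 1 > 0"
  proof -
    have "cosh x * cosh y * cosh z > 0" by (simp add: cosh_real_pos)
    then show ?thesis using \<open>(cosh x)\<^sup>2 > 1\<close> zero_le_power2[of "cosh y"] zero_le_power2[of "cosh z"] by linarith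
  qed
  then show "hex_disc x y z > 0" "(hex_disc x y z)\<^sup>2 = (cosh x)\<^sup>2 + (cosh y)\<^sup>2 + (cosh z)\<^sup>2 + 2 * cosh x * cosh y * cosh z - 1"
    by (simp_all add: hex_disc_def)
qed

lemma facing_arc_gt_1:
  assumes "x > 0" "y > 0" "z > (0::real)"
  shows "(cosh x + cosh y * cosh z) / (sinh y * sinh z) > 1"
proof -
  have "sinh y * sinh z > 0" using assms by simp
  moreover have "cosh y * cosh z - sinh y * sinh z \<ge> 1"
    using cosh_diff[of y z] cosh_real_ge_1[of "y - z"] by simp
  moreover have "cosh x > 0" by (rule cosh_real_pos)
  ultimately show ?thesis by (subst less_divide_eq_1_pos) linarith+
qed

lemma facing_arc_pos:
  assumes "x > 0" "y > 0" "z > 0"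
  shows "facing_arc x y z > 0"
  using facing_arc_gt_1[OF assms] arcosh_real_gt_1_iff[OF less_imp_le[OF facing_arc_gt_1[OF assms]]]
  unfolding facing_arc_def by (metis less_irrefl)

lemma cosh_facing_arc:
  assumes "x > 0" "y > 0" "z > 0"
  shows "cosh (facing_arc x y z) = (cosh x + cosh y * cosh z) / (sinh y * sinh z)"
  using facing_arc_gt_1[OF assms] by (simp add: facing_arc_def cosh_arcosh_real)

lemma sqrt_facing_arc:
  assumes "x > 0" "y > 0" "z > 0"
  shows "sqrt (((cosh x + cosh y * cosh z) / (sinh y * sinh z))\<^sup>2 - 1) = hex_disc x y z / (sinh y * sinh z)"
proof -
  define X Y where "X = cosh x + cosh y * cosh z" and "Y = sinh y * sinh z"
  have Y: "Y > 0" using assms by (simp add: Y_def)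
  have "X\<^sup>2 - Y\<^sup>2 = (hex_disc x y z)\<^sup>2"
    unfolding hex_disc_pos(2)[OF assms] X_def Y_def power_mult_distrib sinh_square_eq
    by (simp add: power2_eq_square algebra_simps)
  moreover have "(X / Y)\<^sup>2 - 1 = (X\<^sup>2 - Y\<^sup>2) / Y\<^sup>2"
    using Y by (simp add: power_divide diff_divide_distrib)
  ultimately have "(X / Y)\<^sup>2 - 1 = (hex_disc x y z / Y)\<^sup>2"
    by (simp add: power_divide)
  then have "sqrt ((X / Y)\<^sup>2 - 1) = hex_disc x y z / Y"
    using hex_disc_pos(1)[OF assms] Y by simp
  then show ?thesis by (simp only: X_def Y_def)
qed

lemma sinh_facing_arc:
  assumes "x > 0" "y > 0" "z > 0"
  shows "sinh (facing_arc x y z) = hex_disc x y z / (sinh y * sinh z)"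
  using facing_arc_gt_1[OF assms] sqrt_facing_arc[OF assms]
  by (simp add: facing_arc_def sinh_arcosh_real)

text \<open>The first argument is the length of the red edge whose half gap is taken; the two arcs
  entering with a plus sign are the ones adjacent to it.\<close>

definition half_gap :: "real \<Rightarrow> real \<Rightarrow> real \<Rightarrow> real" where
  "half_gap x y z = (facing_arc y z x + facing_arc z x y - facing_arc x y z) / 2"

lemma half_gap_commute: "half_gap x y z = half_gap x z y"
  using facing_arc_commute[of y] facing_arc_commute[of z] facing_arc_commute[of x]
  by (simp add: half_gap_def)

lemma half_gap_add: "half_gap x y z + half_gap y z x = facing_arc z x y"
  by (simp add: half_gap_def field_simps)

text \<open>The cosine law with the two colours exchanged, which recovers a red length from the
  three black ones. Over a common denominator it becomes a polynomial identity in the hyperbolic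
  cosines and \<open>hex_disc\<close>.\<close>

lemma facing_arc_dual:
  assumes "x > 0" "y > 0" "z > 0"
  shows "cosh (facing_arc x y z) + cosh (facing_arc y z x) * cosh (facing_arc z x y)
    = cosh x * (sinh (facing_arc y z x) * sinh (facing_arc z x y))"
proof -
  have s: "sinh x > 0" "sinh y > 0" "sinh z > 0" using assms by simp_all
  have A: "hex_disc x y z * hex_disc x y z = (cosh x)\<^sup>2 + (cosh y)\<^sup>2 + (cosh z)\<^sup>2 + 2 * cosh x * cosh y * cosh z - 1"
    using hex_disc_pos(2)[OF assms] by (simp add: power2_eq_square)
  have "(cosh x + cosh y * cosh z) * (sinh x)\<^sup>2 + (cosh y + cosh z * cosh x) * (cosh z + cosh x * cosh y)
    = cosh x * (hex_disc x y z * hex_disc x y z)"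
    unfolding A sinh_square_eq by (simp add: power2_eq_square algebra_simps)
  then have "((cosh x + cosh y * cosh z) * (sinh x)\<^sup>2 + (cosh y + cosh z * cosh x) * (cosh z + cosh x * cosh y)) / ((sinh x)\<^sup>2 * sinh y * sinh z)
    = cosh x * (hex_disc x y z * hex_disc x y z) / ((sinh x)\<^sup>2 * sinh y * sinh z)" by simp
  then show ?thesis
    unfolding cosh_facing_arc[OF assms] cosh_facing_arc[OF assms(2,3,1)] cosh_facing_arc[OF assms(3,1,2)]
      sinh_facing_arc[OF assms(2,3,1)] sinh_facing_arc[OF assms(3,1,2)]
      hex_disc_rotate[of y z x] hex_disc_rotate[of x y z, symmetric]
    using s by (simp add: add_frac_eq power2_eq_square divide_simps ac_simps)
qed

lemma tanh_half_sq:
  fixes x :: real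
  shows "(tanh (x / 2))\<^sup>2 * (cosh x + 1) = cosh x - 1"
proof -
  have "cosh x = 2 * (cosh (x/2))\<^sup>2 - 1" using cosh_double_cosh[of "x/2"] by simp
  moreover have "(tanh (x / 2))\<^sup>2 = ((cosh (x/2))\<^sup>2 - 1) / (cosh (x/2))\<^sup>2"
    by (simp add: tanh_def power_divide sinh_square_eq)
  ultimately show ?thesis by simp
qed

text \<open>A half-length formula: \<open>tanh (x / 2)^2\<close> is
  \<open>(cosh x - 1) / (cosh x + 1)\<close>. By the dual cosine law, numerator and denominator
  become \<open>cosh p + cosh (q - s)\<close> and \<open>cosh p + cosh (q + s)\<close> up to a
  common factor, and these sums turn into products of two hyperbolic cosines.\<close>

lemma tanh_half_gap:
  assumes "x > 0" "y > 0" "z > 0"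
  defines "r \<equiv> half_gap x y z" and "r' \<equiv> half_gap y z x" and "r'' \<equiv> half_gap z x y"
  shows "(tanh (x / 2))\<^sup>2 * (cosh (r + r' + r'') * cosh r) = cosh r' * cosh r''"
proof -
  define p q s where "p = facing_arc x y z" and "q = facing_arc y z x" and "s = facing_arc z x y"
  have r: "r = (q + s - p) / 2" "r' = (s + p - q) / 2" "r'' = (p + q - s) / 2"
    by (simp_all add: assms(4-6) half_gap_def p_def q_def s_def)
  have 1: "2 * (cosh (r + r' + r'') * cosh r) = cosh p + (cosh q * cosh s + sinh q * sinh s)"
  proof -
    have "2 * (cosh (r + r' + r'') * cosh r) = cosh ((r + r' + r'') + r) + cosh ((r + r' + r'') - r)"
      using cosh_add[of "r + r' + r''" r] cosh_diff[of "r + r' + r''" r] by simp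
    moreover have "(r + r' + r'') + r = q + s" "(r + r' + r'') - r = p"
      unfolding r by (simp_all add: field_simps)
    ultimately show ?thesis by (simp add: cosh_add)
  qed
  have 2: "2 * (cosh r' * cosh r'') = cosh p + (cosh q * cosh s - sinh q * sinh s)"
  proof -
    have "2 * (cosh r' * cosh r'') = cosh (r' + r'') + cosh (r'' - r')"
      by (simp add: cosh_add cosh_diff)
    moreover have "r' + r'' = p" "r'' - r' = q - s" unfolding r by (simp_all add: field_simps)
    ultimately show ?thesis by (simp add: cosh_diff)
  qed
  have dual: "cosh p + cosh q * cosh s = cosh x * (sinh q * sinh s)"
    using facing_arc_dual[OF assms(1-3)] by (simp add: p_def q_def s_def)
  have c1: "cosh x + 1 > 0" using cosh_real_pos[of x] by linarith
  have "(tanh (x / 2))\<^sup>2 * (2 * (cosh (r + r' + r'') * cosh r)) = (tanh (x / 2))\<^sup>2 * (cosh x + 1) * (sinh q * sinh s)"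
  proof -
    have "cosh p + (cosh q * cosh s + sinh q * sinh s) = (cosh x + 1) * (sinh q * sinh s)"
      using dual by (simp add: algebra_simps)
    then show ?thesis unfolding 1 by simp
  qed
  also have "\<dots> = 2 * (cosh r' * cosh r'')"
    unfolding tanh_half_sq 2 using dual by (simp add: algebra_simps)
  finally show ?thesis by simp
qed

text \<open>Multiplying the half-length formula by \<open>cosh r\<close> makes its right-hand side
  the product of the three \<open>cosh\<close> of half gaps, which is symmetric in the three red
  edges. Both sides are nonnegative, so squares may be compared.\<close>

lemma tangent_law:
  assumes "x > 0" "y > 0" "z > 0"
  shows "tanh (x / 2) * cosh (half_gap x y z) = tanh (y / 2) * cosh (half_gap y z x)"
proof -
  let ?r = "half_gap x y z" and ?r' = "half_gap y z x" and ?r'' = "half_gap z x y"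
  let ?R = "cosh (?r + ?r' + ?r'')"
  have 1: "(tanh (x / 2))\<^sup>2 * (?R * cosh ?r) = cosh ?r' * cosh ?r''"
    and 2: "(tanh (y / 2))\<^sup>2 * (?R * cosh ?r') = cosh ?r'' * cosh ?r"
    using tanh_half_gap[OF assms] tanh_half_gap[OF assms(2,3,1)] by (simp_all add: add_ac)
  have "?R * (tanh (x / 2) * cosh ?r)\<^sup>2 = (tanh (x / 2))\<^sup>2 * (?R * cosh ?r) * cosh ?r"
    by (simp add: power2_eq_square)
  also have "\<dots> = (tanh (y / 2))\<^sup>2 * (?R * cosh ?r') * cosh ?r'"
    unfolding 1 2 by simp
  also have "\<dots> = ?R * (tanh (y / 2) * cosh ?r')\<^sup>2"
    by (simp add: power2_eq_square)
  finally have "?R * (tanh (x / 2) * cosh ?r)\<^sup>2 = ?R * (tanh (y / 2) * cosh ?r')\<^sup>2" .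
  then have "(tanh (x / 2) * cosh ?r)\<^sup>2 = (tanh (y / 2) * cosh ?r')\<^sup>2"
    using cosh_real_pos[of "?r + ?r' + ?r''"] by simp
  moreover have "tanh (x / 2) * cosh ?r \<ge> 0" "tanh (y / 2) * cosh ?r' \<ge> 0"
    using assms by (intro mult_nonneg_nonneg; simp)+
  ultimately show ?thesis by (rule power2_eq_imp_eq)
qed

section \<open>Differentials of black lengths and half gaps\<close>

text \<open>The differential of \<open>facing_arc\<close> at \<open>(x, y, z)\<close> applied to
  \<open>(a, b, c)\<close>. The coefficients of \<open>b\<close> and \<open>c\<close> are, up to
  sign, \<open>sinh x\<close> times the \<open>cosh\<close> of the arcs opposite to \<open>z\<close>
  and to \<open>y\<close>, all divided by \<open>hex_disc\<close>.\<close>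

definition darc :: "real \<Rightarrow> real \<Rightarrow> real \<Rightarrow> real \<Rightarrow> real \<Rightarrow> real \<Rightarrow> real" where
  "darc x y z a b c = (sinh x * a - (cosh z + cosh x * cosh y) / sinh y * b
     - (cosh y + cosh x * cosh z) / sinh z * c) / hex_disc x y z"

definition dgap :: "real \<Rightarrow> real \<Rightarrow> real \<Rightarrow> real \<Rightarrow> real \<Rightarrow> real \<Rightarrow> real" where
  "dgap x y z a b c = (darc y z x b c a + darc z x y c a b - darc x y z a b c) / 2"

lemma facing_arc_has_derivative:
  assumes "(f has_derivative f') (at p)" "(g has_derivative g') (at p)" "(k has_derivative k') (at p)"
    and pos: "f p > 0" "g p > 0" "k p > 0"
  shows "((\<lambda>p. facing_arc (f p) (g p) (k p)) has_derivative
     (\<lambda>v. darc (f p) (g p) (k p) (f' v) (g' v) (k' v))) (at p)"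
proof -
  let ?x = "f p" and ?y = "g p" and ?z = "k p"
  define u where "u p = (cosh (f p) + cosh (g p) * cosh (k p)) / (sinh (g p) * sinh (k p))" for p
  define N where "N v = sinh ?x * f' v + (cosh ?y * (sinh ?z * k' v) + sinh ?y * g' v * cosh ?z)" for v
  define u' where "u' v = (N v * (sinh ?y * sinh ?z) - (cosh ?x + cosh ?y * cosh ?z) * (sinh ?y * (cosh ?z * k' v) + cosh ?y * g' v * sinh ?z))
     / (sinh ?y * sinh ?z * (sinh ?y * sinh ?z))" for v
  have s: "sinh ?y > 0" "sinh ?z > 0" using pos by simp_all
  have A: "hex_disc ?x ?y ?z > 0" by (rule hex_disc_pos[OF pos])
  have hyp: "(cosh has_real_derivative sinh t) (at t)" "(sinh has_real_derivative cosh t) (at t)" for t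
    using has_field_derivative_cosh[OF DERIV_ident, of t] has_field_derivative_sinh[OF DERIV_ident, of t] by simp_all
  note cs = assms(1-3)[THEN DERIV_compose_FDERIV[OF hyp(1)]] assms(1-3)[THEN DERIV_compose_FDERIV[OF hyp(2)]]
  have d1: "((\<lambda>p. cosh (f p) + cosh (g p) * cosh (k p)) has_derivative N) (at p)"
    using has_derivative_add[OF cs(1) has_derivative_mult[OF cs(2,3)]]
    by (rule has_derivative_eq_rhs) (simp add: N_def fun_eq_iff algebra_simps)
  have d2: "((\<lambda>p. sinh (g p) * sinh (k p)) has_derivative
     (\<lambda>v. sinh ?y * (cosh ?z * k' v) + cosh ?y * g' v * sinh ?z)) (at p)"
    using has_derivative_mult[OF cs(5,6)]
    by (rule has_derivative_eq_rhs) (simp add: fun_eq_iff algebra_simps)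
  have du: "(u has_derivative u') (at p)"
    unfolding u_def u'_def using s by (intro has_derivative_divide' d1 d2) simp
  have u1: "u p > 1" unfolding u_def by (rule facing_arc_gt_1[OF pos])
  have "(arcosh has_field_derivative (1 / sqrt ((u p)\<^sup>2 - 1))) (at (u p))"
    using u1 by (rule arcosh_real_has_field_derivative)
  from DERIV_compose_FDERIV[OF this du]
  have "((\<lambda>p. arcosh (u p)) has_derivative (\<lambda>v. 1 / sqrt ((u p)\<^sup>2 - 1) * u' v)) (at p)"
    by (simp add: mult.commute)
  moreover have "1 / sqrt ((u p)\<^sup>2 - 1) * u' v = darc ?x ?y ?z (f' v) (g' v) (k' v)" for v
  proof -
    have "sqrt ((u p)\<^sup>2 - 1) = hex_disc ?x ?y ?z / (sinh ?y * sinh ?z)"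
      unfolding u_def by (rule sqrt_facing_arc[OF pos])
    then have "1 / sqrt ((u p)\<^sup>2 - 1) * u' v = (u' v * (sinh ?y * sinh ?z)) / hex_disc ?x ?y ?z"
      by simp
    also have "u' v * (sinh ?y * sinh ?z) = sinh ?x * f' v - (cosh ?z + cosh ?x * cosh ?y) / sinh ?y * g' v
     - (cosh ?y + cosh ?x * cosh ?z) / sinh ?z * k' v"
    proof -
      have "N v * (sinh ?y * sinh ?z) - (cosh ?x + cosh ?y * cosh ?z) * (sinh ?y * (cosh ?z * k' v) + cosh ?y * g' v * sinh ?z)
        = sinh ?x * f' v * (sinh ?y * sinh ?z) - (cosh ?z * ((cosh ?y)\<^sup>2 - (sinh ?y)\<^sup>2) + cosh ?x * cosh ?y) * sinh ?z * g' v
          - (cosh ?y * ((cosh ?z)\<^sup>2 - (sinh ?z)\<^sup>2) + cosh ?x * cosh ?z) * sinh ?y * k' v"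
        unfolding N_def by (simp add: power2_eq_square algebra_simps)
      then show ?thesis
        unfolding u'_def hyperbolic_pythagoras using s by (simp add: diff_divide_distrib left_diff_distrib)
    qed
    finally show ?thesis by (simp add: darc_def)
  qed
  ultimately show ?thesis by (simp add: facing_arc_def[abs_def] u_def)
qed

lemma half_gap_has_derivative:
  assumes "(f has_derivative f') (at p)" "(g has_derivative g') (at p)" "(k has_derivative k') (at p)"
    and pos: "f p > 0" "g p > 0" "k p > 0"
  shows "((\<lambda>p. half_gap (f p) (g p) (k p)) has_derivative
     (\<lambda>v. dgap (f p) (g p) (k p) (f' v) (g' v) (k' v))) (at p)"
proof -
  note d = facing_arc_has_derivative
  have "((\<lambda>p. (facing_arc (g p) (k p) (f p) + facing_arc (k p) (f p) (g p) - facing_arc (f p) (g p) (k p)) * (1/2)) has_derivative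
    (\<lambda>v. (darc (g p) (k p) (f p) (g' v) (k' v) (f' v) + darc (k p) (f p) (g p) (k' v) (f' v) (g' v) 
      - darc (f p) (g p) (k p) (f' v) (g' v) (k' v)) * (1/2))) (at p)"
    by (intro has_derivative_mult_left has_derivative_add has_derivative_diff d assms)
  then show ?thesis by (simp add: half_gap_def[abs_def] dgap_def)
qed

lemma tanh_half_real: "x \<noteq> 0 \<Longrightarrow> tanh (x / 2) = (cosh x - 1) / sinh (x::real)"
proof -
  assume "x \<noteq> 0"
  have "sinh x = 2 * sinh (x/2) * cosh (x/2)" "cosh x = 2 * (sinh (x/2))\<^sup>2 + 1"
    using sinh_double[of "x/2"] cosh_double[of "x/2"] by (simp_all add: cosh_square_eq)
  then show ?thesis using \<open>x \<noteq> 0\<close> by (simp add: tanh_def power2_eq_square)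
qed

text \<open>In half lengths the coefficient of \<open>b\<close> is \<open>tanh (y / 2)\<close> times
  an expression symmetric in \<open>x\<close> and \<open>y\<close>, and likewise for
  \<open>c\<close>. This form exhibits the symmetry of the weighted Jacobian.\<close>

lemma dgap_eq:
  assumes "x > 0" "y > 0" "z > 0"
  shows "2 * hex_disc x y z * dgap x y z a b c =
    - (cosh x + cosh y + cosh z - 1) / tanh (x / 2) * a
    + tanh (y / 2) * (1 + cosh x + cosh y - cosh z) * b
    + tanh (z / 2) * (1 + cosh x + cosh z - cosh y) * c"
proof -
  have A: "hex_disc x y z > 0" by (rule hex_disc_pos[OF assms])
  have s: "sinh x > 0" "sinh y > 0" "sinh z > 0" using assms by simp_all
  have c: "cosh x > 1" "cosh y > 1" "cosh z > 1" using assms cosh_gt_1 by auto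
  have T: "tanh (y / 2) = (cosh y - 1) / sinh y" "tanh (z / 2) = (cosh z - 1) / sinh z"
    using assms by (simp_all add: tanh_half_real)
  have Tx: "1 / tanh (x / 2) = (cosh x + 1) / sinh x"
  proof -
    have "(cosh x - 1) * (cosh x + 1) = sinh x * sinh x"
      using sinh_square_eq[of x] by (simp add: power2_eq_square algebra_simps)
    then show ?thesis using assms s c by (simp add: tanh_half_real field_simps)
  qed
  \<comment> \<open>Treating the reciprocals of the hyperbolic sines as separate variables turns the
    claim into a polynomial identity.\<close>
  define X Y Z where "X = 1 / sinh x" and "Y = 1 / sinh y" and "Z = 1 / sinh z"
  have sx: "sinh x = ((cosh x)\<^sup>2 - 1) * X" "sinh y = ((cosh y)\<^sup>2 - 1) * Y" "sinh z = ((cosh z)\<^sup>2 - 1) * Z"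
    using s unfolding sinh_square_eq[symmetric] by (simp_all add: power2_eq_square X_def Y_def Z_def)
  have div: "t / sinh x = t * X" "t / sinh y = t * Y" "t / sinh z = t * Z" for t
    by (simp_all add: X_def Y_def Z_def)
  have "2 * hex_disc x y z * dgap x y z a b c = 
     (sinh y * b - (cosh x + cosh y * cosh z) / sinh z * c - (cosh z + cosh y * cosh x) / sinh x * a)
   + (sinh z * c - (cosh y + cosh z * cosh x) / sinh x * a - (cosh x + cosh z * cosh y) / sinh y * b)
   - (sinh x * a - (cosh z + cosh x * cosh y) / sinh y * b - (cosh y + cosh x * cosh z) / sinh z * c)"
    unfolding dgap_def darc_def hex_disc_rotate[of y z x] hex_disc_rotate[of x y z, symmetric]
    using A by (simp flip: add_divide_distrib diff_divide_distrib)
  also have "\<dots> = - (cosh x + cosh y + cosh z - 1) * ((cosh x + 1) / sinh x) * a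
    + (cosh y - 1) / sinh y * (1 + cosh x + cosh y - cosh z) * b
    + (cosh z - 1) / sinh z * (1 + cosh x + cosh z - cosh y) * c"
    unfolding div using sx by algebra
  also have "\<dots> = - (cosh x + cosh y + cosh z - 1) / tanh (x / 2) * a
    + tanh (y / 2) * (1 + cosh x + cosh y - cosh z) * b
    + tanh (z / 2) * (1 + cosh x + cosh z - cosh y) * c"
    unfolding T Tx[symmetric] by simp
  finally show ?thesis .
qed

text \<open>The difference of the two sides is a nonnegative combination of squares plus twice the
  defect in the weighted Cauchy-Schwarz inequality \<open>cs\<close>. It is applied with
  \<open>p = cosh x - 1\<close> and \<open>u = tanh (x / 2) * a\<close>.\<close>

lemma quadratic_form_pos:
  fixes p q r u v w :: real
  assumes "p > 0" "q > 0" "r > 0" and "u \<noteq> 0 \<or> v \<noteq> 0 \<or> w \<noteq> 0"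
  defines "P \<equiv> p + q + r"
  shows "(P + 2) * (1 + 2 / p) * u\<^sup>2 + (P + 2) * (1 + 2 / q) * v\<^sup>2 + (P + 2) * (1 + 2 / r) * w\<^sup>2
    > 2 * (P + 2 - 2 * r) * u * v + 2 * (P + 2 - 2 * p) * v * w + 2 * (P + 2 - 2 * q) * w * u"
proof -
  have cs: "(u + v + w)\<^sup>2 \<le> P * (u\<^sup>2 / p + v\<^sup>2 / q + w\<^sup>2 / r)"
  proof -
    have *: "2 * (x * y) \<le> a / b * y\<^sup>2 + b / a * x\<^sup>2" if "a > 0" "b > 0" for x y a b :: real
    proof -
      have "a * b * (a / b * y\<^sup>2 + b / a * x\<^sup>2 - 2 * (x * y)) = (a * y - b * x)\<^sup>2"
        using that by (simp add: power2_eq_square algebra_simps)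
      then have "a * b * (a / b * y\<^sup>2 + b / a * x\<^sup>2 - 2 * (x * y)) \<ge> 0" by simp
      moreover have "a * b > 0" using that by simp
      ultimately have "a / b * y\<^sup>2 + b / a * x\<^sup>2 - 2 * (x * y) \<ge> 0"
        by (metis mult_less_cancel_left_pos not_le mult_zero_right)
      then show ?thesis by linarith
    qed
    have "P * (u\<^sup>2 / p + v\<^sup>2 / q + w\<^sup>2 / r) = u\<^sup>2 + v\<^sup>2 + w\<^sup>2 + (p / q * v\<^sup>2 + q / p * u\<^sup>2)
       + (q / r * w\<^sup>2 + r / q * v\<^sup>2) + (r / p * u\<^sup>2 + p / r * w\<^sup>2)"
      using assms(1-3) by (simp add: P_def algebra_simps add_divide_distrib)
    then show ?thesis
      using *[of p q u v] *[of q r v w] *[of r p w u] assms(1-3)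
      by (simp add: power2_eq_square algebra_simps)
  qed
  have pos: "u\<^sup>2 / p + v\<^sup>2 / q + w\<^sup>2 / r > 0"
    using assms(1-4) by (smt (verit) divide_nonneg_pos divide_pos_pos zero_le_power2 zero_less_power2)
  have e: "(P + 2) * (1 + 2 / p) * u\<^sup>2 + (P + 2) * (1 + 2 / q) * v\<^sup>2 + (P + 2) * (1 + 2 / r) * w\<^sup>2
    - (2 * (P + 2 - 2 * r) * u * v + 2 * (P + 2 - 2 * p) * v * w + 2 * (P + 2 - 2 * q) * w * u)
    = p * (u - v - w)\<^sup>2 + q * (v - w - u)\<^sup>2 + r * (w - u - v)\<^sup>2
     + 4 * (u\<^sup>2 + v\<^sup>2 + w\<^sup>2) + 2 * (P * (u\<^sup>2 / p + v\<^sup>2 / q + w\<^sup>2 / r) - (u + v + w)\<^sup>2)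
     + 4 * (u\<^sup>2 / p + v\<^sup>2 / q + w\<^sup>2 / r)"
    by (simp add: P_def power2_eq_square add_divide_distrib algebra_simps)
  have "P * (u\<^sup>2 / p + v\<^sup>2 / q + w\<^sup>2 / r) - (u + v + w)\<^sup>2 \<ge> 0"
    using cs by simp
  then have "p * (u - v - w)\<^sup>2 + q * (v - w - u)\<^sup>2 + r * (w - u - v)\<^sup>2
     + 4 * (u\<^sup>2 + v\<^sup>2 + w\<^sup>2) + 2 * (P * (u\<^sup>2 / p + v\<^sup>2 / q + w\<^sup>2 / r) - (u + v + w)\<^sup>2)
     + 4 * (u\<^sup>2 / p + v\<^sup>2 / q + w\<^sup>2 / r) > 0"
    using pos assms(1-3) by (intro add_nonneg_pos add_nonneg_nonneg mult_nonneg_nonneg) auto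
  then show ?thesis unfolding e[symmetric] by simp
qed

text \<open>The Jacobian of the half gaps becomes symmetric after weighting by \<open>tanh (x / 2)\<close>.\<close>

lemma dgap_form_neg:
  assumes "x > 0" "y > 0" "z > 0" and "a \<noteq> 0 \<or> b \<noteq> 0 \<or> c \<noteq> 0"
  shows "tanh (x / 2) * a * dgap x y z a b c + tanh (y / 2) * b * dgap y z x b c a
    + tanh (z / 2) * c * dgap z x y c a b < 0"
proof -
  define A where "A = 2 * hex_disc x y z"
  have A: "A > 0" using hex_disc_pos[OF assms(1-3)] by (simp add: A_def)
  define p q r where "p = cosh x - 1" and "q = cosh y - 1" and "r = cosh z - 1"
  have pqr: "p > 0" "q > 0" "r > 0" using assms cosh_gt_1 by (auto simp: p_def q_def r_def)
  define P where "P = p + q + r"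
  define t1 t2 t3 where "t1 = tanh (x / 2)" and "t2 = tanh (y / 2)" and "t3 = tanh (z / 2)"
  have t: "t1 > 0" "t2 > 0" "t3 > 0" using assms by (simp_all add: t1_def t2_def t3_def)
  \<comment> \<open>As \<open>p = cosh x - 1\<close>, the factor \<open>1 + 2 / p\<close> is the
    inverse square of \<open>tanh (x / 2)\<close>; it converts the diagonal coefficients into those
    of the abstract form.\<close>
  have tt: "t1\<^sup>2 * (1 + 2 / p) = 1" "t2\<^sup>2 * (1 + 2 / q) = 1" "t3\<^sup>2 * (1 + 2 / r) = 1"
  proof -
    have frac: "1 + 2 / (k - 1) = (k + 1) / (k - 1)" if "k > 1" for k :: real
      using that by (simp add: field_simps)
    have *: "(tanh (s / 2))\<^sup>2 * (1 + 2 / (cosh s - 1)) = 1" if "cosh s > 1" for s :: real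
    proof -
      have "(tanh (s / 2))\<^sup>2 * ((cosh s + 1) / (cosh s - 1)) = (cosh s - 1) / (cosh s - 1)"
        using tanh_half_sq[of s] by simp
      then show ?thesis unfolding frac[OF that] using that by (metis diff_gt_0_iff_gt divide_self less_irrefl)
    qed
    show "t1\<^sup>2 * (1 + 2 / p) = 1" "t2\<^sup>2 * (1 + 2 / q) = 1" "t3\<^sup>2 * (1 + 2 / r) = 1"
      using *[of x] *[of y] *[of z] pqr by (simp_all add: t1_def t2_def t3_def p_def q_def r_def)
  qed
  have inv: "1 / t = t * (1 + 2 / s)" if "t\<^sup>2 * (1 + 2 / s) = 1" "t > 0" for t s :: real
    using that by (simp add: divide_eq_eq power2_eq_square mult_ac)
  note inv = inv[OF tt(1) t(1)] inv[OF tt(2) t(2)] inv[OF tt(3) t(3)]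
  define u v w where "u = t1 * a" and "v = t2 * b" and "w = t3 * c"
  have nz: "u \<noteq> 0 \<or> v \<noteq> 0 \<or> w \<noteq> 0" using assms(4) t by (simp add: u_def v_def w_def)
  have g1: "A * dgap x y z a b c = - (P + 2) * (1 / t1) * a + (P + 2 - 2 * r) * v + (P + 2 - 2 * q) * w"
    using dgap_eq[OF assms(1,2,3), of a b c]
    by (simp add: A_def P_def p_def q_def r_def t1_def v_def w_def t2_def t3_def algebra_simps add_divide_distrib diff_divide_distrib)
  have g2: "A * dgap y z x b c a = - (P + 2) * (1 / t2) * b + (P + 2 - 2 * p) * w + (P + 2 - 2 * r) * u"
    using dgap_eq[OF assms(2,3,1), of b c a]
    by (simp add: hex_disc_rotate[of y z x] A_def P_def p_def q_def r_def t1_def u_def w_def t2_def t3_def algebra_simps add_divide_distrib diff_divide_distrib)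
  have g3: "A * dgap z x y c a b = - (P + 2) * (1 / t3) * c + (P + 2 - 2 * q) * u + (P + 2 - 2 * p) * v"
    using dgap_eq[OF assms(3,1,2), of c a b]
    by (simp add: hex_disc_rotate[of x y z, symmetric] A_def P_def p_def q_def r_def t1_def u_def v_def t2_def t3_def algebra_simps add_divide_distrib diff_divide_distrib)
  have "A * (u * dgap x y z a b c + v * dgap y z x b c a + w * dgap z x y c a b)
    = u * (A * dgap x y z a b c) + v * (A * dgap y z x b c a) + w * (A * dgap z x y c a b)"
    by (simp add: algebra_simps)
  also have "\<dots> = - ((P + 2) * (1 + 2 / p) * u\<^sup>2 + (P + 2) * (1 + 2 / q) * v\<^sup>2 + (P + 2) * (1 + 2 / r) * w\<^sup>2)
    + (2 * (P + 2 - 2 * r) * u * v + 2 * (P + 2 - 2 * p) * v * w + 2 * (P + 2 - 2 * q) * w * u)"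
    unfolding g1 g2 g3 inv
    by (simp add: u_def v_def w_def power2_eq_square algebra_simps add_divide_distrib diff_divide_distrib)
  also have "\<dots> < 0"
    using quadratic_form_pos[OF pqr nz] by (simp add: P_def)
  finally show ?thesis
    using A by (simp add: mult_less_0_iff u_def v_def w_def t1_def t2_def t3_def)
qed


section \<open>The primitive of a power of cosh\<close>

definition cosh_primitive :: "real \<Rightarrow> real \<Rightarrow> real" where
  "cosh_primitive lam x = (LBINT t=0..ereal x. cosh t powr lam)"

lemma cosh_powr_pos: "cosh t powr lam > (0::real)"
  using cosh_real_pos[of t] by simp

lemma continuous_on_cosh_powr: "continuous_on A (\<lambda>t::real. cosh t powr lam)"
  using cosh_real_pos by (intro continuous_intros) (auto simp: less_imp_neq[THEN not_sym])

lemma borel_measurable_cosh_powr [measurable]: "(\<lambda>t::real. cosh t powr lam) \<in> borel_measurable borel"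
  by (rule borel_measurable_continuous_onI[OF continuous_on_cosh_powr])

lemma cosh_primitive_DERIV: "(cosh_primitive lam has_real_derivative cosh x powr lam) (at x)"
proof -
  define a b where "a = - \<bar>x\<bar> - 1" and "b = \<bar>x\<bar> + 1"
  have "continuous_on {a..b} (\<lambda>t. cosh t powr lam)"
    by (rule continuous_on_cosh_powr)
  then have "((\<lambda>u. LBINT t=ereal 0..ereal u. cosh t powr lam) has_vector_derivative cosh x powr lam)
      (at x within {a..b})"
    by (intro interval_integral_FTC2) (auto simp: a_def b_def)
  then have "((\<lambda>u. LBINT t=ereal 0..ereal u. cosh t powr lam) has_vector_derivative cosh x powr lam)
      (at x within {a<..<b})"
    by (rule has_vector_derivative_within_subset) auto
  moreover have "x \<in> {a<..<b}" by (auto simp: a_def b_def)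
  ultimately have "((\<lambda>u. LBINT t=ereal 0..ereal u. cosh t powr lam) has_vector_derivative cosh x powr lam) (at x)"
    by (metis has_vector_derivative_within_open open_greaterThanLessThan)
  then show ?thesis
    by (simp add: cosh_primitive_def[abs_def] has_real_derivative_iff_has_vector_derivative zero_ereal_def)
qed

lemma cosh_primitive_0 [simp]: "cosh_primitive lam 0 = 0"
  by (simp add: cosh_primitive_def flip: zero_ereal_def)

lemma isCont_cosh_primitive: "isCont (cosh_primitive lam) x"
  using cosh_primitive_DERIV DERIV_isCont by blast

lemma cosh_primitive_less: "x < y \<Longrightarrow> cosh_primitive lam x < cosh_primitive lam y"
  by (rule DERIV_pos_imp_increasing[of x y]) (auto intro: cosh_primitive_DERIV cosh_powr_pos)

lemma cosh_primitive_less_iff [simp]: "cosh_primitive lam x < cosh_primitive lam y \<longleftrightarrow> x < y"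
  using cosh_primitive_less[of x y lam] cosh_primitive_less[of y x lam] by (cases x y rule: linorder_cases) auto

lemma cosh_primitive_le_iff [simp]: "cosh_primitive lam x \<le> cosh_primitive lam y \<longleftrightarrow> x \<le> y"
  by (simp flip: not_less)

lemma cosh_primitive_minus [simp]: "cosh_primitive lam (- x) = - cosh_primitive lam x"
proof -
  have "((\<lambda>x. cosh_primitive lam x + cosh_primitive lam (- x)) has_real_derivative 0) (at t)" for t
  proof -
    have "((\<lambda>x. cosh_primitive lam (- x)) has_real_derivative cosh (- t) powr lam * (- 1)) (at t)"
      by (rule DERIV_chain2[OF cosh_primitive_DERIV]) (auto intro!: derivative_eq_intros)
    from DERIV_add[OF cosh_primitive_DERIV[of lam t] this] show ?thesis by simp
  qed
  then have "cosh_primitive lam x + cosh_primitive lam (- x) = cosh_primitive lam 0 + cosh_primitive lam (- 0)"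
    using DERIV_isconst_all[of "\<lambda>x. cosh_primitive lam x + cosh_primitive lam (- x)"] by blast
  then show ?thesis by simp
qed

lemma cosh_primitive_add_pos: "a + b > 0 \<Longrightarrow> cosh_primitive lam a + cosh_primitive lam b > 0"
  using cosh_primitive_less[of "- b" a lam] by simp

text \<open>By oddness the sum is the integral of the integrand over the interval from
  \<open>- b\<close> to \<open>a\<close>, whose length is \<open>a + b\<close>.\<close>

lemma cosh_primitive_add_le:
  assumes "a + b \<ge> 0" and "\<And>t. - b \<le> t \<Longrightarrow> t \<le> a \<Longrightarrow> cosh t powr lam \<le> C"
  shows "cosh_primitive lam a + cosh_primitive lam b \<le> C * (a + b)"
proof -
  have "C * (- b) - cosh_primitive lam (- b) \<le> C * a - cosh_primitive lam a"
  proof (rule DERIV_nonneg_imp_nondecreasing[where f = "\<lambda>x. C * x - cosh_primitive lam x"])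
    fix x assume "- b \<le> x" "x \<le> a"
    then show "\<exists>y. ((\<lambda>x. C * x - cosh_primitive lam x) has_real_derivative y) (at x) \<and> 0 \<le> y"
      using assms(2)[of x] by (intro exI[of _ "C - cosh x powr lam"])
        (auto intro!: derivative_eq_intros cosh_primitive_DERIV)
  qed (use assms in simp)
  then show ?thesis by (simp add: algebra_simps)
qed

lemma cosh_primitive_mono_exponent:
  assumes "lam \<le> mu" "0 \<le> a" "a \<le> b"
  shows "cosh_primitive lam b - cosh_primitive lam a \<le> cosh_primitive mu b - cosh_primitive mu a"
proof -
  have "cosh_primitive mu a - cosh_primitive lam a \<le> cosh_primitive mu b - cosh_primitive lam b"
  proof (rule DERIV_nonneg_imp_nondecreasing[where f = "\<lambda>x. cosh_primitive mu x - cosh_primitive lam x", OF assms(3)])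
    fix x
    have "cosh x powr lam \<le> cosh x powr mu"
      using assms(1) cosh_real_ge_1 by (intro powr_mono)
    then show "\<exists>y. ((\<lambda>x. cosh_primitive mu x - cosh_primitive lam x) has_real_derivative y) (at x) \<and> 0 \<le> y"
      by (intro exI[of _ "cosh x powr mu - cosh x powr lam"])
        (auto intro!: derivative_eq_intros cosh_primitive_DERIV)
  qed
  then show ?thesis by simp
qed

lemma cosh_primitive_exponent_0: "cosh_primitive 0 x = x"
proof -
  have "((\<lambda>x. cosh_primitive 0 x - x) has_real_derivative 0) (at t)" for t
    by (auto intro!: derivative_eq_intros cosh_primitive_DERIV)
  then have "cosh_primitive 0 x - x = cosh_primitive 0 0 - 0"
    using DERIV_isconst_all[of "\<lambda>x. cosh_primitive 0 x - x"] by blast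
  then show ?thesis by simp
qed

lemma cosh_primitive_ge: "lam \<ge> 0 \<Longrightarrow> x \<ge> 0 \<Longrightarrow> cosh_primitive lam x \<ge> x"
  using cosh_primitive_mono_exponent[of 0 lam 0 x] by (simp add: cosh_primitive_exponent_0)

lemma cosh_primitive_le_cosh_integral: "ereal (cosh_primitive lam A) \<le> cosh_integral lam"
proof (cases "A \<ge> 0")
  case True
  have "ennreal (cosh_primitive lam A) = (\<integral>\<^sup>+t. ennreal (cosh t powr lam) * indicator {0..A} t \<partial>lborel)"
    using True by (subst nn_integral_FTC_Icc[of _ 0 A "cosh_primitive lam"]) (auto intro: cosh_primitive_DERIV)
  also have "\<dots> \<le> (\<integral>\<^sup>+t\<in>{0..}. ennreal (cosh t powr lam) \<partial>lborel)"
    by (intro nn_integral_mono mult_left_mono) (auto split: split_indicator)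
  finally have "enn2ereal (ennreal (cosh_primitive lam A)) \<le> cosh_integral lam"
    unfolding cosh_integral_def by (simp add: less_eq_ennreal.rep_eq)
  moreover have "cosh_primitive lam A \<ge> 0" using True cosh_primitive_le_iff[of lam 0 A] by simp
  ultimately show ?thesis by (simp add: enn2ereal_ennreal)
next
  case False
  then have "cosh_primitive lam A \<le> 0" using cosh_primitive_le_iff[of lam A 0] by simp
  then have "ereal (cosh_primitive lam A) \<le> 0" by simp
  also have "\<dots> \<le> cosh_integral lam" by (simp add: cosh_integral_def)
  finally show ?thesis .
qed

lemma cosh_primitive_less_cosh_integral: "ereal (cosh_primitive lam A) < cosh_integral lam"
proof -
  have "ereal (cosh_primitive lam A) < ereal (cosh_primitive lam (A + 1))" by simp
  also have "\<dots> \<le> cosh_integral lam" by (rule cosh_primitive_le_cosh_integral)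
  finally show ?thesis .
qed

text \<open>A bounded increasing primitive converges to its supremum, which is therefore the
  improper integral. This transfers bounds on finite upper limits to the extended real
  value.\<close>

lemma cosh_integral_le:
  assumes "\<And>A. A \<ge> 0 \<Longrightarrow> cosh_primitive lam A \<le> y"
  shows "cosh_integral lam \<le> ereal y"
proof -
  have le: "cosh_primitive lam A \<le> y" for A
    using assms[of A] assms[of 0] cosh_primitive_le_iff[of lam A 0] by (cases "A \<ge> 0") auto
  define T where "T = (SUP A. cosh_primitive lam A)"
  have bdd: "bdd_above (range (cosh_primitive lam))" using le by (intro bdd_aboveI[of _ y]) auto
  have lim: "(cosh_primitive lam \<longlongrightarrow> T) at_top"
  proof (rule order_tendstoI)
    fix a assume "a < T"
    then obtain A where "a < cosh_primitive lam A"
      unfolding T_def using less_cSUP_iff[OF _ bdd] by auto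
    then show "\<forall>\<^sub>F x in at_top. a < cosh_primitive lam x"
      by (intro eventually_at_top_linorderI[of A]) (meson cosh_primitive_le_iff less_le_trans)
  next
    fix a assume "T < a"
    then show "\<forall>\<^sub>F x in at_top. cosh_primitive lam x < a"
      unfolding T_def by (intro always_eventually allI) (meson bdd cSUP_upper UNIV_I le_less_trans)
  qed
  have "(\<integral>\<^sup>+t\<in>{0..}. ennreal (cosh t powr lam) \<partial>lborel) = T - cosh_primitive lam 0"
    by (rule nn_integral_FTC_atLeast[OF _ _ _ lim]) (auto intro: cosh_primitive_DERIV)
  moreover have "T \<ge> 0" unfolding T_def by (rule cSUP_upper2[OF bdd, of 0]) auto
  ultimately have "cosh_integral lam = ereal T" by (simp add: cosh_integral_def enn2ereal_ennreal)
  moreover have "T \<le> y" unfolding T_def using le by (intro cSUP_least) auto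
  ultimately show ?thesis by simp
qed

lemma cosh_integral_pos: "cosh_integral lam > 0"
  using cosh_primitive_less_cosh_integral[of lam 0] by (simp add: zero_ereal_def)

lemma cosh_integral_nonneg_exponent:
  assumes "lam \<ge> 0"
  shows "cosh_integral lam = \<infinity>"
proof (rule ereal_top)
  fix B :: real
  have "B \<le> cosh_primitive lam \<bar>B\<bar>" using cosh_primitive_ge[OF assms, of "\<bar>B\<bar>"] by simp
  also have "ereal \<dots> \<le> cosh_integral lam" by (rule cosh_primitive_le_cosh_integral)
  finally show "ereal B \<le> cosh_integral lam" by simp
qed

lemma cosh_integral_finite:
  assumes "lam < 0"
  obtains C where "cosh_integral lam = ereal C"
proof -
  have "cosh_primitive lam A \<le> 2 powr (- lam) / (- lam)" if "A \<ge> 0" for A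
  proof -
    \<comment> \<open>Since \<open>cosh x\<close> is at least \<open>exp x / 2\<close> and
      \<open>lam\<close> is negative, the integrand is at most
      \<open>2 powr (- lam) * exp (lam * x)\<close>; \<open>G\<close> is a primitive of the
      difference.\<close>
    define G where "G x = 2 powr (- lam) / lam * exp (lam * x) - cosh_primitive lam x" for x
    have "G 0 \<le> G A"
    proof (rule DERIV_nonneg_imp_nondecreasing[OF that])
      fix x :: real
      have "exp x / 2 \<le> cosh x" by (simp add: cosh_def exp_ge_zero)
      then have "cosh x powr lam \<le> (exp x / 2) powr lam"
        using assms by (intro powr_mono2') auto
      also have "\<dots> = 2 powr (- lam) * exp (lam * x)"
        by (simp add: powr_def ln_div algebra_simps flip: exp_add)
      finally have "0 \<le> 2 powr (- lam) * exp (lam * x) - cosh x powr lam" by simp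
      moreover have "(G has_real_derivative 2 powr (- lam) * exp (lam * x) - cosh x powr lam) (at x)"
        unfolding G_def[abs_def] using assms
        by (auto intro!: derivative_eq_intros cosh_primitive_DERIV)
      ultimately show "\<exists>y. (G has_real_derivative y) (at x) \<and> 0 \<le> y" by blast
    qed
    moreover have "2 powr (- lam) / lam * exp (lam * A) \<le> 0"
      using assms by (intro mult_nonpos_nonneg) (auto simp: divide_nonneg_neg)
    ultimately show ?thesis by (simp add: G_def)
  qed
  then have "cosh_integral lam \<le> ereal (2 powr (- lam) / (- lam))" by (rule cosh_integral_le)
  then show ?thesis using that cosh_integral_pos[of lam] by (cases "cosh_integral lam") auto
qed

text \<open>Pointwise strictness alone would be lost in the limit. A definite surplus
  \<open>d\<close> is gained on the interval from 0 to 1, and it cannot shrink beyond 1.\<close>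

lemma cosh_integral_strict_mono:
  assumes "lam < mu" "mu < 0"
  shows "cosh_integral lam < cosh_integral mu"
proof -
  obtain C where C: "cosh_integral mu = ereal C" using cosh_integral_finite[OF assms(2)] .
  define d where "d = cosh_primitive mu 1 - cosh_primitive lam 1"
  have "cosh_primitive mu 0 - cosh_primitive lam 0 < cosh_primitive mu 1 - cosh_primitive lam 1"
  proof (rule DERIV_pos_imp_increasing_open[where f = "\<lambda>x. cosh_primitive mu x - cosh_primitive lam x"])
    fix x :: real assume "0 < x" "x < 1"
    then have "cosh x powr lam < cosh x powr mu"
      using assms(1) cosh_real_strict_mono[of 0 x] by (intro powr_less_mono) auto
    then show "\<exists>y. ((\<lambda>x. cosh_primitive mu x - cosh_primitive lam x) has_real_derivative y) (at x) \<and> 0 < y"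
      by (intro exI[of _ "cosh x powr mu - cosh x powr lam"])
        (auto intro!: derivative_eq_intros cosh_primitive_DERIV)
  qed (auto intro!: continuous_intros continuous_at_imp_continuous_on isCont_cosh_primitive)
  then have d: "d > 0" by (simp add: d_def)
  have "cosh_integral lam \<le> ereal (C - d)"
  proof (rule cosh_integral_le)
    fix A :: real assume "A \<ge> 0"
    have "cosh_primitive lam (A + 1) - cosh_primitive lam 1 \<le> cosh_primitive mu (A + 1) - cosh_primitive mu 1"
      using assms \<open>A \<ge> 0\<close> by (intro cosh_primitive_mono_exponent) auto
    moreover have "cosh_primitive mu (A + 1) \<le> C"
      using cosh_primitive_le_cosh_integral[of mu "A + 1"] by (simp add: C)
    moreover have "cosh_primitive lam A \<le> cosh_primitive lam (A + 1)" by simp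
    ultimately show "cosh_primitive lam A \<le> C - d" unfolding d_def by linarith
  qed
  also have "\<dots> < ereal C" using d by simp
  finally show ?thesis by (simp add: C)
qed

lemma cosh_ge_quadratic: "cosh x \<ge> 1 + x\<^sup>2 / (2::real)"
proof -
  have nonneg: "cosh x \<ge> 1 + x\<^sup>2 / 2" if "x \<ge> 0" for x :: real
  proof -
    have s: "sinh t \<ge> t" if "t \<ge> 0" for t :: real
    proof -
      have "sinh 0 - 0 \<le> sinh t - t"
      proof (rule DERIV_nonneg_imp_nondecreasing[where f = "\<lambda>x. sinh x - x", OF that])
        fix x :: real
        show "\<exists>y. ((\<lambda>x. sinh x - x) has_real_derivative y) (at x) \<and> 0 \<le> y"
          using cosh_real_ge_1[of x] by (intro exI[of _ "cosh x - 1"]) (auto intro!: derivative_eq_intros)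
      qed
      then show ?thesis by simp
    qed
    have "(x / 2)\<^sup>2 \<le> (sinh (x / 2))\<^sup>2" using s[of "x / 2"] that by (intro power_mono) auto
    moreover have "cosh x = 1 + 2 * (sinh (x / 2))\<^sup>2"
      using cosh_double[of "x / 2"] by (simp add: cosh_square_eq)
    ultimately show ?thesis by (simp add: power_divide)
  qed
  show ?thesis using nonneg[of "\<bar>x\<bar>"] by simp
qed

text \<open>By Bernoulli's inequality \<open>cosh x ^ n\<close> is at least
  \<open>1 + n x^2 / 2\<close>, so the integral is dominated by one giving \<open>arctan\<close>.
  The bound tends to 0, which empties the intersection over all nonpositive exponents.\<close>

lemma cosh_integral_minus_nat_le:
  assumes "n \<ge> 1"
  shows "cosh_integral (- real n) \<le> ereal (sqrt (2 / n) * pi / 2)"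
proof (rule cosh_integral_le)
  fix A :: real assume A: "A \<ge> 0"
  define k where "k = sqrt (real n / 2)"
  have k: "k > 0" "k\<^sup>2 = n / 2" using assms by (simp_all add: k_def)
  define G where "G x = 1 / k * arctan (k * x) - cosh_primitive (- real n) x" for x
  have "G 0 \<le> G A"
  proof (rule DERIV_nonneg_imp_nondecreasing[OF A])
    fix x :: real
    have "1 + (k * x)\<^sup>2 = 1 + real n * (x\<^sup>2 / 2)" using k by (simp add: power_mult_distrib)
    also have "\<dots> \<le> (1 + x\<^sup>2 / 2) ^ n" by (intro Bernoulli_inequality) (smt (verit) zero_le_power2 divide_nonneg_pos)
    also have "\<dots> \<le> cosh x ^ n" by (intro power_mono cosh_ge_quadratic) (smt (verit) zero_le_power2 divide_nonneg_pos)
    finally have le: "1 + (k * x)\<^sup>2 \<le> cosh x ^ n" .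
    have "cosh x powr (- real n) = 1 / cosh x ^ n"
      using cosh_real_pos[of x] by (simp add: powr_minus powr_realpow divide_inverse)
    also have "\<dots> \<le> 1 / (1 + (k * x)\<^sup>2)"
      using le by (intro divide_left_mono) (auto intro!: mult_pos_pos add_pos_nonneg simp: cosh_real_pos)
    finally have "0 \<le> 1 / (1 + (k * x)\<^sup>2) - cosh x powr (- real n)" by simp
    moreover have "(G has_real_derivative 1 / (1 + (k * x)\<^sup>2) - cosh x powr (- real n)) (at x)"
    proof -
      have "((\<lambda>x. arctan (k * x)) has_real_derivative inverse (1 + (k * x)\<^sup>2) * k) (at x)"
        by (rule DERIV_chain2[OF DERIV_arctan]) (auto intro!: derivative_eq_intros)
      from DERIV_diff[OF DERIV_cmult[OF this, of "1 / k"] cosh_primitive_DERIV]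
      show ?thesis using k(1) by (simp add: G_def[abs_def] inverse_eq_divide)
    qed
    ultimately show "\<exists>y. (G has_real_derivative y) (at x) \<and> 0 \<le> y" by blast
  qed
  then have "cosh_primitive (- real n) A \<le> 1 / k * arctan (k * A)" by (simp add: G_def)
  also have "\<dots> \<le> 1 / k * (pi / 2)"
    using k arctan_ubound[of "k * A"] by (intro mult_left_mono) auto
  also have "1 / k = sqrt (2 / n)"
    using assms by (simp add: k_def real_sqrt_divide)
  finally show "cosh_primitive (- real n) A \<le> sqrt (2 / n) * pi / 2" by simp
qed


section \<open>Edge paths and walks on the sides\<close>

lemma sum_regroup_path:
  fixes f g :: "nat \<Rightarrow> 'a::comm_monoid_add"
  assumes "n \<ge> 1"
  shows "(\<Sum>k=1..n. f k + g k) = f 1 + g n + (\<Sum>k=1..<n. g k + f (k + 1))"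
  using assms
proof (induction n rule: nat_induct_at_least)
  case (Suc n)
  have "(\<Sum>k=1..<Suc n. g k + f (k + 1)) = (\<Sum>k=1..<n. g k + f (k + 1)) + (g n + f (n + 1))"
    using Suc.hyps by (simp add: sum.atLeastLessThan_Suc)
  then show ?case using Suc by (simp add: ac_simps)
qed simp

locale side_pairing =
  fixes ed :: "'h::finite \<times> nat \<Rightarrow> 'e::finite"
  assumes card_sides: "card {s \<in> sides. ed s = e} = 2"
begin

lemma finite_sides [simp]: "finite (sides :: ('h \<times> nat) set)"
  by (simp add: sides_def)

definition opp :: "'h \<times> nat \<Rightarrow> 'h \<times> nat" where
  "opp s = (THE s'. s' \<in> sides \<and> s' \<noteq> s \<and> ed s' = ed s)"

lemma sides_of_edge:
  assumes "s \<in> sides"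
  shows "opp s \<in> sides" "opp s \<noteq> s" "ed (opp s) = ed s" "{s' \<in> sides. ed s' = ed s} = {s, opp s}"
    and "\<And>s'. \<lbrakk>s' \<in> sides; s' \<noteq> s; ed s' = ed s\<rbrakk> \<Longrightarrow> s' = opp s"
proof -
  obtain x y where xy: "{s' \<in> sides. ed s' = ed s} = {x, y}" "x \<noteq> y"
    using card_sides[of "ed s"] by (auto simp: card_2_iff)
  then have "s = x \<or> s = y" using assms by blast
  then obtain t where t: "{s' \<in> sides. ed s' = ed s} = {s, t}" "t \<noteq> s"
    using xy by blast
  then have "opp s = t" unfolding opp_def by (intro the_equality) auto
  with t show "opp s \<in> sides" "opp s \<noteq> s" "ed (opp s) = ed s" "{s' \<in> sides. ed s' = ed s} = {s, opp s}"
    "\<And>s'. \<lbrakk>s' \<in> sides; s' \<noteq> s; ed s' = ed s\<rbrakk> \<Longrightarrow> s' = opp s"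
    by auto
qed

lemma side_exists: obtains s where "s \<in> sides" "ed s = e"
proof -
  have "{s \<in> sides. ed s = e} \<noteq> {}" using card_sides[of e] by (metis card.empty zero_neq_numeral)
  then show ?thesis using that by blast
qed

lemma sum_sides_of_edge:
  assumes "s \<in> sides" "s' \<in> sides" "s \<noteq> s'" "ed s = e" "ed s' = e"
  shows "(\<Sum>s\<in>{s \<in> sides. ed s = e}. f s) = f s + (f s' :: 'b::comm_monoid_add)"
  using sides_of_edge(4,5)[OF assms(1)] assms by auto

text \<open>Pairing by edges is exchanged for pairing by hexagons: each intermediate hexagon
  contributes its entry and its exit side, and the first exit and the last entry are left
  over.\<close>

lemma sum_edge_path:
  assumes "edge_path_via ed n H e a b"
  shows "(\<Sum>k=1..n. \<Sum>s\<in>{s \<in> sides. ed s = e k}. f s) = f (H 0, a 1) + f (H n, b n)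
    + (\<Sum>k=1..<n. f (H k, b k) + (f (H k, a (k + 1)) :: 'b::comm_monoid_add))"
proof -
  have "(\<Sum>k=1..n. \<Sum>s\<in>{s \<in> sides. ed s = e k}. f s) = (\<Sum>k=1..n. f (H (k - 1), a k) + f (H k, b k))"
    using assms by (intro sum.cong sum_sides_of_edge) (auto simp: edge_path_via_def sides_def)
  also have "\<dots> = f (H 0, a 1) + f (H n, b n) + (\<Sum>k=1..<n. f (H k, b k) + f (H k, a (k + 1)))"
    using assms sum_regroup_path[of n "\<lambda>k. f (H (k - 1), a k)" "\<lambda>k. f (H k, b k)"]
    by (simp add: edge_path_via_def)
  finally show ?thesis .
qed

text \<open>An edge path is given by the sides \<open>p k\<close> through which it leaves a hexagon and the sides \<open>q k\<close>
  through which it enters the next one.\<close>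

lemma edge_path_via_of_sides:
  assumes "n \<ge> 1"
    and p: "\<And>k. k \<in> {1..n} \<Longrightarrow> p k \<in> sides" and q: "\<And>k. k \<in> {1..n} \<Longrightarrow> q k = opp (p k)"
    and step: "\<And>k. k \<in> {1..<n} \<Longrightarrow> fst (p (k + 1)) = fst (q k) \<and> p (k + 1) \<noteq> q k"
  defines "H \<equiv> \<lambda>k. if k = 0 then fst (p 1) else fst (q k)"
  shows "edge_path_via ed n H (\<lambda>k. ed (q k)) (\<lambda>k. snd (p k)) (\<lambda>k. snd (q k))"
proof -
  have Hp: "(H (k - 1), snd (p k)) = p k" if "k \<in> {1..n}" for k
  proof (cases "k = 1")
    case False
    then have "k - 1 \<in> {1..<n}" "k - 1 + 1 = k" using that by auto
    then show ?thesis using step[of "k - 1"] by (auto simp: H_def prod_eq_iff)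
  qed (simp add: H_def)
  have Hq: "(H k, snd (q k)) = q k" if "k \<in> {1..n}" for k
    using that by (simp add: H_def)
  have qs: "q k \<in> sides \<and> q k \<noteq> p k \<and> ed (q k) = ed (p k)" if "k \<in> {1..n}" for k
    using sides_of_edge(1-3)[OF p[OF that]] unfolding q[OF that] by blast
  have "snd (p k) < 3 \<and> snd (q k) < 3 \<and> p k \<noteq> q k" if "k \<in> {1..n}" for k
    using p[OF that] qs[OF that] by (auto simp: sides_def)
  moreover have "snd (q k) \<noteq> snd (p (k + 1))" if "k \<in> {1..<n}" for k
    using step[OF that] by (auto simp: prod_eq_iff)
  ultimately show ?thesis
    using assms(1) Hp Hq qs by (simp add: edge_path_via_def)
qed

text \<open>Distinct entry sides can lie on the same edge only as often as the edge has
  sides.\<close>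

lemma at_most_twice_of_sides:
  assumes q: "\<And>k. k \<in> {1..n} \<Longrightarrow> q k \<in> sides" and inj: "inj_on q {1..n}"
  shows "at_most_twice n (\<lambda>k. ed (q k))"
  unfolding at_most_twice_def
proof
  fix x
  have "card {k \<in> {1..n}. ed (q k) = x} \<le> card {s \<in> sides. ed s = x}"
    using q inj by (intro card_inj_on_le[of q]) (auto intro: inj_on_subset)
  then show "card {k \<in> {1..n}. ed (q k) = x} \<le> 2" by (simp only: card_sides)
qed

text \<open>\<open>nx\<close> picks an exit side for each entry side, so iterating
  \<open>opp (nx s)\<close> is a deterministic walk. If some walk in \<open>B\<close> always has its
  exit side in \<open>B\<close>, finiteness forces a repetition and hence a cycle. Otherwise every
  walk stops at a side whose exit is outside \<open>B\<close>; crossing such a side backwards and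
  walking on gives a path that is terminal at both ends.\<close>

lemma walk_cases:
  fixes nx :: "'h \<times> nat \<Rightarrow> 'h \<times> nat"
  assumes nx: "\<And>s. s \<in> sides \<Longrightarrow> nx s \<in> sides \<and> fst (nx s) = fst s \<and> nx s \<noteq> s"
    and B: "B \<subseteq> sides" "B \<noteq> {}" "\<And>s. s \<in> B \<Longrightarrow> opp s \<in> B"
  obtains (cycle) n H e q where "fundamental_edge_cycle ed n H e"
      "\<And>k. k \<in> {1..n} \<Longrightarrow> q k \<in> B \<and> nx (q k) \<in> B"
      "\<And>f :: 'h \<times> nat \<Rightarrow> real. (\<Sum>k=1..n. \<Sum>s\<in>{s \<in> sides. ed s = e k}. f s) = (\<Sum>k=1..n. f (q k) + f (nx (q k)))"
    | (path) n H e q p where "fundamental_edge_path ed n H e"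
      "\<And>k. k \<in> {1..<n} \<Longrightarrow> q k \<in> B \<and> nx (q k) \<in> B"
      "p \<in> B" "nx p \<notin> B" "q n \<in> B" "nx (q n) \<notin> B"
      "\<And>f :: 'h \<times> nat \<Rightarrow> real. (\<Sum>k=1..n. \<Sum>s\<in>{s \<in> sides. ed s = e k}. f s)
         = f p + f (q n) + (\<Sum>k=1..<n. f (q k) + f (nx (q k)))"
proof -
  define g where "g s = opp (nx s)" for s
  have gB: "g s \<in> B" if "nx s \<in> B" for s using B(3)[OF that] by (simp add: g_def)
  have iter: "(g ^^ k) s \<in> B" if "s \<in> B" "\<And>j. j < k \<Longrightarrow> nx ((g ^^ j) s) \<in> B" for s k
    using that by (induction k) (auto intro: gB)
  show thesis
  proof (cases "\<exists>s\<in>B. \<forall>k. nx ((g ^^ k) s) \<in> B")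
    case True
    then obtain s where s: "s \<in> B" "\<And>k. nx ((g ^^ k) s) \<in> B" by blast
    define w where "w k = (g ^^ k) s" for k
    have wB: "w k \<in> B" "nx (w k) \<in> B" for k using iter[OF s(1)] s(2) by (auto simp: w_def)
    have wS: "w k = opp (nx (w (k - 1)))" if "k \<ge> 1" for k
      using that by (cases k) (simp_all add: w_def g_def)
    have "\<not> inj w"
    proof
      assume "inj w"
      then have "infinite (range w)" using range_inj_infinite by blast
      moreover have "finite B" using B(1) by (rule finite_subset) simp
      ultimately show False using wB finite_subset[of "range w" B] by blast
    qed
    then obtain i0 j0 where "i0 < j0" "w i0 = w j0"
      unfolding inj_def by (metis linorder_neqE_nat)
    \<comment> \<open>The first repetition, so that the sides from index \<open>i\<close> up to
      \<open>j - 1\<close> are distinct and the cycle enters each of its sides once.\<close>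
    define j where "j = (LEAST j. \<exists>i<j. w i = w j)"
    have "\<exists>i<j. w i = w j" unfolding j_def
      by (rule LeastI[of "\<lambda>j. \<exists>i<j. w i = w j" j0]) (use \<open>i0 < j0\<close> \<open>w i0 = w j0\<close> in blast)
    then obtain i where i: "i < j" "w i = w j" by blast
    have min: "w a \<noteq> w b" if "a < b" "b < j" for a b
      using not_less_Least[of b "\<lambda>j. \<exists>i<j. w i = w j"] that by (auto simp: j_def)
    define n where "n = j - i"
    define q where "q k = w (i + k)" for k
    define p where "p k = nx (q (k - 1))" for k
    have n: "n \<ge> 1" "q n = q 0" using i by (auto simp: n_def q_def)
    have qB: "q k \<in> B" "nx (q k) \<in> B" for k using wB by (auto simp: q_def)
    have ps: "p k \<in> sides" for k using qB B(1) by (auto simp: p_def)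
    have qp: "q k = opp (p k)" if "k \<ge> 1" for k
      using wS[of "i + k"] that by (simp add: q_def p_def)
    have nxq: "fst (nx (q k)) = fst (q k) \<and> nx (q k) \<noteq> q k" for k
      using nx[of "q k"] qB B(1) by blast
    have inj: "inj_on q {1..n}"
    proof (rule linorder_inj_onI)
      fix a b assume ab: "a < b" "a \<in> {1..n}" "b \<in> {1..n}"
      show "q a \<noteq> q b"
      proof (cases "b = n")
        case True
        then have "i < i + a" "i + a < j" using ab i(1) by (auto simp: n_def)
        then have "q 0 \<noteq> q a" using min[of i "i + a"] by (simp add: q_def)
        then show ?thesis using n(2) True by simp
      next
        case False
        then have "i + a < i + b" "i + b < j" using ab i(1) by (auto simp: n_def)
        then show ?thesis using min[of "i + a" "i + b"] by (simp add: q_def)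
      qed
    qed auto
    let ?H = "\<lambda>k. if k = 0 then fst (p 1) else fst (q k)" and ?e = "\<lambda>k. ed (q k)"
    have via: "edge_path_via ed n ?H ?e (\<lambda>k. snd (p k)) (\<lambda>k. snd (q k))"
    proof (rule edge_path_via_of_sides[OF n(1) ps])
      show "q k = opp (p k)" if "k \<in> {1..n}" for k using qp that by simp
      show "fst (p (k + 1)) = fst (q k) \<and> p (k + 1) \<noteq> q k" for k
        using nxq[of k] by (simp add: p_def)
    qed
    have p1: "fst (p 1) = fst (q n)" "p 1 \<noteq> q n" using nxq[of 0] n(2) by (auto simp: p_def)
    have "edge_cycle ed n ?H ?e"
      unfolding edge_cycle_def
    proof (intro exI conjI)
      show "?H n = ?H 0" using p1(1) n(1) by simp
      show "snd (q n) \<noteq> snd (p 1)" using p1 by (auto simp: prod_eq_iff)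
    qed (rule via)
    moreover have "at_most_twice n ?e"
      using qB B(1) inj by (intro at_most_twice_of_sides) auto
    ultimately have cyc: "fundamental_edge_cycle ed n ?H ?e" by (simp add: fundamental_edge_cycle_def)
    show thesis
    proof (rule cycle[OF cyc])
      show "q k \<in> B \<and> nx (q k) \<in> B" for k using qB by blast
      fix f :: "'h \<times> nat \<Rightarrow> real"
      have "(\<Sum>k=1..n. \<Sum>s\<in>{s \<in> sides. ed s = ed (q k)}. f s) = (\<Sum>k=1..n. f (p k) + f (q k))"
      proof (intro sum.cong refl sum_sides_of_edge)
        fix k assume k: "k \<in> {1..n}"
        have "p k \<in> sides" "q k = opp (p k)" using ps k qp by simp_all
        then show "p k \<noteq> q k" "p k \<in> sides" "q k \<in> sides" "ed (p k) = ed (q k)"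
          using sides_of_edge(1-3)[of "p k"] by metis+
      qed
      also have "\<dots> = f (p 1) + f (q n) + (\<Sum>k=1..<n. f (q k) + f (p (k + 1)))"
        by (rule sum_regroup_path[OF n(1)])
      also have "\<dots> = (f (q n) + f (nx (q n))) + (\<Sum>k=1..<n. f (q k) + f (nx (q k)))"
        using n(2) by (simp add: p_def)
      also have "\<dots> = (\<Sum>k=1..n. f (q k) + f (nx (q k)))"
        using n(1) by (simp add: sum.last_plus)
      finally show "(\<Sum>k=1..n. \<Sum>s\<in>{s \<in> sides. ed s = ed (q k)}. f s) = (\<Sum>k=1..n. f (q k) + f (nx (q k)))" .
    qed
  next
    case False
    have end_ex: "\<exists>k. (\<forall>j<k. nx ((g ^^ j) s) \<in> B) \<and> (g ^^ k) s \<in> B \<and> nx ((g ^^ k) s) \<notin> B"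
      if "s \<in> B" for s
    proof -
      have "\<not> (\<forall>k. nx ((g ^^ k) s) \<in> B)"
        using False that by (metis (mono_tags, lifting))
      then obtain k0 where k0: "nx ((g ^^ k0) s) \<notin> B" by (auto simp only: not_all)
      define k where "k = (LEAST k. nx ((g ^^ k) s) \<notin> B)"
      have k: "nx ((g ^^ k) s) \<notin> B" unfolding k_def using k0 by (rule LeastI)
      have least: "nx ((g ^^ j) s) \<in> B" if "j < k" for j
        using not_less_Least[of j "\<lambda>k. nx ((g ^^ k) s) \<notin> B"] that by (simp add: k_def)
      have "(g ^^ k) s \<in> B" by (rule iter[OF that least])
      then show ?thesis using k least by (intro exI[of _ k]) simp
    qed
    \<comment> \<open>A terminal side serves as the start: the walk leaves its hexagon through
      \<open>t\<close> itself, so the first hexagon of the path is terminal too.\<close>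
    obtain t where t: "t \<in> B" "nx t \<notin> B" using end_ex B(2) by (metis ex_in_conv)
    define s where "s = opp t"
    obtain m where m: "\<And>j. j < m \<Longrightarrow> nx ((g ^^ j) s) \<in> B" "(g ^^ m) s \<in> B" "nx ((g ^^ m) s) \<notin> B"
      using end_ex[of s] B(3)[OF t(1)] by (auto simp: s_def)
    \<comment> \<open>A walk of \<open>m\<close> moves begins after \<open>t\<close> has been
      crossed, so the path crosses \<open>m + 1\<close> edges and its first entry side is
      \<open>s = opp t\<close>.\<close>
    define n where "n = Suc m"
    define q where "q k = (g ^^ (k - 1)) s" for k
    define p where "p k = (if k = 1 then t else nx (q (k - 1)))" for k
    have qB: "q k \<in> B" if "k \<in> {1..n}" for k
      using iter[of s "k - 1"] m(1) that B(3)[OF t(1)] by (auto simp: q_def n_def s_def)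
    have nqB: "nx (q k) \<in> B" if "k \<in> {1..<n}" for k
      using m(1)[of "k - 1"] that by (auto simp: q_def n_def)
    have ps: "p k \<in> sides" if "k \<in> {1..n}" for k
    proof (cases "k = 1")
      case False
      then have "k - 1 \<in> {1..<n}" using that by auto
      then show ?thesis using nqB[of "k - 1"] False B(1) by (auto simp: p_def)
    qed (use t B(1) in \<open>auto simp: p_def\<close>)
    have qp: "q k = opp (p k)" if "k \<in> {1..n}" for k
    proof (cases "k = 1")
      case False
      then have "q k = g (q (k - 1))" using that
        by (cases k; cases "k - 1") (auto simp: q_def)
      then show ?thesis using False by (simp add: p_def g_def)
    qed (simp add: p_def q_def s_def)
    have nxq: "fst (nx (q k)) = fst (q k) \<and> nx (q k) \<noteq> q k" if "k \<in> {1..n}" for k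
      using nx[of "q k"] qB[OF that] B(1) by blast
    have inj: "inj_on q {1..n}"
    proof (rule linorder_inj_onI)
      fix a b assume ab: "a < b" "a \<in> {1..n}" "b \<in> {1..n}"
      show "q a \<noteq> q b"
      proof
        \<comment> \<open>Two equal sides would have the same future, so the walk would already have
          stopped before step \<open>m\<close>.\<close>
        assume "q a = q b"
        then have "(g ^^ (n - b)) (q a) = (g ^^ (n - b)) (q b)" by simp
        then have "(g ^^ (n - b + (a - 1))) s = (g ^^ (n - b + (b - 1))) s"
          by (simp add: q_def funpow_add)
        moreover have "n - b + (b - 1) = m" using ab by (auto simp: n_def)
        moreover have "n - b + (a - 1) < m" using ab by (auto simp: n_def)
        ultimately show False using m(1)[of "n - b + (a - 1)"] m(3) by metis
      qed
    qed auto
    let ?H = "\<lambda>k. if k = 0 then fst (p 1) else fst (q k)" and ?e = "\<lambda>k. ed (q k)"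
    have via: "edge_path_via ed n ?H ?e (\<lambda>k. snd (p k)) (\<lambda>k. snd (q k))"
    proof (rule edge_path_via_of_sides[OF _ ps])
      show "n \<ge> 1" by (simp add: n_def)
      show "q k = opp (p k)" if "k \<in> {1..n}" for k using qp that by simp
      show "fst (p (k + 1)) = fst (q k) \<and> p (k + 1) \<noteq> q k" if "k \<in> {1..<n}" for k
        using nxq[of k] that by (simp add: p_def)
    qed
    have "at_most_twice n ?e"
      using qB B(1) inj by (intro at_most_twice_of_sides) auto
    then have pth: "fundamental_edge_path ed n ?H ?e"
      using via by (auto simp: fundamental_edge_path_def edge_path_def)
    show thesis
    proof (rule path[OF pth])
      show "q k \<in> B \<and> nx (q k) \<in> B" if "k \<in> {1..<n}" for k using qB[of k] nqB[OF that] that by auto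
      show "t \<in> B" "nx t \<notin> B" by (rule t)+
      show "q n \<in> B" "nx (q n) \<notin> B" using m by (auto simp: q_def n_def)
      fix f :: "'h \<times> nat \<Rightarrow> real"
      have "(\<Sum>k=1..n. \<Sum>s\<in>{s \<in> sides. ed s = ed (q k)}. f s) = (\<Sum>k=1..n. f (p k) + f (q k))"
      proof (intro sum.cong refl sum_sides_of_edge)
        fix k assume k: "k \<in> {1..n}"
        have "p k \<in> sides" "q k = opp (p k)" using ps k qp by simp_all
        then show "p k \<noteq> q k" "p k \<in> sides" "q k \<in> sides" "ed (p k) = ed (q k)"
          using sides_of_edge(1-3)[of "p k"] by metis+
      qed
      also have "\<dots> = f (p 1) + f (q n) + (\<Sum>k=1..<n. f (q k) + f (p (k + 1)))"
        by (rule sum_regroup_path) (simp add: n_def)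
      also have "\<dots> = f t + f (q n) + (\<Sum>k=1..<n. f (q k) + f (nx (q k)))"
        by (simp add: p_def)
      finally show "(\<Sum>k=1..n. \<Sum>s\<in>{s \<in> sides. ed s = ed (q k)}. f s)
        = f t + f (q n) + (\<Sum>k=1..<n. f (q k) + f (nx (q k)))" .
    qed
  qed
qed

end


section \<open>The edge invariant and its derivative\<close>

definition nxt :: "'h \<times> nat \<Rightarrow> 'h \<times> nat" where
  "nxt s = (fst s, (snd s + 1) mod 3)"

lemma fst_nxt [simp]: "fst (nxt s) = fst s"
  by (simp add: nxt_def)

lemma nxt_sides [simp]: "nxt s \<in> sides"
  by (simp add: nxt_def sides_def)

lemma nxt_simps [simp]: "nxt (h, 0) = (h, 1)" "nxt (h, Suc 0) = (h, 2)" "nxt (h, 2) = (h, 0)"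
  "nxt (h, Suc (Suc 0)) = (h, 0)"
  by (simp_all add: nxt_def)

lemma sides_cases:
  assumes "s \<in> sides"
  obtains h where "s = (h, 0)" | h where "s = (h, 1)" | h where "s = (h, 2)"
proof -
  obtain h i where s: "s = (h, i)" "i < 3" using assms by (auto simp: sides_def)
  then consider "i = 0" | "i = 1" | "i = 2" by linarith
  then show ?thesis using s that by cases auto
qed

lemma nxt_nxt_nxt: "s \<in> sides \<Longrightarrow> nxt (nxt (nxt s)) = s"
  by (erule sides_cases) simp_all

lemma nxt_neq: "s \<in> sides \<Longrightarrow> nxt s \<noteq> s" "s \<in> sides \<Longrightarrow> nxt (nxt s) \<noteq> s"
  by (erule sides_cases; simp)+

lemma other_side_cases:
  assumes "s \<in> sides" "t \<in> sides" "fst s = fst t" "s \<noteq> t"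
  shows "t = nxt s \<or> t = nxt (nxt s)"
  using assms(3,4) by (cases rule: sides_cases[OF assms(1)]; cases rule: sides_cases[OF assms(2)]) simp_all

lemma sum_sides: "(\<Sum>s\<in>(sides :: ('h::finite \<times> nat) set). f s) = (\<Sum>h\<in>UNIV. f (h, 0) + (f (h, 1) + f (h, 2)))"
  for f :: "_ \<Rightarrow> 'b::comm_monoid_add"
proof -
  have "(\<Sum>s\<in>(sides :: ('h::finite \<times> nat) set). f s) = (\<Sum>h\<in>UNIV. \<Sum>i<3. f (h, i))"
    by (simp add: sides_def sum.cartesian_product)
  then show ?thesis by (simp add: eval_nat_numeral lessThan_Suc ac_simps)
qed

context side_pairing
begin

definition gap :: "real^'e \<Rightarrow> 'h \<times> nat \<Rightarrow> real" where
  "gap l s = half_gap (l $ ed s) (l $ ed (nxt s)) (l $ ed (nxt (nxt s)))"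

definition edge_invariant :: "real \<Rightarrow> real^'e \<Rightarrow> real^'e" where
  "edge_invariant lam l = (\<chi> e. \<Sum>s\<in>{s \<in> sides. ed s = e}. cosh_primitive lam (gap l s))"

lemma half_diff_eq_gap:
  assumes "l \<in> teichmueller" "s \<in> sides"
  shows "half_diff ed l s = gap l s"
proof -
  note arc = arc_opposite_eq[OF assms(1)]
  show ?thesis
    by (cases rule: sides_cases[OF assms(2)])
      (simp_all add: half_diff_def gap_def half_gap_def arc numeral_2_eq_2)
qed

lemma Psi_eq_edge_invariant: "l \<in> teichmueller \<Longrightarrow> Psi ed lam l = edge_invariant lam l"
  unfolding Psi_def edge_invariant_def cosh_primitive_def vec_eq_iff vec_lambda_beta
  by (intro allI sum.cong refl) (simp add: half_diff_eq_gap)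

lemma Psi_image: "Psi ed lam ` teichmueller = edge_invariant lam ` teichmueller"
  by (intro image_cong refl Psi_eq_edge_invariant)

lemma edge_invariant_nth:
  assumes "s \<in> sides" "ed s = e"
  shows "edge_invariant lam l $ e = cosh_primitive lam (gap l s) + cosh_primitive lam (gap l (opp s))"
  unfolding edge_invariant_def vec_lambda_beta
  using sides_of_edge(1-3)[OF assms(1)] assms by (intro sum_sides_of_edge) auto

lemma gap_add:
  assumes "s \<in> sides"
  shows "gap l s + gap l (nxt s) = facing_arc (l $ ed (nxt (nxt s))) (l $ ed s) (l $ ed (nxt s))"
  unfolding gap_def nxt_nxt_nxt[OF assms] by (rule half_gap_add)

lemma gap_add':
  assumes "s \<in> sides"
  shows "gap l s + gap l (nxt (nxt s)) = facing_arc (l $ ed (nxt s)) (l $ ed s) (l $ ed (nxt (nxt s)))"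
  using gap_add[of "nxt (nxt s)" l] nxt_nxt_nxt[OF assms]
  by (simp add: add.commute facing_arc_commute)

lemma gap_add_pos:
  assumes "l \<in> teichmueller" "s \<in> sides" "t \<in> sides" "fst s = fst t" "s \<noteq> t"
  shows "gap l s + gap l t > 0"
  using other_side_cases[OF assms(2-5)] gap_add[OF assms(2), of l] gap_add'[OF assms(2), of l]
    assms(1) by (auto simp: teichmueller_def facing_arc_pos)

section \<open>The image lies in the polytope\<close>

definition edge_polytope :: "real \<Rightarrow> (real^'e) set" where
  "edge_polytope lam = {z.
     (\<forall>e. ereal (z $ e) < 2 * cosh_integral lam) \<and>
     (\<forall>n H e. fundamental_edge_path ed n H e \<longrightarrow>
        ereal (\<Sum>i=1..n. z $ e i) > - (2 * cosh_integral lam)) \<and>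
     (\<forall>n H e. fundamental_edge_cycle ed n H e \<longrightarrow> (\<Sum>i=1..n. z $ e i) > 0)}"

lemma two_cosh_integral_gt:
  "ereal (cosh_primitive lam a + cosh_primitive lam b) < 2 * cosh_integral lam"
proof (cases "cosh_integral lam")
  case (real r)
  then show ?thesis
    using cosh_primitive_less_cosh_integral[of lam a] cosh_primitive_less_cosh_integral[of lam b] by simp
next
  case PInf
  then show ?thesis by simp
next
  case MInf
  then show ?thesis using cosh_integral_pos[of lam] by simp
qed

text \<open>After regrouping, only the two unpaired ends of a path matter. Each exceeds minus the
  integral by oddness; in a cycle they are two different sides of one hexagon and form another
  positive pair.\<close>

lemma edge_invariant_in_edge_polytope:
  assumes "l \<in> teichmueller"
  shows "edge_invariant lam l \<in> edge_polytope lam"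
proof -
  define f where "f s = cosh_primitive lam (gap l s)" for s
  have nth: "edge_invariant lam l $ e = (\<Sum>s\<in>{s \<in> sides. ed s = e}. f s)" for e
    by (simp add: edge_invariant_def f_def)
  have f_pos: "f s + f t > 0" if "s \<in> sides" "t \<in> sides" "fst s = fst t" "s \<noteq> t" for s t
    unfolding f_def using gap_add_pos[OF assms that] by (rule cosh_primitive_add_pos)
  have path_sum: "(\<Sum>k=1..n. edge_invariant lam l $ e k) \<ge> f (H 0, a 1) + f (H n, b n)"
    if "edge_path_via ed n H e a b" for n H e a b
  proof -
    have "f (H k, b k) + f (H k, a (k + 1)) \<ge> 0" if k: "k \<in> {1..<n}" for k
      by (intro less_imp_le f_pos)
        (use \<open>edge_path_via ed n H e a b\<close> k in \<open>auto simp: edge_path_via_def sides_def\<close>)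
    then have "(\<Sum>k=1..<n. f (H k, b k) + f (H k, a (k + 1))) \<ge> 0" by (rule sum_nonneg)
    then show ?thesis unfolding nth sum_edge_path[OF that] by simp
  qed
  have "ereal (edge_invariant lam l $ e) < 2 * cosh_integral lam" for e
  proof -
    obtain s where s: "s \<in> sides" "ed s = e" by (rule side_exists)
    show ?thesis unfolding edge_invariant_nth[OF s] by (rule two_cosh_integral_gt)
  qed
  moreover have "ereal (\<Sum>i=1..n. edge_invariant lam l $ e i) > - (2 * cosh_integral lam)"
    if path: "fundamental_edge_path ed n H e" for n H e
  proof -
    obtain a b where via: "edge_path_via ed n H e a b"
      using path by (auto simp: fundamental_edge_path_def edge_path_def)
    have "- (\<Sum>i=1..n. edge_invariant lam l $ e i) \<le>
        cosh_primitive lam (- gap l (H 0, a 1)) + cosh_primitive lam (- gap l (H n, b n))"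
      using path_sum[OF via] by (simp add: f_def)
    then have "ereal (- (\<Sum>i=1..n. edge_invariant lam l $ e i)) < 2 * cosh_integral lam"
      using two_cosh_integral_gt le_less_trans ereal_less_eq(3) by blast
    then show ?thesis by (simp add: ereal_uminus_less_reorder flip: uminus_ereal.simps)
  qed
  moreover have "(\<Sum>i=1..n. edge_invariant lam l $ e i) > 0"
    if cycle: "fundamental_edge_cycle ed n H e" for n H e
  proof -
    obtain a b where via: "edge_path_via ed n H e a b" and cl: "H n = H 0" "b n \<noteq> a 1"
      using cycle by (auto simp: fundamental_edge_cycle_def edge_cycle_def)
    have "f (H 0, a 1) + f (H n, b n) > 0"
      by (rule f_pos) (use via cl in \<open>auto simp: edge_path_via_def sides_def\<close>)
    then show ?thesis using path_sum[OF via] by simp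
  qed
  ultimately show ?thesis by (simp add: edge_polytope_def)
qed

section \<open>Openness of the image\<close>

lemma open_teichmueller: "open (teichmueller :: (real^'e) set)"
proof -
  have eq: "teichmueller = (\<Inter>e. {l :: real^'e. 0 < l $ e})" by (auto simp: teichmueller_def)
  show ?thesis
    by (subst eq) (intro open_INT finite ballI open_Collect_less continuous_intros)
qed

definition dgap_side :: "real^'e \<Rightarrow> 'h \<times> nat \<Rightarrow> real^'e \<Rightarrow> real" where
  "dgap_side l s v = dgap (l $ ed s) (l $ ed (nxt s)) (l $ ed (nxt (nxt s)))
     (v $ ed s) (v $ ed (nxt s)) (v $ ed (nxt (nxt s)))"

lemma gap_has_derivative:
  assumes "l \<in> teichmueller"
  shows "((\<lambda>l. gap l s) has_derivative dgap_side l s) (at l)"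
  unfolding gap_def dgap_side_def[abs_def]
  by (rule half_gap_has_derivative bounded_linear_imp_has_derivative[OF bounded_linear_vec_nth])+
    (use assms in \<open>simp_all add: teichmueller_def\<close>)

definition dinvariant :: "real \<Rightarrow> real^'e \<Rightarrow> real^'e \<Rightarrow> real^'e" where
  "dinvariant lam l v = (\<chi> e. \<Sum>s\<in>{s \<in> sides. ed s = e}. dgap_side l s v * cosh (gap l s) powr lam)"

lemma edge_invariant_has_derivative:
  assumes "l \<in> teichmueller"
  shows "(edge_invariant lam has_derivative dinvariant lam l) (at l)"
proof -
  have "((\<lambda>l. \<Sum>s\<in>{s \<in> sides. ed s = e}. cosh_primitive lam (gap l s)) has_derivative
     (\<lambda>v. \<Sum>s\<in>{s \<in> sides. ed s = e}. dgap_side l s v * cosh (gap l s) powr lam)) (at l)" for e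
    by (intro has_derivative_sum DERIV_compose_FDERIV[OF cosh_primitive_DERIV] gap_has_derivative assms)
  then have "((\<lambda>l. edge_invariant lam l $ e) has_derivative (\<lambda>v. dinvariant lam l v $ e)) (at l)" for e
    by (simp add: edge_invariant_def dinvariant_def)
  then have "((\<lambda>l. \<Sum>e\<in>UNIV. edge_invariant lam l $ e *\<^sub>R (axis e 1 :: real^'e)) has_derivative
    (\<lambda>v. \<Sum>e\<in>UNIV. dinvariant lam l v $ e *\<^sub>R (axis e 1 :: real^'e))) (at l)"
    by (intro has_derivative_sum has_derivative_scaleR_left)
  moreover have basis: "(\<Sum>e\<in>UNIV. z $ e *\<^sub>R axis e 1) = z" for z :: "real^'e"
    using basis_expansion[of z] by (simp add: scalar_mult_eq_scaleR)
  ultimately show ?thesis unfolding basis by simp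
qed

lemma sum_edges_sides:
  fixes f :: "'h \<times> nat \<Rightarrow> real"
  shows "(\<Sum>e\<in>UNIV. \<Sum>s\<in>{s \<in> sides. ed s = e}. f s) = (\<Sum>s\<in>sides. f s)"
  by (rule sum.group) auto

lemma tangent_law_side:
  assumes "l \<in> teichmueller" "s \<in> sides"
  shows "tanh (l $ ed (nxt s) / 2) * cosh (gap l (nxt s)) = tanh (l $ ed s / 2) * cosh (gap l s)"
  unfolding gap_def nxt_nxt_nxt[OF assms(2)]
  using assms(1) by (intro tangent_law[symmetric]) (auto simp: teichmueller_def)

text \<open>By the tangent law the weights turn the derivative into a sum over the hexagons of the negative
  definite forms of the half gaps, each one scaled by a positive factor.\<close>

lemma dinvariant_inj:
  assumes l: "l \<in> teichmueller" and v: "dinvariant lam l v = 0"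
  shows "v = 0"
proof (rule ccontr)
  assume "v \<noteq> 0"
  then obtain e where e: "v $ e \<noteq> 0" by (auto simp: vec_eq_iff)
  obtain s where s: "s \<in> sides" "ed s = e" by (rule side_exists)
  define T where "T s = tanh (l $ ed s / 2)" for s
  define M where "M s = T s * cosh (gap l s)" for s
  have T: "T s > 0" for s using l by (simp add: T_def teichmueller_def)
  have M: "M s > 0" for s using T by (simp add: M_def)
  \<comment> \<open>Summed by edges, \<open>\<phi>\<close> pairs the derivative with a weighted
    \<open>v\<close> and gives 0; summed by hexagons, it gives multiples of the forms. The exponent
    \<open>lam + 1\<close> reconciles both: \<open>T powr (lam + 1) * cosh r powr lam\<close> is
    \<open>T * M powr lam\<close>, where the first weight depends on the edge only and
    \<open>M\<close> on the hexagon only.\<close>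
  define \<phi> where "\<phi> s = T s powr (lam + 1) * v $ ed s * (dgap_side l s v * cosh (gap l s) powr lam)" for s
  have \<phi>: "\<phi> s = M s powr lam * (T s * v $ ed s * dgap_side l s v)" for s
    using T[of s] by (simp add: \<phi>_def M_def powr_add powr_mult)
  have Mn: "M (nxt s) = M s" if "s \<in> sides" for s
    unfolding M_def T_def using tangent_law_side[OF l that] by simp
  have form: "\<phi> (h, 0) + (\<phi> (h, 1) + \<phi> (h, 2)) = M (h, 0) powr lam *
     (T (h, 0) * v $ ed (h, 0) * dgap_side l (h, 0) v + T (h, 1) * v $ ed (h, 1) * dgap_side l (h, 1) v
      + T (h, 2) * v $ ed (h, 2) * dgap_side l (h, 2) v)" for h
  proof -
    have "nxt (h, 0) = (h, 1)" "nxt (h, 1) = (h, 2)" by (simp_all add: nxt_def)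
    then have "M (h, 1) = M (h, 0)" "M (h, 2) = M (h, 0)"
      using Mn[of "(h, 0)"] Mn[of "(h, 1)"] by (simp_all add: sides_def)
    then show ?thesis unfolding \<phi> by (simp add: algebra_simps)
  qed
  have dg: "dgap_side l (h, 0) v = dgap (l $ ed (h, 0)) (l $ ed (h, 1)) (l $ ed (h, 2)) (v $ ed (h, 0)) (v $ ed (h, 1)) (v $ ed (h, 2))"
    "dgap_side l (h, 1) v = dgap (l $ ed (h, 1)) (l $ ed (h, 2)) (l $ ed (h, 0)) (v $ ed (h, 1)) (v $ ed (h, 2)) (v $ ed (h, 0))"
    "dgap_side l (h, 2) v = dgap (l $ ed (h, 2)) (l $ ed (h, 0)) (l $ ed (h, 1)) (v $ ed (h, 2)) (v $ ed (h, 0)) (v $ ed (h, 1))"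
    for h
    by (simp_all add: dgap_side_def nxt_def numeral_2_eq_2)
  have lpos: "l $ e > 0" for e using l by (simp add: teichmueller_def)
  have neg: "\<phi> (h, 0) + (\<phi> (h, 1) + \<phi> (h, 2)) < 0"
    if "v $ ed (h, 0) \<noteq> 0 \<or> v $ ed (h, 1) \<noteq> 0 \<or> v $ ed (h, 2) \<noteq> 0" for h
    unfolding form dg T_def using M[of "(h, 0)"]
    by (intro mult_pos_neg dgap_form_neg lpos that) simp
  have nonpos: "\<phi> (h, 0) + (\<phi> (h, 1) + \<phi> (h, 2)) \<le> 0" for h
  proof (cases "v $ ed (h, 0) \<noteq> 0 \<or> v $ ed (h, 1) \<noteq> 0 \<or> v $ ed (h, 2) \<noteq> 0")
    case True
    from neg[OF this] show ?thesis by simp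
  next
    case False
    then show ?thesis by (simp add: \<phi>_def)
  qed
  have "snd s = 0 \<or> snd s = 1 \<or> snd s = 2" using s(1) by (auto simp: sides_def)
  then have "s = (fst s, 0) \<or> s = (fst s, 1) \<or> s = (fst s, 2)" by (auto simp: prod_eq_iff)
  then have "v $ ed (fst s, 0) \<noteq> 0 \<or> v $ ed (fst s, 1) \<noteq> 0 \<or> v $ ed (fst s, 2) \<noteq> 0"
    using e s(2) by metis
  then have "(\<Sum>h\<in>UNIV. \<phi> (h, 0) + (\<phi> (h, 1) + \<phi> (h, 2))) < (\<Sum>h\<in>(UNIV :: 'h set). 0)"
    using neg[of "fst s"] nonpos
    by (intro sum_strict_mono_ex1) auto
  moreover have "(\<Sum>e\<in>UNIV. tanh (l $ e / 2) powr (lam + 1) * v $ e * dinvariant lam l v $ e) = (\<Sum>s\<in>sides. \<phi> s)"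
    unfolding sum_edges_sides[symmetric] dinvariant_def vec_lambda_beta sum_distrib_left
    by (intro sum.cong refl) (auto simp: \<phi>_def T_def)
  ultimately show False unfolding v sum_sides by simp
qed

text \<open>An injective linear endomorphism in finite dimension has an inverse, so each point of
  the image is interior by the open mapping theorem for a map differentiable at a single
  point.\<close>

lemma open_edge_invariant_image: "open (edge_invariant lam ` teichmueller)"
proof -
  have "edge_invariant lam l \<in> interior (edge_invariant lam ` teichmueller)" if l: "l \<in> teichmueller" for l
  proof -
    have lin: "linear (dinvariant lam l)"
      using edge_invariant_has_derivative[OF l] has_derivative_linear by blast
    then have "inj (dinvariant lam l)"
      unfolding linear_injective_0[OF lin] using dinvariant_inj[OF l] by blast
    then obtain g where g: "linear g" "\<And>x. dinvariant lam l (g x) = x"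
      using linear_injective_isomorphism[OF lin] by blast
    show ?thesis
    proof (rule sussmann_open_mapping[OF open_teichmueller _ l edge_invariant_has_derivative[OF l]])
      show "continuous_on teichmueller (edge_invariant lam)"
        using edge_invariant_has_derivative has_derivative_continuous
        by (intro continuous_at_imp_continuous_on) blast
      show "bounded_linear g" using g(1) by (simp add: linear_conv_bounded_linear)
      show "dinvariant lam l \<circ> g = id" using g(2) by (simp add: fun_eq_iff)
      show "l \<in> interior teichmueller" using l open_teichmueller by (simp add: interior_open)
    qed simp
  qed
  then have "edge_invariant lam ` teichmueller \<subseteq> interior (edge_invariant lam ` teichmueller)" by blast
  then show ?thesis using interior_subset open_interior by (metis subset_antisym)
qed

section \<open>The coordinate sum, and the polytope as a finite intersection of half-spaces\<close>

text \<open>In each hexagon the three positive pair sums add up to twice the contribution of the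
  hexagon. This excludes image points with all coordinates nonpositive.\<close>

lemma sum_edge_invariant_pos:
  assumes "l \<in> teichmueller"
  shows "(\<Sum>e\<in>UNIV. edge_invariant lam l $ e) > 0"
proof -
  define f where "f s = cosh_primitive lam (gap l s)" for s
  have f_pos: "f s + f t > 0" if "s \<in> sides" "t \<in> sides" "fst s = fst t" "s \<noteq> t" for s t
    unfolding f_def using gap_add_pos[OF assms that] by (rule cosh_primitive_add_pos)
  have "f (h, 0) + (f (h, 1) + f (h, 2)) > 0" for h
    using f_pos[of "(h, 0)" "(h, 1)"] f_pos[of "(h, 1)" "(h, 2)"] f_pos[of "(h, 2)" "(h, 0)"]
    by (simp add: sides_def)
  then have "(\<Sum>h\<in>(UNIV :: 'h set). f (h, 0) + (f (h, 1) + f (h, 2))) > 0" by (intro sum_pos) auto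
  then show ?thesis
    unfolding sum_sides[symmetric] sum_edges_sides[symmetric] by (simp add: edge_invariant_def f_def)
qed

text \<open>Paths are encoded by functions on all naturals, but the inequality depends only on how
  often each edge is crossed. For fundamental paths these multiplicities are at most 2, which leaves
  finitely many normal vectors, and they are nonzero because a path crosses at least one
  edge.\<close>

lemma open_convex_polytope_edge_polytope: "open_convex_polytope (edge_polytope lam)"
proof -
  define c :: "nat \<Rightarrow> (nat \<Rightarrow> 'e) \<Rightarrow> 'e \<Rightarrow> nat" where "c n e x = card {k \<in> {1..n}. e k = x}" for n e x
  define vec :: "('e \<Rightarrow> nat) \<Rightarrow> real^'e" where "vec d = (\<chi> x. real (d x))" for d
  have sum_c: "(\<Sum>i=1..n. z $ e i) = vec (c n e) \<bullet> z" for n e z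
  proof -
    have "(\<Sum>i=1..n. z $ e i) = (\<Sum>x\<in>UNIV. \<Sum>i\<in>{i \<in> {1..n}. e i = x}. z $ e i)"
      by (rule sum.group[symmetric]) auto
    also have "\<dots> = (\<Sum>x\<in>UNIV. real (c n e x) * z $ x)"
      by (intro sum.cong refl) (simp add: c_def)
    finally show ?thesis by (simp add: inner_vec_def vec_def)
  qed
  have c_nz: "vec (c n e) \<noteq> 0" if "edge_path ed n H e" for n H e
  proof -
    have "n \<ge> 1" using that by (auto simp: edge_path_def edge_path_via_def)
    then have "1 \<in> {k \<in> {1..n}. e k = e 1}" by simp
    then have "c n e (e 1) \<noteq> 0" unfolding c_def by (subst card_eq_0_iff) auto
    then show ?thesis by (auto simp: vec_def vec_eq_iff)
  qed
  define D where "D = {d :: 'e \<Rightarrow> nat. \<forall>x. d x \<le> 2}"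
  have finD: "finite D"
  proof -
    have "D = PiE UNIV (\<lambda>_. {..2})" by (auto simp: D_def PiE_def)
    then show ?thesis by (simp add: finite_PiE)
  qed
  have cD: "c n e \<in> D" if "at_most_twice n e" for n e
    using that by (simp add: D_def c_def at_most_twice_def)
  define A where "A = {d. \<exists>n H e. fundamental_edge_path ed n H e \<and> d = c n e}"
  define B where "B = {d. \<exists>n H e. fundamental_edge_cycle ed n H e \<and> d = c n e}"
  have "A \<subseteq> D" "B \<subseteq> D"
    using cD by (auto simp: A_def B_def fundamental_edge_path_def fundamental_edge_cycle_def)
  then have fin: "finite A" "finite B" using finD finite_subset by blast+
  have nzA: "vec d \<noteq> 0" if "d \<in> A" for d
    using that c_nz by (auto simp: A_def fundamental_edge_path_def)
  have nzB: "vec d \<noteq> 0" if "d \<in> B" for d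
  proof -
    obtain n H e where "fundamental_edge_cycle ed n H e" "d = c n e" using \<open>d \<in> B\<close> by (auto simp: B_def)
    then have "edge_path ed n H e" unfolding fundamental_edge_cycle_def edge_cycle_def edge_path_def by blast
    then show ?thesis using c_nz \<open>d = c n e\<close> by simp
  qed
  define FB where "FB = (\<lambda>d. {z. - vec d \<bullet> z < 0}) ` B"
  have FB: "finite FB" "\<And>h. h \<in> FB \<Longrightarrow> \<exists>a b. a \<noteq> 0 \<and> h = {x. a \<bullet> x < b}"
  proof -
    fix h assume "h \<in> FB"
    then obtain d where d: "d \<in> B" "h = {z. - vec d \<bullet> z < 0}" by (auto simp: FB_def)
    then show "\<exists>a b. a \<noteq> 0 \<and> h = {x. a \<bullet> x < b}"
      using nzB[OF d(1)] by (intro exI[of _ "- vec d"] exI[of _ 0]) simp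
  qed (use fin in \<open>simp add: FB_def\<close>)
  have IB: "z \<in> \<Inter>FB \<longleftrightarrow> (\<forall>n H e. fundamental_edge_cycle ed n H e \<longrightarrow> (\<Sum>i=1..n. z $ e i) > 0)" for z
    unfolding sum_c by (auto simp: FB_def B_def)
  show ?thesis
  proof (cases "cosh_integral lam")
    case PInf
    have "edge_polytope lam = \<Inter>FB"
      using IB by (auto simp: edge_polytope_def PInf)
    then show ?thesis
      unfolding open_convex_polytope_def by (intro exI[of _ FB] conjI ballI FB)
  next
    case MInf
    then show ?thesis using cosh_integral_pos[of lam] by simp
  next
    case (real r)
    define FA where "FA = (\<lambda>d. {z. - vec d \<bullet> z < 2 * r}) ` A"
    define FE where "FE = (\<lambda>e. {z :: real^'e. axis e 1 \<bullet> z < 2 * r}) ` UNIV"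
    have FA: "finite FA" "\<And>h. h \<in> FA \<Longrightarrow> \<exists>a b. a \<noteq> 0 \<and> h = {x. a \<bullet> x < b}"
    proof -
      fix h assume "h \<in> FA"
      then obtain d where d: "d \<in> A" "h = {z. - vec d \<bullet> z < 2 * r}" by (auto simp: FA_def)
      then show "\<exists>a b. a \<noteq> 0 \<and> h = {x. a \<bullet> x < b}"
        using nzA[OF d(1)] by (intro exI[of _ "- vec d"] exI[of _ "2 * r"]) simp
    qed (use fin in \<open>simp add: FA_def\<close>)
    have FE: "finite FE" "\<And>h. h \<in> FE \<Longrightarrow> \<exists>a b. a \<noteq> 0 \<and> h = {x. a \<bullet> x < b}"
    proof -
      fix h assume "h \<in> FE"
      then obtain e where e: "h = {z. axis e 1 \<bullet> z < 2 * r}" by (auto simp: FE_def)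
      then show "\<exists>a b. a \<noteq> 0 \<and> h = {x. a \<bullet> x < b}"
        by (intro exI[of _ "axis e 1"] exI[of _ "2 * r"]) (simp add: axis_eq_0_iff)
    qed (simp add: FE_def)
    have IA: "z \<in> \<Inter>FA \<longleftrightarrow> (\<forall>n H e. fundamental_edge_path ed n H e \<longrightarrow> (\<Sum>i=1..n. z $ e i) > - (2 * r))" for z
    proof -
      have flip: "- (vec d \<bullet> z) < 2 * r \<longleftrightarrow> - (2 * r) < vec d \<bullet> z" for d by linarith
      have "z \<in> \<Inter>FA \<longleftrightarrow> (\<forall>d\<in>A. - (2 * r) < vec d \<bullet> z)" by (simp add: FA_def flip)
      then show ?thesis unfolding sum_c A_def by blast
    qed
    have IE: "z \<in> \<Inter>FE \<longleftrightarrow> (\<forall>e. z $ e < 2 * r)" for z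
      by (auto simp: FE_def inner_axis')
    have "edge_polytope lam = {z. z \<in> \<Inter>FE \<and> z \<in> \<Inter>FA \<and> z \<in> \<Inter>FB}"
      unfolding IA IE IB edge_polytope_def real by simp
    also have "\<dots> = \<Inter>(FE \<union> FA \<union> FB)" by blast
    finally have "edge_polytope lam = \<Inter>(FE \<union> FA \<union> FB)" .
    moreover have "finite (FE \<union> FA \<union> FB)" using FE(1) FA(1) FB(1) by simp
    moreover have "\<forall>h\<in>FE \<union> FA \<union> FB. \<exists>a b. a \<noteq> 0 \<and> h = {x. a \<bullet> x < b}"
      using FE(2) FA(2) FB(2) by (meson UnE)
    ultimately show ?thesis
      unfolding open_convex_polytope_def by (intro exI[of _ "FE \<union> FA \<union> FB"] conjI)
  qed
qed

end


section \<open>Degenerating hexagons\<close>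

text \<open>By the tangent law the shorter red edge has the half gap of larger absolute value, and
  since the two half gaps have a positive sum, the one of larger absolute value is the larger
  one.\<close>

lemma half_gap_antimono:
  assumes "x > 0" "y > 0" "z > 0" "x \<le> y"
  shows "half_gap y z x \<le> half_gap x y z"
proof -
  let ?r = "half_gap x y z" and ?r' = "half_gap y z x"
  have "tanh (x / 2) \<le> tanh (y / 2)" using assms by simp
  then have "tanh (x / 2) * cosh ?r' \<le> tanh (y / 2) * cosh ?r'"
    using cosh_real_pos[of ?r'] by (intro mult_right_mono) auto
  also have "\<dots> = tanh (x / 2) * cosh ?r" using tangent_law[OF assms(1-3)] by simp
  finally have "cosh ?r' \<le> cosh ?r" using assms(1) by simp
  then have "\<not> \<bar>?r\<bar> < \<bar>?r'\<bar>" using cosh_real_strict_mono[of "\<bar>?r\<bar>" "\<bar>?r'\<bar>"] by auto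
  then have "\<bar>?r'\<bar> \<le> \<bar>?r\<bar>" by simp
  moreover have "?r + ?r' > 0"
    unfolding half_gap_add using facing_arc_pos assms by simp
  ultimately show ?thesis by linarith
qed

text \<open>A short red edge forces the adjacent black edges to be long.\<close>

lemma cosh_facing_arc_ge:
  assumes "x > 0" "y > 0" "z > 0"
  shows "cosh (facing_arc x y z) \<ge> 1 / sinh y"
proof -
  have s: "sinh y > 0" "sinh z > 0" using assms by simp_all
  have c: "cosh z \<ge> sinh z" "cosh y \<ge> 1" "cosh x > 0"
    using cosh_real_ge_1[of y] cosh_real_pos[of x] by (simp_all add: sinh_le_cosh_real)
  have "1 * sinh z \<le> cosh y * cosh z" using c s by (intro mult_mono) auto
  then have "sinh z \<le> cosh x + cosh y * cosh z" using c(3) by linarith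
  then have "sinh z / (sinh y * sinh z) \<le> (cosh x + cosh y * cosh z) / (sinh y * sinh z)"
    using s by (intro divide_right_mono) auto
  then show ?thesis using s unfolding cosh_facing_arc[OF assms] by simp
qed

text \<open>The bound is chosen so that it tends to 1 when \<open>y\<close> and \<open>z\<close>
  tend to infinity.\<close>

lemma cosh_facing_arc_le:
  assumes "x > 0" "y > 0" "z > 0" "x \<le> z"
  shows "cosh (facing_arc x y z) \<le> 1 / tanh z * (1 / sinh y + 1 / tanh y)"
proof -
  have s: "sinh y > 0" "sinh z > 0" using assms by simp_all
  have "cosh x \<le> cosh z" using assms cosh_real_strict_mono[of x z] by (cases "x = z") auto
  then have "(cosh x + cosh y * cosh z) / (sinh y * sinh z) \<le> (cosh z + cosh y * cosh z) / (sinh y * sinh z)"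
    using s by (intro divide_right_mono) auto
  also have "\<dots> = 1 / tanh z * (1 / sinh y + 1 / tanh y)"
    using s by (simp add: tanh_def field_simps)
  finally show ?thesis unfolding cosh_facing_arc[OF assms(1-3)] .
qed

lemma cosh_facing_arc_le_fixed:
  assumes "c > 0" "x \<ge> c" "y \<ge> c" "z \<ge> c"
  shows "cosh (facing_arc x y z) \<le> cosh x / (sinh c)\<^sup>2 + (1 / tanh c)\<^sup>2"
proof -
  have p: "x > 0" "y > 0" "z > 0" using assms by simp_all
  have s: "sinh c > 0" "sinh y \<ge> sinh c" "sinh z \<ge> sinh c" "tanh c > 0" "tanh y \<ge> tanh c" "tanh z \<ge> tanh c"
    using assms by simp_all
  have "cosh x / (sinh y * sinh z) \<le> cosh x / (sinh c)\<^sup>2"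
    using s cosh_real_pos[of x] p unfolding power2_eq_square
    by (intro divide_left_mono mult_mono mult_pos_pos) auto
  moreover have "1 / tanh y * (1 / tanh z) \<le> 1 / tanh c * (1 / tanh c)"
    using s p by (intro mult_mono divide_left_mono mult_pos_pos) auto
  moreover have "(cosh x + cosh y * cosh z) / (sinh y * sinh z) = cosh x / (sinh y * sinh z) + 1 / tanh y * (1 / tanh z)"
    using s p by (simp add: tanh_def add_divide_distrib)
  ultimately show ?thesis unfolding cosh_facing_arc[OF p] by (simp add: power2_eq_square)
qed

lemma tendsto_0_of_cosh_tendsto_1:
  fixes f :: "'a \<Rightarrow> real"
  assumes "((\<lambda>n. cosh (f n)) \<longlongrightarrow> 1) F"
  shows "(f \<longlongrightarrow> 0) F"
proof -
  have le: "\<bar>f n\<bar> \<le> sqrt (2 * (cosh (f n) - 1))" for n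
    using cosh_ge_quadratic[of "f n"] by (intro real_le_rsqrt) simp
  have "((\<lambda>n. sqrt (2 * (cosh (f n) - 1))) \<longlongrightarrow> sqrt (2 * (1 - 1))) F"
    by (intro tendsto_intros assms)
  then have "((\<lambda>n. sqrt (2 * (cosh (f n) - 1))) \<longlongrightarrow> 0) F" by simp
  then show ?thesis
    by (rule Lim_null_comparison[rotated]) (use le in simp)
qed

text \<open>The black edge between two infinitely long red edges collapses. The comparison
  \<open>X n \<le> Z n\<close> keeps the opposite red edge from growing faster than the sum of the
  other two, in which case the arc would stay long.\<close>

lemma facing_arc_tendsto_0:
  fixes X Y Z :: "nat \<Rightarrow> real"
  assumes "filterlim Y at_top sequentially" "filterlim Z at_top sequentially"
    and "\<And>n. X n > 0" "\<And>n. Y n > 0" "\<And>n. X n \<le> Z n"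
  shows "(\<lambda>n. facing_arc (X n) (Y n) (Z n)) \<longlonglongrightarrow> 0"
proof (rule tendsto_0_of_cosh_tendsto_1, 
    rule tendsto_sandwich[where f = "\<lambda>_. 1" and
      h = "\<lambda>n. 1 / tanh (Z n) * (1 / sinh (Y n) + 1 / tanh (Y n))"])
  have tanh1: "(\<lambda>n. tanh (W n)) \<longlonglongrightarrow> 1" if "filterlim W at_top sequentially" for W :: "nat \<Rightarrow> real"
    using filterlim_compose[OF tanh_real_at_top that] .
  have "(\<lambda>n. 1 / sinh (Y n)) \<longlonglongrightarrow> 0"
    using tendsto_divide_0[OF tendsto_const filterlim_at_top_imp_at_infinity[OF filterlim_compose[OF sinh_real_at_top assms(1)]]] .
  then have "(\<lambda>n. 1 / tanh (Z n) * (1 / sinh (Y n) + 1 / tanh (Y n))) \<longlonglongrightarrow> 1 / 1 * (0 + 1 / 1)"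
    using tanh1[OF assms(1)] tanh1[OF assms(2)] by (intro tendsto_intros) auto
  then show "(\<lambda>n. 1 / tanh (Z n) * (1 / sinh (Y n) + 1 / tanh (Y n))) \<longlonglongrightarrow> 1" by simp
  show "\<forall>\<^sub>F n in sequentially. cosh (facing_arc (X n) (Y n) (Z n)) \<le> 1 / tanh (Z n) * (1 / sinh (Y n) + 1 / tanh (Y n))"
  proof (intro always_eventually allI)
    fix n
    have "Z n > 0" using assms(3)[of n] assms(5)[of n] by linarith
    then show "cosh (facing_arc (X n) (Y n) (Z n)) \<le> 1 / tanh (Z n) * (1 / sinh (Y n) + 1 / tanh (Y n))"
      using assms(3-5) by (intro cosh_facing_arc_le)
  qed
  show "\<forall>\<^sub>F n in sequentially. 1 \<le> cosh (facing_arc (X n) (Y n) (Z n))"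
    by (simp add: cosh_real_ge_1)
qed simp

lemma cosh_le_imp_le:
  assumes "cosh x \<le> k" "k \<ge> 1"
  shows "\<bar>x\<bar> \<le> arcosh (k::real)"
proof (rule ccontr)
  assume "\<not> ?thesis"
  then have "cosh (arcosh k) < cosh \<bar>x\<bar>" using assms(2) by (intro cosh_real_strict_mono) auto
  then show False using assms by (simp add: cosh_arcosh_real)
qed

text \<open>With a single infinitely long red edge, the opposite black edge grows without bound
  while the two adjacent ones stay below the constant \<open>K\<close>.\<close>

lemma half_gap_at_bot:
  fixes X Y Z :: "nat \<Rightarrow> real"
  assumes X: "filterlim X at_top sequentially" and c: "c > 0" and C: "\<And>n. X n \<ge> c" "\<And>n. c \<le> Y n"
    "\<And>n. Y n \<le> C" "\<And>n. c \<le> Z n" "\<And>n. Z n \<le> C"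
  shows "filterlim (\<lambda>n. half_gap (X n) (Y n) (Z n)) at_bot sequentially"
proof -
  define K where "K = arcosh (cosh C / (sinh c)\<^sup>2 + (1 / tanh c)\<^sup>2 + 1)"
  have pos: "X n > 0" "Y n > 0" "Z n > 0" for n using c C[of n] by linarith+
  have le: "facing_arc x y z \<le> K" if "c \<le> x" "x \<le> C" "c \<le> y" "c \<le> z" for x y z
  proof -
    have "cosh x \<le> cosh C" using that c cosh_real_strict_mono[of x C] by (cases "x = C") auto
    then have "cosh x / (sinh c)\<^sup>2 \<le> cosh C / (sinh c)\<^sup>2" by (intro divide_right_mono) auto
    then have "cosh (facing_arc x y z) \<le> cosh C / (sinh c)\<^sup>2 + (1 / tanh c)\<^sup>2 + 1"
      using cosh_facing_arc_le_fixed[of c x y z] that c by linarith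
    then have "\<bar>facing_arc x y z\<bar> \<le> K"
      unfolding K_def using cosh_real_pos[of C] by (intro cosh_le_imp_le) auto
    then show ?thesis by simp
  qed
  have sC: "sinh C > 0" "c \<le> C" using c C[of 0] by auto
  have ge: "cosh (facing_arc (X n) (Y n) (Z n)) \<ge> cosh (X n) / (sinh C)\<^sup>2" for n
  proof -
    have "sinh (Y n) > 0" "sinh (Z n) > 0" "sinh (Y n) \<le> sinh C" "sinh (Z n) \<le> sinh C"
      using pos[of n] C[of n] by simp_all
    then have "cosh (X n) / (sinh C)\<^sup>2 \<le> cosh (X n) / (sinh (Y n) * sinh (Z n))"
      using cosh_real_pos[of "X n"] sC unfolding power2_eq_square
      by (intro divide_left_mono mult_mono mult_pos_pos) auto
    also have "\<dots> \<le> (cosh (X n) + cosh (Y n) * cosh (Z n)) / (sinh (Y n) * sinh (Z n))"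
      using cosh_real_pos[of "Y n"] cosh_real_pos[of "Z n"] pos[of n] by (intro divide_right_mono) auto
    finally show ?thesis unfolding cosh_facing_arc[OF pos] .
  qed
  have "filterlim (\<lambda>n. cosh (X n)) at_top sequentially"
    using filterlim_compose[OF cosh_real_at_top X] .
  show ?thesis
    unfolding filterlim_at_bot
  proof
    fix A :: real
    \<comment> \<open>An opposite arc longer than \<open>2 * K - 2 * A\<close> pushes the half gap
      below \<open>A\<close>; the absolute value allows comparing hyperbolic cosines.\<close>
    define D where "D = \<bar>2 * K - 2 * A\<bar>"
    have "\<forall>\<^sub>F n in sequentially. cosh (X n) > cosh D * (sinh C)\<^sup>2"
      using \<open>filterlim (\<lambda>n. cosh (X n)) at_top sequentially\<close> unfolding filterlim_at_top_dense by blast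
    then show "\<forall>\<^sub>F n in sequentially. half_gap (X n) (Y n) (Z n) \<le> A"
    proof eventually_elim
      case (elim n)
      then have "cosh D < cosh (X n) / (sinh C)\<^sup>2" using sC by (simp add: less_divide_eq)
      then have lt: "cosh D < cosh (facing_arc (X n) (Y n) (Z n))" using ge[of n] by linarith
      have "D < facing_arc (X n) (Y n) (Z n)"
      proof (rule ccontr)
        assume "\<not> ?thesis"
        then have "cosh (facing_arc (X n) (Y n) (Z n)) \<le> cosh D"
          using facing_arc_pos[OF pos, of n n n] cosh_real_strict_mono[of "facing_arc (X n) (Y n) (Z n)" D]
          by (cases "facing_arc (X n) (Y n) (Z n) = D") auto
        then show False using lt by simp
      qed
      then have "facing_arc (X n) (Y n) (Z n) > 2 * K - 2 * A" by (simp add: D_def)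
      moreover have "facing_arc (Y n) (Z n) (X n) \<le> K" "facing_arc (Z n) (X n) (Y n) \<le> K"
        using le C[of n] by simp_all
      ultimately show ?case by (simp add: half_gap_def)
    qed
  qed
qed

text \<open>A half gap can only be large if one of the other two in its hexagon is
  very negative, or if the red edge is short.\<close>

lemma half_gap_le:
  assumes "c > 0" "x \<ge> c" "y > 0" "z > 0" and K: "half_gap y z x \<ge> - K" "half_gap z x y \<ge> - K" "K \<ge> 0"
  shows "half_gap x y z \<le> ln (4 * exp (4 * K) / (tanh (c / 2))\<^sup>2) / 2"
proof -
  let ?r = "half_gap x y z" and ?r' = "half_gap y z x" and ?r'' = "half_gap z x y"
  have x: "x > 0" using assms by simp
  have t: "0 < tanh (c / 2)" "tanh (c / 2) \<le> tanh (x / 2)" using assms by simp_all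
  have cosh_ge: "exp u / 2 \<le> cosh u" for u :: real by (simp add: cosh_def)
  have cosh_le: "cosh u \<le> exp (u + 2 * K)" if "u \<ge> - K" for u
  proof -
    have "exp u \<le> exp (u + 2 * K)" "exp (- u) \<le> exp (u + 2 * K)" using that K(3) by simp_all
    from add_mono[OF this] show ?thesis unfolding cosh_field_def by simp
  qed
  have "(tanh (c / 2))\<^sup>2 * (exp (?r + ?r' + ?r'') / 2 * (exp ?r / 2))
    \<le> (tanh (x / 2))\<^sup>2 * (cosh (?r + ?r' + ?r'') * cosh ?r)"
    using t by (intro mult_mono power_mono cosh_ge) (auto simp: cosh_real_nonneg)
  also have "\<dots> = cosh ?r' * cosh ?r''" by (rule tanh_half_gap[OF x assms(3,4)])
  also have "\<dots> \<le> exp (?r' + 2 * K) * exp (?r'' + 2 * K)"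
    using K by (intro mult_mono cosh_le) (auto simp: cosh_real_nonneg)
  finally have "(tanh (c / 2))\<^sup>2 * (exp (?r + ?r' + ?r'') / 2 * (exp ?r / 2))
    \<le> exp (?r' + 2 * K) * exp (?r'' + 2 * K)" .
  \<comment> \<open>The other two half gaps have no upper bound, but \<open>exp\<close> of their sum
    occurs on both sides and cancels.\<close>
  moreover have "exp (?r + ?r' + ?r'') * exp ?r = exp (2 * ?r) * exp (?r' + ?r'')"
    "exp (?r' + 2 * K) * exp (?r'' + 2 * K) = exp (4 * K) * exp (?r' + ?r'')"
    by (simp_all add: algebra_simps flip: exp_add)
  ultimately have "(tanh (c / 2))\<^sup>2 * exp (2 * ?r) * exp (?r' + ?r'') \<le> 4 * exp (4 * K) * exp (?r' + ?r'')"
    by (simp add: mult.assoc)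
  then have "(tanh (c / 2))\<^sup>2 * exp (2 * ?r) \<le> 4 * exp (4 * K)" by simp
  then have "exp (2 * ?r) \<le> 4 * exp (4 * K) / (tanh (c / 2))\<^sup>2" using t by (simp add: field_simps)
  then have "2 * ?r \<le> ln (4 * exp (4 * K) / (tanh (c / 2))\<^sup>2)" using t by (subst ln_ge_iff) auto
  then show ?thesis by simp
qed

context side_pairing
begin

section \<open>Bounds on the half gaps for nonnegative exponents\<close>

lemma gap_antimono:
  assumes l: "l \<in> teichmueller" and s: "s \<in> sides" "t \<in> sides" "fst s = fst t" "s \<noteq> t" and le: "l $ ed s \<le> l $ ed t"
  shows "gap l t \<le> gap l s"
proof -
  have pos: "l $ e > 0" for e using l by (simp add: teichmueller_def)
  from other_side_cases[OF s] show ?thesis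
  proof
    assume t: "t = nxt s"
    show ?thesis unfolding gap_def t nxt_nxt_nxt[OF s(1)]
      using le unfolding t by (intro half_gap_antimono pos)
  next
    assume t: "t = nxt (nxt s)"
    then have e: "nxt t = s" "nxt (nxt t) = nxt s" using nxt_nxt_nxt[OF s(1)] by simp_all
    have "half_gap (l $ ed t) (l $ ed (nxt s)) (l $ ed s) \<le> half_gap (l $ ed s) (l $ ed t) (l $ ed (nxt s))"
      by (intro half_gap_antimono pos le)
    then show ?thesis unfolding gap_def e t[symmetric] by (metis half_gap_commute)
  qed
qed

text \<open>Two half gaps of a hexagon have a positive sum, so a negative one is the smallest and
  sits at the strictly longest red edge.\<close>

lemma gap_neg_imp_less:
  assumes l: "l \<in> teichmueller" and s: "s \<in> sides" "t \<in> sides" "fst s = fst t" "s \<noteq> t" and "gap l t < 0"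
  shows "l $ ed s < l $ ed t"
proof (rule ccontr)
  assume "\<not> ?thesis"
  then have "gap l s \<le> gap l t" using s by (intro gap_antimono l) auto
  then show False using gap_add_pos[OF l s] assms(6) by linarith
qed

text \<open>A very negative half gap forces a large one across the edge, hence another very negative one in the
  next hexagon, at a strictly longer edge. This can go on only as long as there are longer edges.\<close>

lemma gap_bounded_below:
  assumes lam: "lam \<ge> 0" and c: "c > 0"
  shows "\<exists>K\<ge>0. \<forall>l s. (\<forall>e. c \<le> l $ e) \<and> (\<forall>e. \<bar>edge_invariant lam l $ e\<bar> \<le> b) \<and> s \<in> sides
    \<and> card {e. l $ ed s < l $ e} < m \<longrightarrow> - K \<le> gap l s"
proof (induction m)
  case 0
  show ?case by (intro exI[of _ 0]) auto
next
  case (Suc m)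
  then obtain K where K: "K \<ge> 0" "\<And>l s. \<lbrakk>\<forall>e. c \<le> l $ e; \<forall>e. \<bar>edge_invariant lam l $ e\<bar> \<le> b;
      s \<in> sides; card {e. l $ ed s < l $ e} < m\<rbrakk> \<Longrightarrow> - K \<le> gap l s" by blast
  define K2 where "K2 = ln (4 * exp (4 * K) / (tanh (c / 2))\<^sup>2) / 2"
  define K3 where "K3 = max 0 (b + cosh_primitive lam K2)"
  have "- K3 \<le> gap l s" if A: "\<forall>e. c \<le> l $ e" "\<forall>e. \<bar>edge_invariant lam l $ e\<bar> \<le> b"
      "s \<in> sides" "card {e. l $ ed s < l $ e} < Suc m" for l s
  proof -
    have pos: "l $ e > 0" for e using A(1) c by (meson less_le_trans)
    then have l: "l \<in> teichmueller" by (simp add: teichmueller_def)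
    define s' where "s' = opp s"
    have s': "s' \<in> sides" "ed s' = ed s" using sides_of_edge(1,3)[OF A(3)] by (simp_all add: s'_def)
    \<comment> \<open>A negative half gap in the neighbouring hexagon sits at an edge strictly
      longer than that of \<open>s\<close>; fewer edges exceed it, so the induction hypothesis
      applies.\<close>
    have other: "- K \<le> gap l t" if t: "t \<in> sides" "fst s' = fst t" "s' \<noteq> t" for t
    proof (cases "gap l t < 0")
      case True
      then have "l $ ed s < l $ ed t" using gap_neg_imp_less[OF l s'(1) t] s'(2) by simp
      then have "{e. l $ ed t < l $ e} \<subset> {e. l $ ed s < l $ e}" by (auto intro: less_trans)
      then have "card {e. l $ ed t < l $ e} < card {e. l $ ed s < l $ e}" by (intro psubset_card_mono) auto
      then show ?thesis using K(2)[OF A(1,2) t(1)] A(4) by linarith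
    qed (use K(1) in linarith)
    have "gap l s' \<le> K2"
      unfolding gap_def K2_def
    proof (rule half_gap_le[OF c _ pos pos _ _ K(1)])
      show "c \<le> l $ ed s'" using A(1) by blast
      show "- K \<le> half_gap (l $ ed (nxt s')) (l $ ed (nxt (nxt s'))) (l $ ed s')"
        using other[of "nxt s'"] nxt_neq(1)[OF s'(1)] unfolding gap_def nxt_nxt_nxt[OF s'(1)] by simp
      show "- K \<le> half_gap (l $ ed (nxt (nxt s'))) (l $ ed s') (l $ ed (nxt s'))"
        using other[of "nxt (nxt s')"] nxt_neq(2)[OF s'(1)] unfolding gap_def nxt_nxt_nxt[OF s'(1)] by simp
    qed
    then have "cosh_primitive lam (gap l s') \<le> cosh_primitive lam K2" by simp
    moreover have "cosh_primitive lam (gap l s) + cosh_primitive lam (gap l s') \<ge> - b"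
      using A(2) edge_invariant_nth[OF A(3) refl, of lam l] unfolding s'_def by (metis abs_le_D2 minus_le_iff)
    ultimately have ge: "cosh_primitive lam (gap l s) \<ge> - (b + cosh_primitive lam K2)" by linarith
    show ?thesis
    proof (cases "gap l s < 0")
      case True
      \<comment> \<open>For \<open>lam \<ge> 0\<close> the primitive lies below the identity on
        negative arguments, so a lower bound for the primitive bounds the half gap itself.\<close>
      then have "cosh_primitive lam (gap l s) \<le> gap l s"
        using cosh_primitive_ge[OF lam, of "- gap l s"] by simp
      then show ?thesis using ge by (simp add: K3_def)
    qed (simp add: K3_def)
  qed
  then show ?case by (intro exI[of _ K3]) (auto simp: K3_def)
qed

text \<open>For \<open>m\<close> larger than the number of edges the cardinality condition always
  holds. The bound from above is the bound from below on the opposite side, carried across the edge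
  by the bounded invariant.\<close>

lemma gap_bounded:
  assumes lam: "lam \<ge> 0" and c: "c > 0"
  obtains K where "\<And>l s. \<lbrakk>\<forall>e. c \<le> l $ e; \<forall>e. \<bar>edge_invariant lam l $ e\<bar> \<le> b; s \<in> sides\<rbrakk> \<Longrightarrow> \<bar>gap l s\<bar> \<le> K"
proof -
  obtain K where K: "K \<ge> 0" "\<And>l s. \<lbrakk>\<forall>e. c \<le> l $ e; \<forall>e. \<bar>edge_invariant lam l $ e\<bar> \<le> b;
      s \<in> sides; card {e. l $ ed s < l $ e} < Suc CARD('e)\<rbrakk> \<Longrightarrow> - K \<le> gap l s"
    using gap_bounded_below[OF lam c, of b "Suc CARD('e)"] by blast
  have "\<bar>gap l s\<bar> \<le> max K (b + cosh_primitive lam K)"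
    if A: "\<forall>e. c \<le> l $ e" "\<forall>e. \<bar>edge_invariant lam l $ e\<bar> \<le> b" "s \<in> sides" for l s
  proof -
    have low: "- K \<le> gap l t" if "t \<in> sides" for t
      using K(2)[OF A(1,2) that] card_mono[of UNIV "{e. l $ ed t < l $ e}"] by (simp add: less_Suc_eq_le)
    have "- K \<le> gap l (opp s)" using low sides_of_edge(1)[OF A(3)] by blast
    then have "cosh_primitive lam (- K) \<le> cosh_primitive lam (gap l (opp s))" by (simp only: cosh_primitive_le_iff)
    moreover have "cosh_primitive lam (gap l s) + cosh_primitive lam (gap l (opp s)) \<le> b"
      using A(2) edge_invariant_nth[OF A(3) refl, of lam l] by (metis abs_le_D1)
    ultimately have up: "cosh_primitive lam (gap l s) \<le> b + cosh_primitive lam K" by simp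
    show ?thesis
    proof (cases "gap l s \<ge> 0")
      case True
      then show ?thesis using cosh_primitive_ge[OF lam True] up by simp
    next
      case False
      then show ?thesis using low[OF A(3)] by simp
    qed
  qed
  then show ?thesis by (rule that)
qed


section \<open>The image of the edge invariant\<close>

text \<open>In the hexagon with the shortest red edge, the half gap of that edge is the largest one.\<close>

lemma edge_lengths_bounded_below:
  assumes "\<And>n. l n \<in> teichmueller" and lim: "(\<lambda>n. edge_invariant lam (l n)) \<longlonglongrightarrow> z"
    and z: "z \<in> edge_polytope lam"
  obtains c where "c > 0" "\<forall>\<^sub>F n in sequentially. \<forall>e. c \<le> l n $ e"
proof -
  have "\<exists>A. z $ e < 2 * cosh_primitive lam A" for e
  proof (rule ccontr)
    assume "\<not> ?thesis"
    then have "cosh_primitive lam A \<le> z $ e / 2" for A by (simp add: not_less mult.commute)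
    then have "cosh_integral lam \<le> ereal (z $ e / 2)" by (rule cosh_integral_le)
    then have "2 * cosh_integral lam \<le> 2 * ereal (z $ e / 2)" by (intro ereal_mult_left_mono) auto
    moreover have "2 * ereal (z $ e / 2) = ereal (z $ e)" by simp
    moreover have "ereal (z $ e) < 2 * cosh_integral lam" using z unfolding edge_polytope_def by blast
    ultimately show False by simp
  qed
  then obtain A where A: "\<And>e. z $ e < 2 * cosh_primitive lam (A e)" by metis
  \<comment> \<open>The strict first condition is already witnessed at a finite upper limit for each
    edge; \<open>B\<close> serves for all edges at once.\<close>
  define B where "B = Max (range A)"
  have B: "z $ e < 2 * cosh_primitive lam B" for e
  proof -
    have "A e \<le> B" unfolding B_def by (intro Max_ge) auto
    then have "cosh_primitive lam (A e) \<le> cosh_primitive lam B" by simp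
    then show ?thesis using A[of e] by linarith
  qed
  have "\<forall>\<^sub>F n in sequentially. edge_invariant lam (l n) $ e < 2 * cosh_primitive lam B" for e
    using order_tendstoD(2)[OF tendsto_vec_nth[OF lim] B] .
  then have ev: "\<forall>\<^sub>F n in sequentially. \<forall>e. edge_invariant lam (l n) $ e < 2 * cosh_primitive lam B"
    by (rule eventually_all_finite)
  \<comment> \<open>If the shortest red edge were below \<open>c\<close>, its adjacent black edges
    would be longer than \<open>2 * B\<close>, both half gaps at it would exceed \<open>B\<close>,
    and its invariant would exceed the bound.\<close>
  define c where "c = arsinh (1 / cosh (2 * B))"
  have "1 / cosh (2 * B) > 0" using cosh_real_pos[of "2 * B"] by simp
  then have c: "c > 0" by (simp add: c_def)
  have "c \<le> l n $ e" if n: "\<forall>e. edge_invariant lam (l n) $ e < 2 * cosh_primitive lam B" for n e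
  proof -
    have tm: "l n \<in> teichmueller" by (rule assms(1))
    then have pos: "l n $ e > 0" for e by (simp add: teichmueller_def)
    have "Min (range (\<lambda>e. l n $ e)) \<in> range (\<lambda>e. l n $ e)" by (intro Min_in) auto
    then obtain e0 where e0: "Min (range (\<lambda>e. l n $ e)) = l n $ e0" by (rule rangeE)
    have min: "l n $ e0 \<le> l n $ e" for e unfolding e0[symmetric] by (intro Min_le) auto
    \<comment> \<open>The half gap of the shortest edge is the larger of two with sum
      \<open>\<theta>\<close>, hence at least \<open>\<theta> / 2\<close>.\<close>
    have gap_ge: "\<exists>\<theta>. \<theta> \<ge> 0 \<and> cosh \<theta> \<ge> 1 / sinh (l n $ e0) \<and> gap (l n) s \<ge> \<theta> / 2"
      if s: "s \<in> sides" "ed s = e0" for s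
    proof -
      have "gap (l n) (nxt s) \<le> gap (l n) s"
        using nxt_neq(1)[OF s(1)] min s(2) by (intro gap_antimono tm s(1)) auto
      moreover have "gap (l n) s + gap (l n) (nxt s) = facing_arc (l n $ ed (nxt (nxt s))) (l n $ e0) (l n $ ed (nxt s))"
        using gap_add[OF s(1), of "l n"] s(2) by simp
      ultimately show ?thesis
        using facing_arc_pos[OF pos pos pos, of "ed (nxt (nxt s))" e0 "ed (nxt s)"]
          cosh_facing_arc_ge[OF pos pos pos, of e0 "ed (nxt (nxt s))" "ed (nxt s)"]
        by (intro exI[of _ "facing_arc (l n $ ed (nxt (nxt s))) (l n $ e0) (l n $ ed (nxt s))"]) auto
    qed
    obtain s where s: "s \<in> sides" "ed s = e0" by (rule side_exists)
    have s': "opp s \<in> sides" "ed (opp s) = e0" using sides_of_edge(1,3)[OF s(1)] s(2) by simp_all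
    have "cosh_primitive lam (gap (l n) s) + cosh_primitive lam (gap (l n) (opp s)) < 2 * cosh_primitive lam B"
      using n edge_invariant_nth[OF s, of lam "l n"] by metis
    then have "cosh_primitive lam (gap (l n) s) < cosh_primitive lam B \<or> cosh_primitive lam (gap (l n) (opp s)) < cosh_primitive lam B"
      by linarith
    then have "gap (l n) s < B \<or> gap (l n) (opp s) < B" by simp
    then obtain \<theta> where th: "\<theta> \<ge> 0" "cosh \<theta> \<ge> 1 / sinh (l n $ e0)" "\<theta> / 2 < B"
      using gap_ge[OF s] gap_ge[OF s'] by (meson le_less_trans)
    have "cosh \<theta> < cosh (2 * B)" using th by (intro cosh_real_strict_mono) auto
    then have "1 / sinh (l n $ e0) < cosh (2 * B)" using th(2) by linarith
    then have "1 / cosh (2 * B) < sinh (l n $ e0)"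
      using pos[of e0] cosh_real_pos[of "2 * B"] by (simp add: field_simps)
    then have "arsinh (1 / cosh (2 * B)) < arsinh (sinh (l n $ e0))" by (simp only: arsinh_less_iff_real)
    then have "c < l n $ e0" by (simp add: c_def arsinh_sinh_real)
    then show ?thesis using min[of e] by linarith
  qed
  then have "\<forall>\<^sub>F n in sequentially. \<forall>e. c \<le> l n $ e" using ev by (auto elim: eventually_mono)
  with c show ?thesis by (rule that)
qed

lemma tendsto_length_of_tanh:
  fixes x :: "nat \<Rightarrow> real"
  assumes "(\<lambda>n. tanh (x n / 2)) \<longlonglongrightarrow> t" "\<And>n. x n > 0"
  shows "t < 1 \<Longrightarrow> x \<longlonglongrightarrow> 2 * artanh t" "t \<ge> 1 \<Longrightarrow> filterlim x at_top sequentially"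
proof -
  assume "t < 1"
  have "t \<ge> 0" using assms(2) by (intro LIMSEQ_le_const[OF assms(1)]) (auto simp: less_imp_le)
  then have "(\<lambda>n. artanh (tanh (x n / 2))) \<longlonglongrightarrow> artanh t"
    using \<open>t < 1\<close> by (intro tendsto_artanh assms(1)) auto
  then have "(\<lambda>n. x n / 2) \<longlonglongrightarrow> artanh t" by (simp add: artanh_tanh_real)
  from tendsto_mult_left[OF this, of 2] show "x \<longlonglongrightarrow> 2 * artanh t" by simp
next
  assume "t \<ge> 1"
  show "filterlim x at_top sequentially"
    unfolding filterlim_at_top_dense
  proof
    fix B :: real
    have "tanh (B / 2) < t" using tanh_real_lt_1[of "B / 2"] \<open>t \<ge> 1\<close> by linarith
    from order_tendstoD(1)[OF assms(1) this]
    show "\<forall>\<^sub>F n in sequentially. B < x n" by eventually_elim simp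
  qed
qed

text \<open>There are finitely many order patterns of the edge lengths, so one of them occurs
  infinitely often. The map \<open>tanh (x / 2)\<close> then compactifies the lengths: a limit below
  1 is a finite length, the limit 1 is divergence.\<close>

lemma length_subsequence:
  fixes l :: "nat \<Rightarrow> real^'e"
  assumes "\<And>n e. l n $ e > 0"
  obtains r L where "strict_mono r" "\<And>n e e'. l (r n) $ e \<le> l (r n) $ e' \<longleftrightarrow> l (r 0) $ e \<le> l (r 0) $ e'"
    "\<And>e. (\<lambda>n. l (r n) $ e) \<longlonglongrightarrow> L e \<or> filterlim (\<lambda>n. l (r n) $ e) at_top sequentially"
proof -
  define ord where "ord n = {(e, e'). l n $ e \<le> l n $ e'}" for n
  have "\<exists>a\<in>UNIV. infinite {n \<in> UNIV. ord n = ord a}"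
    by (rule pigeonhole_infinite) auto
  then obtain a where "infinite {n. ord n = ord a}" by auto
  then obtain r1 :: "nat \<Rightarrow> nat" where r1: "strict_mono r1" "\<And>n. ord (r1 n) = ord a"
    using infinite_enumerate by (metis (mono_tags) mem_Collect_eq)
  define t where "t n = (\<chi> e. tanh (l (r1 n) $ e / 2))" for n
  have "t n \<in> cbox 0 1" for n
    using assms by (auto simp: t_def mem_box_cart less_imp_le tanh_real_lt_1)
  then obtain \<tau> r2 where r2: "strict_mono r2" "(t \<circ> r2) \<longlonglongrightarrow> \<tau>"
    using compact_cbox[of "0 :: real^'e" 1] unfolding compact_def by metis
  define r where "r = r1 \<circ> r2"
  have lim: "(\<lambda>n. tanh (l (r n) $ e / 2)) \<longlonglongrightarrow> \<tau> $ e" for e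
    using tendsto_vec_nth[OF r2(2), of e] by (simp add: t_def r_def o_def)
  show ?thesis
  proof (rule that[of r "\<lambda>e. 2 * artanh (\<tau> $ e)"])
    show "strict_mono r" unfolding r_def by (intro strict_mono_o r1 r2)
    have o: "ord (r n) = ord a" for n using r1(2) by (simp add: r_def)
    have "l (r n) $ e \<le> l (r n) $ e' \<longleftrightarrow> (e, e') \<in> ord a" for n e e'
      unfolding o[of n, symmetric] by (simp add: ord_def)
    then show "l (r n) $ e \<le> l (r n) $ e' \<longleftrightarrow> l (r 0) $ e \<le> l (r 0) $ e'" for n e e' by simp
    show "(\<lambda>n. l (r n) $ e) \<longlonglongrightarrow> 2 * artanh (\<tau> $ e) \<or> filterlim (\<lambda>n. l (r n) $ e) at_top sequentially" for e
      using tendsto_length_of_tanh[OF lim[of e]] assms by (cases "\<tau> $ e < 1") auto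
  qed
qed

lemma continuous_edge_invariant:
  assumes "L \<in> teichmueller" "l \<longlonglongrightarrow> L"
  shows "(\<lambda>n. edge_invariant lam (l n)) \<longlonglongrightarrow> edge_invariant lam L"
  using has_derivative_continuous[OF edge_invariant_has_derivative[OF assms(1)]] assms(2)
  by (rule isCont_tendsto_compose)

text \<open>The degenerate case: a walk along infinitely long edges closes up to a cycle, along which the
  invariants sum up to 0, or is a path between two hexagons with only one infinitely long edge,
  where the half gaps tend to minus infinity.\<close>

lemma unbounded_lengths_leave_polytope:
  assumes l: "\<And>n e. c \<le> l n $ e" "c > 0"
    and ord: "\<And>n e e'. l n $ e \<le> l n $ e' \<longleftrightarrow> l 0 $ e \<le> l 0 $ e'"
    and L: "\<And>e. (\<lambda>n. l n $ e) \<longlonglongrightarrow> L e \<or> filterlim (\<lambda>n. l n $ e) at_top sequentially"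
    and lim: "(\<lambda>n. edge_invariant lam (l n)) \<longlonglongrightarrow> z" and z: "z \<in> edge_polytope lam"
    and e0: "filterlim (\<lambda>n. l n $ e0) at_top sequentially"
  shows False
proof -
  have pos: "l n $ e > 0" for n e using l by (meson less_le_trans)
  then have tm: "l n \<in> teichmueller" for n by (simp add: teichmueller_def)
  define B where "B = {s \<in> sides. filterlim (\<lambda>n. l n $ ed s) at_top sequentially}"
  \<comment> \<open>The longer of the two other red edges. Comparing at index 0 is enough as the
    order pattern is constant, so the walk is the same for all \<open>n\<close>.\<close>
  define nx where "nx s = (if l 0 $ ed (nxt (nxt s)) \<le> l 0 $ ed (nxt s) then nxt s else nxt (nxt s))" for s
  define f where "f n s = cosh_primitive lam (gap (l n) s)" for n s
  have nx: "nx s \<in> sides \<and> fst (nx s) = fst s \<and> nx s \<noteq> s" if "s \<in> sides" for s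
    using nxt_neq[OF that] by (simp add: nx_def)
  have Bs: "B \<subseteq> sides" by (auto simp: B_def)
  have oppB: "opp s \<in> B" if "s \<in> B" for s
    using that sides_of_edge(1,3)[of s] by (simp add: B_def)
  obtain s0 where s0: "s0 \<in> sides" "ed s0 = e0" by (rule side_exists)
  then have "s0 \<in> B" using e0 by (simp add: B_def)
  then have "B \<noteq> {}" by blast
  have pair: "\<exists>u. (\<lambda>n. facing_arc (l n $ ed u) (l n $ ed s) (l n $ ed (nx s))) \<longlonglongrightarrow> 0 \<and>
      (\<forall>n. gap (l n) s + gap (l n) (nx s) = facing_arc (l n $ ed u) (l n $ ed s) (l n $ ed (nx s)))"
    if s: "s \<in> B" "nx s \<in> B" for s
  proof -
    have ss: "s \<in> sides" using s Bs by blast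
    define u where "u = (if nx s = nxt s then nxt (nxt s) else nxt s)"
    have le: "l n $ ed u \<le> l n $ ed (nx s)" for n
      using ord[of n "ed u" "ed (nx s)"] by (auto simp: u_def nx_def)
    have "(\<lambda>n. facing_arc (l n $ ed u) (l n $ ed s) (l n $ ed (nx s))) \<longlonglongrightarrow> 0"
      using s pos le by (intro facing_arc_tendsto_0) (auto simp: B_def)
    moreover have "gap (l n) s + gap (l n) (nx s) = facing_arc (l n $ ed u) (l n $ ed s) (l n $ ed (nx s))" for n
    proof (cases "nx s = nxt s")
      case True
      then show ?thesis using gap_add[OF ss] by (simp add: u_def)
    next
      case False
      then have "nx s = nxt (nxt s)" "u = nxt s" by (auto simp: nx_def u_def split: if_splits)
      then show ?thesis using gap_add'[OF ss] by simp
    qed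
    ultimately show ?thesis by blast
  qed
  \<comment> \<open>Control of the gaps is transferred to their primitives by a Lipschitz constant
    uniform in \<open>n\<close>: it is 1 for \<open>lam \<le> 0\<close>, and otherwise comes from
    the uniform bound on the half gaps.\<close>
  have Lip: "\<exists>C. \<forall>n. f n s + f n t \<le> C * (gap (l n) s + gap (l n) t)"
    if st: "s \<in> sides" "t \<in> sides" "fst s = fst t" "s \<noteq> t" for s t
  proof (cases "lam \<le> 0")
    case True
    have "f n s + f n t \<le> 1 * (gap (l n) s + gap (l n) t)" for n
      unfolding f_def
    proof (rule cosh_primitive_add_le)
      show "gap (l n) s + gap (l n) t \<ge> 0" using gap_add_pos[OF tm st] by (rule less_imp_le)
      fix x :: real
      have "cosh x powr lam \<le> cosh x powr 0" using True cosh_real_ge_1 by (intro powr_mono)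
      then show "cosh x powr lam \<le> 1" using cosh_real_pos[of x] by simp
    qed
    then show ?thesis by blast
  next
    case False
    have "Bseq (\<lambda>n. edge_invariant lam (l n))" using lim convergentI convergent_imp_Bseq by blast
    then obtain b where b: "\<And>n. norm (edge_invariant lam (l n)) \<le> b" by (auto simp: Bseq_def)
    have "\<bar>edge_invariant lam (l n) $ e\<bar> \<le> b" for n e
      using component_le_norm_cart[of "edge_invariant lam (l n)" e] b[of n] by linarith
    moreover obtain K where K: "\<And>l s. \<lbrakk>\<forall>e. c \<le> l $ e; \<forall>e. \<bar>edge_invariant lam l $ e\<bar> \<le> b; s \<in> sides\<rbrakk> \<Longrightarrow> \<bar>gap l s\<bar> \<le> K"
      using gap_bounded[of lam c b] False l(2) by (metis less_imp_le not_le)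
    ultimately have gapK: "\<bar>gap (l n) s\<bar> \<le> K" if "s \<in> sides" for n s
      using l(1) that by simp
    have "f n s + f n t \<le> cosh K powr lam * (gap (l n) s + gap (l n) t)" for n
      unfolding f_def
    proof (rule cosh_primitive_add_le)
      show "gap (l n) s + gap (l n) t \<ge> 0" using gap_add_pos[OF tm st] by (rule less_imp_le)
      fix x assume "- gap (l n) t \<le> x" "x \<le> gap (l n) s"
      then have "\<bar>x\<bar> \<le> K" using gapK[OF st(1), of n] gapK[OF st(2), of n] by linarith
      then have "cosh \<bar>x\<bar> \<le> cosh K"
        using cosh_real_strict_mono[of "\<bar>x\<bar>" K] by (cases "\<bar>x\<bar> = K") auto
      then have "cosh x \<le> cosh K" by simp
      then show "cosh x powr lam \<le> cosh K powr lam"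
        using False cosh_real_pos[of x] by (intro powr_mono2) auto
    qed
    then show ?thesis by blast
  qed
  have pair_lim: "(\<lambda>n. f n s + f n (nx s)) \<longlonglongrightarrow> 0" if s: "s \<in> B" "nx s \<in> B" for s
  proof -
    have ss: "s \<in> sides" "nx s \<in> sides" "fst s = fst (nx s)" "s \<noteq> nx s"
      using s Bs nx[of s] by auto
    obtain u where u: "(\<lambda>n. facing_arc (l n $ ed u) (l n $ ed s) (l n $ ed (nx s))) \<longlonglongrightarrow> 0"
      "\<And>n. gap (l n) s + gap (l n) (nx s) = facing_arc (l n $ ed u) (l n $ ed s) (l n $ ed (nx s))"
      using pair[OF s] by blast
    obtain C where C: "\<And>n. f n s + f n (nx s) \<le> C * (gap (l n) s + gap (l n) (nx s))"
      using Lip[OF ss] by blast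
    have "(\<lambda>n. C * (gap (l n) s + gap (l n) (nx s))) \<longlonglongrightarrow> C * 0"
      unfolding u(2) by (intro tendsto_intros u(1))
    moreover have "f n s + f n (nx s) \<ge> 0" for n
      unfolding f_def by (intro less_imp_le cosh_primitive_add_pos gap_add_pos[OF tm ss])
    ultimately show ?thesis
      by (intro tendsto_sandwich[of "\<lambda>_. 0" "\<lambda>n. f n s + f n (nx s)" sequentially "\<lambda>n. C * (gap (l n) s + gap (l n) (nx s))" 0])
        (use C in auto)
  qed
  \<comment> \<open>The side \<open>nx s\<close> has the longer of the two other edges; as it is
    outside \<open>B\<close>, both other edges stay bounded and the half gap at \<open>s\<close>
    tends to minus infinity.\<close>
  have end_lim: "\<forall>\<^sub>F n in sequentially. f n s \<le> - cosh_primitive lam A" if s: "s \<in> B" "nx s \<notin> B" for s A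
  proof -
    have ss: "s \<in> sides" using s Bs by blast
    have "nx s \<in> sides" using nx[OF ss] by blast
    then have "(\<lambda>n. l n $ ed (nx s)) \<longlonglongrightarrow> L (ed (nx s))" using L[of "ed (nx s)"] s(2) by (auto simp: B_def)
    then have "Bseq (\<lambda>n. l n $ ed (nx s))" using convergentI convergent_imp_Bseq by blast
    then obtain C where C: "\<And>n. \<bar>l n $ ed (nx s)\<bar> \<le> C" by (auto simp: Bseq_def)
    have le: "l n $ ed (nxt s) \<le> l n $ ed (nx s)" "l n $ ed (nxt (nxt s)) \<le> l n $ ed (nx s)" for n
      using ord[of n "ed (nxt s)" "ed (nx s)"] ord[of n "ed (nxt (nxt s))" "ed (nx s)"] by (auto simp: nx_def)
    have leC: "l n $ ed (nxt s) \<le> C" "l n $ ed (nxt (nxt s)) \<le> C" for n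
      using le[of n] C[of n] by linarith+
    have "filterlim (\<lambda>n. gap (l n) s) at_bot sequentially"
      unfolding gap_def using s(1) l leC by (intro half_gap_at_bot[of _ c _ C]) (auto simp: B_def)
    then have "\<forall>\<^sub>F n in sequentially. gap (l n) s \<le> - A" unfolding filterlim_at_bot by blast
    then show ?thesis
    proof eventually_elim
      case (elim n)
      then have "cosh_primitive lam (gap (l n) s) \<le> cosh_primitive lam (- A)" by (simp only: cosh_primitive_le_iff)
      then show ?case by (simp add: f_def)
    qed
  qed
  have sum_lim: "(\<lambda>n. \<Sum>k=1..m. \<Sum>s\<in>{s \<in> sides. ed s = e k}. f n s) \<longlonglongrightarrow> (\<Sum>k=1..m. z $ e k)" for m e
  proof -
    have "(\<lambda>n. \<Sum>k=1..m. edge_invariant lam (l n) $ e k) \<longlonglongrightarrow> (\<Sum>k=1..m. z $ e k)"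
      by (intro tendsto_sum tendsto_vec_nth lim)
    then show ?thesis by (simp add: edge_invariant_def f_def)
  qed
  show False
  proof (rule walk_cases[of nx B, OF nx Bs \<open>B \<noteq> {}\<close> oppB])
    fix m H e q
    assume cycle: "fundamental_edge_cycle ed m H e" "\<And>k. k \<in> {1..m} \<Longrightarrow> q k \<in> B \<and> nx (q k) \<in> B"
      "\<And>f :: 'h \<times> nat \<Rightarrow> real. (\<Sum>k=1..m. \<Sum>s\<in>{s \<in> sides. ed s = e k}. f s) = (\<Sum>k=1..m. f (q k) + f (nx (q k)))"
    have "(\<lambda>n. \<Sum>k=1..m. f n (q k) + f n (nx (q k))) \<longlonglongrightarrow> (\<Sum>k=1..m. 0)"
      using cycle(2) by (intro tendsto_sum pair_lim) auto
    moreover have "(\<lambda>n. \<Sum>k=1..m. f n (q k) + f n (nx (q k))) \<longlonglongrightarrow> (\<Sum>k=1..m. z $ e k)"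
      using sum_lim[of e m] unfolding cycle(3) .
    ultimately have "(\<Sum>k=1..m. z $ e k) = (\<Sum>k=1..m. 0)" by (rule LIMSEQ_unique[symmetric])
    moreover have "(\<Sum>k=1..m. z $ e k) > 0" using z cycle(1) by (auto simp: edge_polytope_def)
    ultimately show False by simp
  next
    fix m H e q p
    assume path: "fundamental_edge_path ed m H e" "\<And>k. k \<in> {1..<m} \<Longrightarrow> q k \<in> B \<and> nx (q k) \<in> B"
      "p \<in> B" "nx p \<notin> B" "q m \<in> B" "nx (q m) \<notin> B"
      "\<And>f :: 'h \<times> nat \<Rightarrow> real. (\<Sum>k=1..m. \<Sum>s\<in>{s \<in> sides. ed s = e k}. f s)
         = f p + f (q m) + (\<Sum>k=1..<m. f (q k) + f (nx (q k)))"
    define S where "S = (\<Sum>k=1..m. z $ e k)"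
    \<comment> \<open>The interior pairs vanish in the limit and each end is eventually below
      \<open>- cosh_primitive lam A\<close>; as \<open>A\<close> is arbitrary, the strict second
      condition fails.\<close>
    have S_le: "S \<le> - (2 * cosh_primitive lam A)" for A
    proof (rule tendsto_le[OF sequentially_bot])
      have "(\<lambda>n. \<Sum>k=1..<m. f n (q k) + f n (nx (q k))) \<longlonglongrightarrow> (\<Sum>k=1..<m. 0)"
        using path(2) by (intro tendsto_sum pair_lim) auto
      then show "(\<lambda>n. - (2 * cosh_primitive lam A) + (\<Sum>k=1..<m. f n (q k) + f n (nx (q k)))) \<longlonglongrightarrow> - (2 * cosh_primitive lam A)"
        by (rule tendsto_eq_rhs[OF tendsto_add[OF tendsto_const]]) simp
      show "(\<lambda>n. f n p + f n (q m) + (\<Sum>k=1..<m. f n (q k) + f n (nx (q k)))) \<longlonglongrightarrow> S"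
        using sum_lim[of e m] unfolding path(7) S_def .
      show "\<forall>\<^sub>F n in sequentially. f n p + f n (q m) + (\<Sum>k=1..<m. f n (q k) + f n (nx (q k)))
        \<le> - (2 * cosh_primitive lam A) + (\<Sum>k=1..<m. f n (q k) + f n (nx (q k)))"
        using end_lim[OF path(3,4), of A] end_lim[OF path(5,6), of A]
        by eventually_elim simp
    qed
    have "cosh_primitive lam A \<le> - S / 2" for A using S_le[of A] by linarith
    then have "cosh_integral lam \<le> ereal (- S / 2)" by (rule cosh_integral_le)
    then have "2 * cosh_integral lam \<le> 2 * ereal (- S / 2)" by (intro ereal_mult_left_mono) auto
    then have "2 * cosh_integral lam \<le> - ereal S" by simp
    then have "ereal S \<le> - (2 * cosh_integral lam)" by (metis ereal_minus_le_minus ereal_uminus_uminus)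
    moreover have "ereal S > - (2 * cosh_integral lam)"
      using z path(1) unfolding S_def edge_polytope_def by blast
    ultimately show False by simp
  qed
qed

text \<open>Once no length tends to 0 or to infinity along a subsequence, the lengths converge
  inside Teichmueller space and continuity identifies the limit.\<close>

lemma edge_invariant_image_closed:
  assumes "\<And>n. l n \<in> teichmueller" and lim: "(\<lambda>n. edge_invariant lam (l n)) \<longlonglongrightarrow> z"
    and z: "z \<in> edge_polytope lam"
  shows "z \<in> edge_invariant lam ` teichmueller"
proof -
  obtain c where c: "c > 0" "\<forall>\<^sub>F n in sequentially. \<forall>e. c \<le> l n $ e"
    using edge_lengths_bounded_below[OF assms] .
  then obtain N where N: "\<And>n e. n \<ge> N \<Longrightarrow> c \<le> l n $ e" by (auto simp: eventually_sequentially)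
  define l1 where "l1 n = l (n + N)" for n
  have l1: "c \<le> l1 n $ e" "l1 n $ e > 0" for n e
    using N[of "n + N"] c(1) by (auto simp: l1_def intro: less_le_trans)
  obtain r L where r: "strict_mono r" "\<And>n e e'. l1 (r n) $ e \<le> l1 (r n) $ e' \<longleftrightarrow> l1 (r 0) $ e \<le> l1 (r 0) $ e'"
    "\<And>e. (\<lambda>n. l1 (r n) $ e) \<longlonglongrightarrow> L e \<or> filterlim (\<lambda>n. l1 (r n) $ e) at_top sequentially"
    by (rule length_subsequence[of l1, OF l1(2)]) (rule that)
  have lim1: "(\<lambda>n. edge_invariant lam (l1 (r n))) \<longlonglongrightarrow> z"
    using LIMSEQ_subseq_LIMSEQ[OF LIMSEQ_ignore_initial_segment[OF lim, of N] r(1)] by (simp add: l1_def o_def)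
  have "\<not> filterlim (\<lambda>n. l1 (r n) $ e) at_top sequentially" for e
    using unbounded_lengths_leave_polytope[of c "\<lambda>n. l1 (r n)" L lam z e, OF l1(1) c(1) r(2,3) lim1 z] by (rule notI)
  then have conv: "(\<lambda>n. l1 (r n) $ e) \<longlonglongrightarrow> L e" for e using r(3) by blast
  have "(\<lambda>n. l1 (r n)) \<longlonglongrightarrow> (\<chi> e. L e)" using conv by (intro vec_tendstoI) simp
  moreover have tm: "(\<chi> e. L e) \<in> teichmueller"
  proof -
    have "c \<le> L e" for e using l1(1) by (intro LIMSEQ_le_const[OF conv]) auto
    then show ?thesis using c(1) by (auto simp: teichmueller_def intro: less_le_trans)
  qed
  ultimately have "(\<lambda>n. edge_invariant lam (l1 (r n))) \<longlonglongrightarrow> edge_invariant lam (\<chi> e. L e)"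
    by (intro continuous_edge_invariant)
  then have "z = edge_invariant lam (\<chi> e. L e)" using lim1 LIMSEQ_unique by blast
  then show ?thesis using tm by blast
qed

lemma connected_edge_polytope: "connected (edge_polytope lam)"
proof -
  obtain F where "finite F \<and> edge_polytope lam = \<Inter>F \<and> (\<forall>h\<in>F. \<exists>a b. a \<noteq> 0 \<and> h = {x. a \<bullet> x < b})"
    using open_convex_polytope_edge_polytope[of lam] unfolding open_convex_polytope_def by (rule exE)
  then have F: "edge_polytope lam = \<Inter>F" "\<forall>h\<in>F. \<exists>a b. a \<noteq> 0 \<and> h = {x. a \<bullet> x < b}" by simp_all
  have "convex h" if "h \<in> F" for h
  proof -
    obtain a b where "h = {x. a \<bullet> x < b}" using F(2) \<open>h \<in> F\<close> by meson
    then show ?thesis by (simp add: convex_halfspace_lt)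
  qed
  then have "convex (\<Inter>F)" by (rule convex_Inter)
  then show ?thesis unfolding F(1) by (rule convex_connected)
qed

lemma edge_invariant_image: "edge_invariant lam ` teichmueller = edge_polytope lam"
proof -
  let ?I = "edge_invariant lam ` teichmueller"
  have sub: "?I \<subseteq> edge_polytope lam" using edge_invariant_in_edge_polytope by blast
  have "openin (top_of_set (edge_polytope lam)) ?I"
    using open_edge_invariant_image sub by (intro open_subset)
  moreover have "closedin (top_of_set (edge_polytope lam)) ?I"
    unfolding closedin_limpt
  proof (intro conjI allI impI sub)
    fix z assume "z islimpt ?I \<and> z \<in> edge_polytope lam"
    then obtain y where y: "\<And>n. y n \<in> ?I" "y \<longlonglongrightarrow> z" "z \<in> edge_polytope lam"
      by (auto simp: islimpt_sequential)
    then have "\<forall>n. \<exists>l. l \<in> teichmueller \<and> y n = edge_invariant lam l" by blast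
    then obtain l where l: "\<And>n. l n \<in> teichmueller" "\<And>n. y n = edge_invariant lam (l n)" by metis
    have "y = (\<lambda>n. edge_invariant lam (l n))" by (rule ext) (rule l(2))
    then show "z \<in> ?I" using y(2,3) by (intro edge_invariant_image_closed[of l] l(1)) simp_all
  qed
  ultimately have "?I = {} \<or> ?I = edge_polytope lam"
    using connected_edge_polytope unfolding connected_clopen by blast
  moreover have "(\<chi> e. 1) \<in> (teichmueller :: (real^'e) set)" by (simp add: teichmueller_def)
  ultimately show ?thesis by blast
qed

section \<open>Dependence of the polytope on the exponent\<close>

lemma edge_polytope_mono:
  assumes "cosh_integral lam \<le> cosh_integral mu"
  shows "edge_polytope lam \<subseteq> edge_polytope mu"
proof
  fix z assume z: "z \<in> edge_polytope lam"
  have le: "2 * cosh_integral lam \<le> 2 * cosh_integral mu" using assms by (intro ereal_mult_left_mono) auto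
  then have le': "- (2 * cosh_integral mu) \<le> - (2 * cosh_integral lam)" by simp
  show "z \<in> edge_polytope mu"
    using z less_le_trans[OF _ le] le_less_trans[OF le'] unfolding edge_polytope_def by blast
qed

lemma edge_polytope_strict_mono:
  assumes "lam < 0" and less: "cosh_integral lam < cosh_integral mu"
  shows "edge_polytope lam \<subset> edge_polytope mu"
proof
  show "edge_polytope lam \<subseteq> edge_polytope mu" using less by (intro edge_polytope_mono less_imp_le)
  obtain C where C: "cosh_integral lam = ereal C" using cosh_integral_finite[OF assms(1)] .
  then have "C > 0" using cosh_integral_pos[of lam] by simp
  \<comment> \<open>This point lies on the boundary hyperplanes of the first condition for
    \<open>lam\<close>, hence violates it, while all its path sums are positive.\<close>
  define z :: "real^'e" where "z = (\<chi> e. 2 * C)"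
  have "2 * ereal C < 2 * cosh_integral mu"
    using less unfolding C by (cases "cosh_integral mu") auto
  then have 1: "ereal (z $ e) < 2 * cosh_integral mu" for e by (simp add: z_def)
  have sum_pos: "(\<Sum>i=1..n. z $ e i) > 0" if "edge_path ed n H e" for n H e
    using that \<open>C > 0\<close> by (auto simp: z_def edge_path_def edge_path_via_def)
  have 3: "(\<Sum>i=1..n. z $ e i) > 0" if "fundamental_edge_cycle ed n H e" for n H e
    using that by (intro sum_pos[of n H]) (auto simp: fundamental_edge_cycle_def edge_cycle_def edge_path_def)
  have 2: "ereal (\<Sum>i=1..n. z $ e i) > - (2 * cosh_integral mu)" if "fundamental_edge_path ed n H e" for n H e
  proof -
    have "- (2 * cosh_integral mu) < 0" using cosh_integral_pos[of mu] by (cases "cosh_integral mu") auto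
    also have "(0::ereal) < ereal (\<Sum>i=1..n. z $ e i)"
      using sum_pos[of n H e] that by (simp add: fundamental_edge_path_def)
    finally show ?thesis .
  qed
  have "z \<in> edge_polytope mu" unfolding edge_polytope_def using 1 2 3 by blast
  moreover have "z \<notin> edge_polytope lam" by (simp add: edge_polytope_def C z_def)
  ultimately show "edge_polytope lam \<noteq> edge_polytope mu" by blast
qed

text \<open>As the exponent tends to minus infinity, the first condition forces all coordinates to
  be nonpositive; but the point also belongs to the image for exponent 0, where the coordinate sum
  is positive.\<close>

lemma Inter_edge_polytope: "(\<Inter>lam\<in>{..0::real}. edge_polytope lam) = {}"
proof -
  have False if z: "\<And>lam. lam \<le> 0 \<Longrightarrow> z \<in> edge_polytope lam" for z
  proof -
    have "z $ e \<le> 0" for e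
    proof (rule LIMSEQ_le_const)
      have "(\<lambda>n. sqrt (2 / real n) * pi) \<longlonglongrightarrow> sqrt 0 * pi"
        by (intro tendsto_mult tendsto_const tendsto_real_sqrt lim_const_over_n)
      then show "(\<lambda>n. sqrt (2 / real n) * pi) \<longlonglongrightarrow> 0" by simp
      have "z $ e \<le> sqrt (2 / real n) * pi" if "n \<ge> 1" for n
      proof -
        have "ereal (z $ e) < 2 * cosh_integral (- real n)" using z[of "- real n"] by (simp add: edge_polytope_def)
        also have "\<dots> \<le> 2 * ereal (sqrt (2 / real n) * pi / 2)"
          using cosh_integral_minus_nat_le[OF that] by (intro ereal_mult_left_mono) auto
        finally show ?thesis by simp
      qed
      then show "\<exists>N. \<forall>n\<ge>N. z $ e \<le> sqrt (2 / real n) * pi" by blast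
    qed
    moreover obtain l where "l \<in> teichmueller" "z = edge_invariant 0 l"
      using z[of 0] edge_invariant_image[of 0] by blast
    ultimately show False
      using sum_edge_invariant_pos[of l 0] sum_nonpos[of UNIV "\<lambda>e. z $ e"] by simp
  qed
  then show ?thesis by blast
qed

end

theorem theorem1p3:
  fixes S :: "'a topology"
    and q :: "'h::finite \<times> complex \<Rightarrow> 'a"
    and ed :: "'h \<times> nat \<Rightarrow> 'e::finite"
  assumes "ideal_triangulation S q ed"
    and "connected_space S"
  shows
    "(\<forall>lam::real. Psi ed lam ` teichmueller =
        {z :: real^'e.
           (\<forall>e. ereal (z $ e) < 2 * cosh_integral lam) \<and>
           (\<forall>n H e. fundamental_edge_path ed n H e \<longrightarrow>
              ereal (\<Sum>i=1..n. z $ e i) > - (2 * cosh_integral lam)) \<and>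
           (\<forall>n H e. fundamental_edge_cycle ed n H e \<longrightarrow> (\<Sum>i=1..n. z $ e i) > 0)}) \<and>
     (\<forall>lam::real. open_convex_polytope (Psi ed lam ` teichmueller)) \<and>
     (\<forall>lam1 lam2 lam3 :: real. lam1 < lam2 \<and> lam2 < 0 \<and> 0 < lam3 \<longrightarrow>
        Psi ed lam1 ` teichmueller \<subset> Psi ed lam2 ` teichmueller \<and>
        Psi ed lam2 ` teichmueller \<subset> Psi ed 0 ` teichmueller \<and>
        Psi ed 0 ` teichmueller = Psi ed lam3 ` teichmueller) \<and>
     (\<Inter>lam\<in>{..0::real}. Psi ed lam ` teichmueller) = {}"
proof -
  interpret side_pairing ed
    by standard (use assms(1) in \<open>simp add: ideal_triangulation_def\<close>)
  have eq: "Psi ed lam ` teichmueller = edge_polytope lam" for lam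
    unfolding Psi_image by (rule edge_invariant_image)
  have strict: "edge_polytope lam1 \<subset> edge_polytope lam2 \<and> edge_polytope lam2 \<subset> edge_polytope 0
      \<and> edge_polytope 0 = edge_polytope lam3" if "lam1 < lam2 \<and> lam2 < 0 \<and> 0 < lam3" for lam1 lam2 lam3
  proof (intro conjI)
    show "edge_polytope lam1 \<subset> edge_polytope lam2"
      using that by (intro edge_polytope_strict_mono cosh_integral_strict_mono) auto
    have "lam2 < 0" using that by blast
    then obtain C where "cosh_integral lam2 = ereal C" by (rule cosh_integral_finite)
    then show "edge_polytope lam2 \<subset> edge_polytope 0"
      using that by (intro edge_polytope_strict_mono) (auto simp: cosh_integral_nonneg_exponent)
    show "edge_polytope 0 = edge_polytope lam3"
      using that by (simp add: edge_polytope_def cosh_integral_nonneg_exponent)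
  qed
  have "\<forall>lam1 lam2 lam3. lam1 < lam2 \<and> lam2 < 0 \<and> 0 < lam3 \<longrightarrow>
     edge_polytope lam1 \<subset> edge_polytope lam2 \<and> edge_polytope lam2 \<subset> edge_polytope 0
      \<and> edge_polytope 0 = edge_polytope lam3"
    by (intro allI impI strict)
  from conjI[OF this Inter_edge_polytope] show ?thesis
    unfolding eq by (intro conjI[OF allI conjI[OF allI]] edge_polytope_def open_convex_polytope_edge_polytope)
qed

end
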